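(* Let $A$ and $R$ be small Reedy categories, let $\mathsf{aSet}=\mathsf{Set}^{A^{\mathrm{op}}}$ be equipped with a Cisinski cofibration category structure (i.e. a cofibration category structure whose cofibrations are exactly the monomorphisms), and let $d\colon \mathsf{arSet}=\mathsf{Set}^{A^{\mathrm{op}}\times R^{\mathrm{op}}}\to\mathsf{aSet}$ be a diagonal functor. Let $f\colon X\to Y$ be a morphism in $\mathsf{arSet}$ between presheaves that are Reedy cofibrant when viewed as diagrams $R^{\mathrm{op}}\to\mathsf{aSet}$, and suppose that $f_r\colon X_r\to Y_r$ is a weak equivalence in $\mathsf{aSet}$ for every object $r\in R$. Then $d f\colon dX\to dY$ is a weak equivalence in $\mathsf{aSet}$.
   Context: Reedy category: a category $R$ with a function $\deg\colon \mathrm{ob}\,R\to\mathbb{N}$ and two wide subcategories $R_-$, $R_+$ such that (1) every non-identity map $r\to s$ in $R_-$ has $\deg r>\deg s$ and every non-identity map $r\to s$ in $R_+$ has $\deg r<\deg s$; (2) every morphism $\varphi$ of $R$ has a unique factorization $\varphi=\varphi_+\varphi_-$ with $\varphi_-\in R_-$, $\varphi_+\in R_+$. Notation: $\mathsf{aSet}$, $\mathsf{rSet}$, $\mathsf{arSet}$ are the categories of presheaves of sets on $A$, $R$, $A\times R$. For $X\in\mathsf{arSet}$ and $r\in R$, $X_r=X(-,r)\in\mathsf{aSet}$; thus $X$ is identified with a diagram $R^{\mathrm{op}}\to\mathsf{aSet}$. Cofibration category: a category $\mathsf{C}$ with two wide subcategories, of cofibrations and of weak equivalences (a map in both is an acyclic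 cofibration), such that: (1) weak equivalences satisfy 2-out-of-3; (2) $\mathsf{C}$ has an initial object $\varnothing$ and every $\varnothing\to X$ is a cofibration; (3) for every $X$ the codiagonal $X\sqcup X\to X$ factors as a cofibration followed by a weak equivalence; (4) pushouts along cofibrations exist, and the pushout of an (acyclic) cofibration is an (acyclic) cofibration; (5) small coproducts exist, and a coproduct of (acyclic) cofibrations is an (acyclic) cofibration; (6) for a countable sequence of (acyclic) cofibrations $X_0\to X_1\to X_2\to\cdots$ the colimit exists and the maps $X_i\to\operatorname{colim}X_i$ are (acyclic) cofibrations. Reedy cofibrancy: for $r\in R$, the latching category $\partial(r\downarrow R_-)$ is the full subcategory of the slice $r\downarrow R_-$ (objects: morphisms $r\to s$ in $R_-$) on the non-identity morphisms. The latching object of a diagram $X\colon R^{\mathrm{op}}\to\mathsf{C}$ at $r$ is $L_rX=\operatorname{colim}\big(\partial(r\downarrow R_-)^{\mathrm{op}}\to R^{\mathrm{op}}\xrightarrow{X}\mathsf{C}\big)$, where the first functor is $(r\to s)\mapsto s$. $X$ is Reedy cofibrant if the induced map $L_rX\to X_r$ is a cofibration for all $r\in R$ (for $\mathsf{C}=\mathsf{aSet}$ here: a monomorphism). External product: $K\mathbin{\underline{\times}}L\in\mathsf{arSet}$ for $K\in\mathsf{aSet}$, $L\in\mathsf{rSet}$ is given by $(K\mathbin{\underline{\times}}L)_{a,r}=K_a\times L_r$. Diagonal functor: a functor $d\colon\mathsf{arSet}\to\mathsf{aSet}$ that preserves colimits, preserves monomorphisms, and is such that for every $K\in\mathsf{rSet}$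 the composite $d(-\mathbin{\underline{\times}}K)\colon\mathsf{aSet}\to\mathsf{aSet}$ preserves weak equivalences. *)

theory Defs
  imports Main "HOL-Library.FuncSet"
begin

section \<open>Universes of small sets\<close>

text \<open>
  \<open>U\<close> is the collection of small sets, all of them subsets of one type \<open>'v\<close>. The sets belonging to a
  Grothendieck universe are an instance; closure under power sets is not required, and therefore
  the collection of all subsets of an infinite type is an instance too.
\<close>

definition set_universe :: "'v set set \<Rightarrow> bool" where
  "set_universe U \<longleftrightarrow>
     (\<exists>S\<in>U. infinite S) \<and>
     (\<forall>S\<in>U. \<forall>T. T \<subseteq> S \<longrightarrow> T \<in> U) \<and>
     (\<forall>S\<in>U. \<forall>f. f ` S \<in> U) \<and>
     (\<forall>I\<in>U. \<forall>S. (\<forall>i\<in>I. S i \<in> U) \<longrightarrow> (\<Union>i\<in>I. S i) \<in> U)"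

definition small :: "'v set set \<Rightarrow> 'x set \<Rightarrow> bool" where
  "small U S \<longleftrightarrow> (\<exists>g. inj_on g S \<and> g ` S \<in> U)"

text \<open>A pairing that encodes binary products of subsets of \<open>'v\<close> as subsets of \<open>'v\<close>.\<close>

definition vpair :: "'v \<times> 'v \<Rightarrow> 'v" where
  "vpair = (SOME p. inj p)"

lemma inj_vpair:
  assumes "infinite (UNIV :: 'v set)"
  shows "inj (vpair :: 'v \<times> 'v \<Rightarrow> 'v)"
proof -
  have "(card_of (UNIV \<times> UNIV :: ('v \<times> 'v) set), card_of (UNIV :: 'v set)) \<in> ordIso"
    using card_of_Times_same_infinite[OF assms] .
  then obtain p :: "'v \<times> 'v \<Rightarrow> 'v" where "bij_betw p (UNIV \<times> UNIV) UNIV"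
    using card_of_ordIso by blast
  then have "inj p" by (simp add: bij_betw_def)
  then show ?thesis unfolding vpair_def by (rule someI[where P = inj])
qed

section \<open>Categories\<close>

record ('o, 'm) cat =
  Obj :: "'o set"
  Arr :: "'m set"
  Dom :: "'m \<Rightarrow> 'o"
  Cod :: "'m \<Rightarrow> 'o"
  Idt :: "'o \<Rightarrow> 'm"
  Cmp :: "'m \<Rightarrow> 'm \<Rightarrow> 'm"  (infixl "\<cdot>\<index>" 70)

definition hom :: "('o, 'm) cat \<Rightarrow> 'o \<Rightarrow> 'o \<Rightarrow> 'm set" where
  "hom C a b = {f \<in> Arr C. Dom C f = a \<and> Cod C f = b}"

definition category :: "('o, 'm) cat \<Rightarrow> bool" where
  "category C \<longleftrightarrow>
     (\<forall>f\<in>Arr C. Dom C f \<in> Obj C \<and> Cod C f \<in> Obj C) \<and>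
     (\<forall>a\<in>Obj C. Idt C a \<in> hom C a a) \<and>
     (\<forall>f\<in>Arr C. \<forall>g\<in>Arr C. Cod C f = Dom C g \<longrightarrow> g \<cdot>\<^bsub>C\<^esub> f \<in> hom C (Dom C f) (Cod C g)) \<and>
     (\<forall>f\<in>Arr C. Idt C (Cod C f) \<cdot>\<^bsub>C\<^esub> f = f \<and> f \<cdot>\<^bsub>C\<^esub> Idt C (Dom C f) = f) \<and>
     (\<forall>f\<in>Arr C. \<forall>g\<in>Arr C. \<forall>h\<in>Arr C. Cod C f = Dom C g \<longrightarrow> Cod C g = Dom C h \<longrightarrow>
        (h \<cdot>\<^bsub>C\<^esub> g) \<cdot>\<^bsub>C\<^esub> f = h \<cdot>\<^bsub>C\<^esub> (g \<cdot>\<^bsub>C\<^esub> f))"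

definition small_category :: "'v set set \<Rightarrow> ('o, 'm) cat \<Rightarrow> bool" where
  "small_category U C \<longleftrightarrow> category C \<and> small U (Obj C) \<and> small U (Arr C)"

definition wide_subcategory :: "('o, 'm) cat \<Rightarrow> 'm set \<Rightarrow> bool" where
  "wide_subcategory C S \<longleftrightarrow>
     S \<subseteq> Arr C \<and> (\<forall>a\<in>Obj C. Idt C a \<in> S) \<and>
     (\<forall>f\<in>S. \<forall>g\<in>S. Cod C f = Dom C g \<longrightarrow> g \<cdot>\<^bsub>C\<^esub> f \<in> S)"

definition mono_arrows :: "('o, 'm) cat \<Rightarrow> 'm set" where
  "mono_arrows C = {f \<in> Arr C. \<forall>g\<in>Arr C. \<forall>h\<in>Arr C.
     Dom C g = Dom C h \<longrightarrow> Cod C g = Dom C f \<longrightarrow> Cod C h = Dom C f \<longrightarrow>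
     f \<cdot>\<^bsub>C\<^esub> g = f \<cdot>\<^bsub>C\<^esub> h \<longrightarrow> g = h}"

definition op_cat :: "('o, 'm) cat \<Rightarrow> ('o, 'm) cat" where
  "op_cat C = \<lparr>Obj = Obj C, Arr = Arr C, Dom = Cod C, Cod = Dom C, Idt = Idt C,
     Cmp = (\<lambda>g f. f \<cdot>\<^bsub>C\<^esub> g)\<rparr>"

definition prod_cat :: "('o, 'm) cat \<Rightarrow> ('p, 'n) cat \<Rightarrow> ('o \<times> 'p, 'm \<times> 'n) cat" where
  "prod_cat C D = \<lparr>Obj = Obj C \<times> Obj D, Arr = Arr C \<times> Arr D,
     Dom = map_prod (Dom C) (Dom D), Cod = map_prod (Cod C) (Cod D),
     Idt = map_prod (Idt C) (Idt D),
     Cmp = (\<lambda>g f. (fst g \<cdot>\<^bsub>C\<^esub> fst f, snd g \<cdot>\<^bsub>D\<^esub> snd f))\<rparr>"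

definition wide_cat :: "('o, 'm) cat \<Rightarrow> 'm set \<Rightarrow> ('o, 'm) cat" where
  "wide_cat C S = C\<lparr>Arr := S\<rparr>"

definition full_cat :: "('o, 'm) cat \<Rightarrow> 'o set \<Rightarrow> ('o, 'm) cat" where
  "full_cat C S = C\<lparr>Obj := Obj C \<inter> S, Arr := {f \<in> Arr C. Dom C f \<in> S \<and> Cod C f \<in> S}\<rparr>"

text \<open>The slice \<open>r \<down> C\<close>: a triple \<open>(f, u, g)\<close> is the arrow from \<open>f\<close> to \<open>g\<close> given by \<open>u\<close>.\<close>

definition under_cat :: "('o, 'm) cat \<Rightarrow> 'o \<Rightarrow> ('m, 'm \<times> 'm \<times> 'm) cat" where
  "under_cat C r = \<lparr>Obj = {f \<in> Arr C. Dom C f = r},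
     Arr = {(f, u, g). f \<in> Arr C \<and> Dom C f = r \<and> g \<in> Arr C \<and> Dom C g = r \<and>
                       u \<in> hom C (Cod C f) (Cod C g) \<and> u \<cdot>\<^bsub>C\<^esub> f = g},
     Dom = (\<lambda>(f, u, g). f), Cod = (\<lambda>(f, u, g). g),
     Idt = (\<lambda>f. (f, Idt C (Cod C f), f)),
     Cmp = (\<lambda>(g, v, h) (f, u, g'). (f, v \<cdot>\<^bsub>C\<^esub> u, h))\<rparr>"

section \<open>Functors and colimits\<close>

record ('o, 'm, 'p, 'n) func =
  Fob :: "'o \<Rightarrow> 'p"
  Far :: "'m \<Rightarrow> 'n"

definition is_functor ::
    "('o, 'm) cat \<Rightarrow> ('p, 'n) cat \<Rightarrow> ('o, 'm, 'p, 'n) func \<Rightarrow> bool" where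
  "is_functor C D F \<longleftrightarrow>
     (\<forall>a\<in>Obj C. Fob F a \<in> Obj D) \<and>
     (\<forall>f\<in>Arr C. Far F f \<in> hom D (Fob F (Dom C f)) (Fob F (Cod C f))) \<and>
     (\<forall>a\<in>Obj C. Far F (Idt C a) = Idt D (Fob F a)) \<and>
     (\<forall>f\<in>Arr C. \<forall>g\<in>Arr C. Cod C f = Dom C g \<longrightarrow>
        Far F (g \<cdot>\<^bsub>C\<^esub> f) = Far F g \<cdot>\<^bsub>D\<^esub> Far F f)"

definition comp_func ::
    "('p, 'n, 'q, 'l) func \<Rightarrow> ('o, 'm, 'p, 'n) func \<Rightarrow> ('o, 'm, 'q, 'l) func" where
  "comp_func G F = \<lparr>Fob = Fob G \<circ> Fob F, Far = Far G \<circ> Far F\<rparr>"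

definition is_cocone ::
    "('i, 'j) cat \<Rightarrow> ('o, 'm) cat \<Rightarrow> ('i, 'j, 'o, 'm) func \<Rightarrow> 'o \<Rightarrow> ('i \<Rightarrow> 'm) \<Rightarrow> bool" where
  "is_cocone J C D x \<iota> \<longleftrightarrow>
     x \<in> Obj C \<and> (\<forall>i\<in>Obj J. \<iota> i \<in> hom C (Fob D i) x) \<and>
     (\<forall>u\<in>Arr J. \<iota> (Cod J u) \<cdot>\<^bsub>C\<^esub> Far D u = \<iota> (Dom J u))"

definition is_colimit ::
    "('i, 'j) cat \<Rightarrow> ('o, 'm) cat \<Rightarrow> ('i, 'j, 'o, 'm) func \<Rightarrow> 'o \<Rightarrow> ('i \<Rightarrow> 'm) \<Rightarrow> bool" where
  "is_colimit J C D x \<iota> \<longleftrightarrow>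
     is_cocone J C D x \<iota> \<and>
     (\<forall>y \<kappa>. is_cocone J C D y \<kappa> \<longrightarrow> (\<exists>!h. h \<in> hom C x y \<and> (\<forall>i\<in>Obj J. h \<cdot>\<^bsub>C\<^esub> \<iota> i = \<kappa> i)))"

text \<open>
  Every small index category is isomorphic to one whose objects and arrows are elements of \<open>'v\<close>.
\<close>

definition preserves_colimits ::
    "'v set set \<Rightarrow> ('o, 'm) cat \<Rightarrow> ('p, 'n) cat \<Rightarrow> ('o, 'm, 'p, 'n) func \<Rightarrow> bool" where
  "preserves_colimits U C D F \<longleftrightarrow>
     (\<forall>(J :: ('v, 'v) cat) X x \<iota>. small_category U J \<longrightarrow> is_functor J C X \<longrightarrow>
        is_colimit J C X x \<iota> \<longrightarrow>
        is_colimit J D (comp_func F X) (Fob F x) (\<lambda>i. Far F (\<iota> i)))"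

definition preserves_monos ::
    "('o, 'm) cat \<Rightarrow> ('p, 'n) cat \<Rightarrow> ('o, 'm, 'p, 'n) func \<Rightarrow> bool" where
  "preserves_monos C D F \<longleftrightarrow> (\<forall>f\<in>mono_arrows C. Far F f \<in> mono_arrows D)"

definition is_initial :: "('o, 'm) cat \<Rightarrow> 'o \<Rightarrow> bool" where
  "is_initial C e \<longleftrightarrow> e \<in> Obj C \<and> (\<forall>x\<in>Obj C. \<exists>!f. f \<in> hom C e x)"

definition is_coproduct ::
    "('o, 'm) cat \<Rightarrow> 'i set \<Rightarrow> ('i \<Rightarrow> 'o) \<Rightarrow> 'o \<Rightarrow> ('i \<Rightarrow> 'm) \<Rightarrow> bool" where
  "is_coproduct C I X p \<iota> \<longleftrightarrow>
     p \<in> Obj C \<and> (\<forall>i\<in>I. \<iota> i \<in> hom C (X i) p) \<and>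
     (\<forall>y\<in>Obj C. \<forall>\<kappa>. (\<forall>i\<in>I. \<kappa> i \<in> hom C (X i) y) \<longrightarrow>
        (\<exists>!h. h \<in> hom C p y \<and> (\<forall>i\<in>I. h \<cdot>\<^bsub>C\<^esub> \<iota> i = \<kappa> i)))"

text \<open>
  \<open>i : a \<rightarrow> b\<close> and \<open>g : a \<rightarrow> c\<close> have the pushout \<open>p\<close> with \<open>g' : b \<rightarrow> p\<close> and \<open>i' : c \<rightarrow> p\<close>.
\<close>

definition is_pushout :: "('o, 'm) cat \<Rightarrow> 'm \<Rightarrow> 'm \<Rightarrow> 'm \<Rightarrow> 'm \<Rightarrow> bool" where
  "is_pushout C i g g' i' \<longleftrightarrow>
     i \<in> Arr C \<and> g \<in> Arr C \<and> g' \<in> Arr C \<and> i' \<in> Arr C \<and>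
     Dom C i = Dom C g \<and> Dom C g' = Cod C i \<and> Dom C i' = Cod C g \<and> Cod C g' = Cod C i' \<and>
     g' \<cdot>\<^bsub>C\<^esub> i = i' \<cdot>\<^bsub>C\<^esub> g \<and>
     (\<forall>y\<in>Obj C. \<forall>s\<in>hom C (Cod C i) y. \<forall>t\<in>hom C (Cod C g) y. s \<cdot>\<^bsub>C\<^esub> i = t \<cdot>\<^bsub>C\<^esub> g \<longrightarrow>
        (\<exists>!h. h \<in> hom C (Cod C g') y \<and> h \<cdot>\<^bsub>C\<^esub> g' = s \<and> h \<cdot>\<^bsub>C\<^esub> i' = t))"

definition is_seq_colimit ::
    "('o, 'm) cat \<Rightarrow> (nat \<Rightarrow> 'o) \<Rightarrow> (nat \<Rightarrow> 'm) \<Rightarrow> 'o \<Rightarrow> (nat \<Rightarrow> 'm) \<Rightarrow> bool" where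
  "is_seq_colimit C X f x \<iota> \<longleftrightarrow>
     x \<in> Obj C \<and> (\<forall>n. \<iota> n \<in> hom C (X n) x) \<and> (\<forall>n. \<iota> (Suc n) \<cdot>\<^bsub>C\<^esub> f n = \<iota> n) \<and>
     (\<forall>y\<in>Obj C. \<forall>\<kappa>. (\<forall>n. \<kappa> n \<in> hom C (X n) y) \<longrightarrow> (\<forall>n. \<kappa> (Suc n) \<cdot>\<^bsub>C\<^esub> f n = \<kappa> n) \<longrightarrow>
        (\<exists>!h. h \<in> hom C x y \<and> (\<forall>n. h \<cdot>\<^bsub>C\<^esub> \<iota> n = \<kappa> n)))"

section \<open>Cofibration categories\<close>

text \<open>
  The quantifier over \<open>S \<in> {cof, cof \<inter> we}\<close> states a condition for cofibrations and for acyclic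
  cofibrations. Constructions determined up to isomorphism are quantified over all their choices.
\<close>

definition cofibration_category ::
    "'v set set \<Rightarrow> ('o, 'm) cat \<Rightarrow> 'm set \<Rightarrow> 'm set \<Rightarrow> bool" where
  "cofibration_category U C cof we \<longleftrightarrow>
     category C \<and> wide_subcategory C cof \<and> wide_subcategory C we \<and>
     (\<forall>f\<in>Arr C. \<forall>g\<in>Arr C. Cod C f = Dom C g \<longrightarrow>
        (f \<in> we \<and> g \<in> we \<longrightarrow> g \<cdot>\<^bsub>C\<^esub> f \<in> we) \<and>
        (f \<in> we \<and> g \<cdot>\<^bsub>C\<^esub> f \<in> we \<longrightarrow> g \<in> we) \<and>
        (g \<in> we \<and> g \<cdot>\<^bsub>C\<^esub> f \<in> we \<longrightarrow> f \<in> we)) \<and>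
     (\<exists>e. is_initial C e) \<and>
     (\<forall>e x. is_initial C e \<longrightarrow> hom C e x \<subseteq> cof) \<and>
     (\<forall>x\<in>Obj C. \<forall>p \<iota> \<delta>. is_coproduct C (UNIV :: bool set) (\<lambda>_. x) p \<iota> \<longrightarrow>
        \<delta> \<in> hom C p x \<longrightarrow> (\<forall>b. \<delta> \<cdot>\<^bsub>C\<^esub> \<iota> b = Idt C x) \<longrightarrow>
        (\<exists>i\<in>cof. \<exists>w\<in>we. Cod C i = Dom C w \<and> w \<cdot>\<^bsub>C\<^esub> i = \<delta>)) \<and>
     (\<forall>i\<in>cof. \<forall>g\<in>Arr C. Dom C i = Dom C g \<longrightarrow> (\<exists>g' i'. is_pushout C i g g' i')) \<and>
     (\<forall>S\<in>{cof, cof \<inter> we}. \<forall>i\<in>S. \<forall>g g' i'. is_pushout C i g g' i' \<longrightarrow> i' \<in> S) \<and>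
     (\<forall>I\<in>U. \<forall>X. (\<forall>i\<in>I. X i \<in> Obj C) \<longrightarrow> (\<exists>p \<iota>. is_coproduct C I X p \<iota>)) \<and>
     (\<forall>S\<in>{cof, cof \<inter> we}. \<forall>I\<in>U. \<forall>X Y f p \<iota> q \<kappa> h.
        (\<forall>i\<in>I. f i \<in> S \<and> f i \<in> hom C (X i) (Y i)) \<longrightarrow>
        is_coproduct C I X p \<iota> \<longrightarrow> is_coproduct C I Y q \<kappa> \<longrightarrow>
        h \<in> hom C p q \<longrightarrow> (\<forall>i\<in>I. h \<cdot>\<^bsub>C\<^esub> \<iota> i = \<kappa> i \<cdot>\<^bsub>C\<^esub> f i) \<longrightarrow> h \<in> S) \<and>
     (\<forall>X f. (\<forall>n. f n \<in> cof \<and> f n \<in> hom C (X n) (X (Suc n))) \<longrightarrow>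
        (\<exists>x \<iota>. is_seq_colimit C X f x \<iota>)) \<and>
     (\<forall>S\<in>{cof, cof \<inter> we}. \<forall>X f x \<iota>.
        (\<forall>n. f n \<in> S \<and> f n \<in> hom C (X n) (X (Suc n))) \<longrightarrow>
        is_seq_colimit C X f x \<iota> \<longrightarrow> (\<forall>n. \<iota> n \<in> S))"

section \<open>Reedy categories and Reedy cofibrant diagrams\<close>

definition reedy_category ::
    "('o, 'm) cat \<Rightarrow> ('o \<Rightarrow> nat) \<Rightarrow> 'm set \<Rightarrow> 'm set \<Rightarrow> bool" where
  "reedy_category R deg Rm Rp \<longleftrightarrow>
     category R \<and> wide_subcategory R Rm \<and> wide_subcategory R Rp \<and>
     (\<forall>f\<in>Rm. f \<noteq> Idt R (Dom R f) \<longrightarrow> deg (Dom R f) > deg (Cod R f)) \<and>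
     (\<forall>f\<in>Rp. f \<noteq> Idt R (Dom R f) \<longrightarrow> deg (Dom R f) < deg (Cod R f)) \<and>
     (\<forall>f\<in>Arr R. \<exists>!(p, m). p \<in> Rp \<and> m \<in> Rm \<and> Cod R m = Dom R p \<and> p \<cdot>\<^bsub>R\<^esub> m = f)"

definition latching_cat ::
    "('o, 'm) cat \<Rightarrow> 'm set \<Rightarrow> 'o \<Rightarrow> ('m, 'm \<times> 'm \<times> 'm) cat" where
  "latching_cat R Rm r = full_cat (under_cat (wide_cat R Rm) r) {f. f \<noteq> Idt R r}"

text \<open>The functor from the opposite of the latching category to the opposite of \<open>R\<close>.\<close>

definition latching_proj :: "('o, 'm) cat \<Rightarrow> ('m, 'm \<times> 'm \<times> 'm, 'o, 'm) func" where
  "latching_proj R = \<lparr>Fob = Cod R, Far = (\<lambda>(f, u, g). u)\<rparr>"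

definition is_latching_object ::
    "('o, 'm) cat \<Rightarrow> 'm set \<Rightarrow> ('p, 'n) cat \<Rightarrow> ('o, 'm, 'p, 'n) func \<Rightarrow> 'o \<Rightarrow> 'p \<Rightarrow> ('m \<Rightarrow> 'n) \<Rightarrow> bool"
  where
  "is_latching_object R Rm C X r l \<iota> \<longleftrightarrow>
     is_colimit (op_cat (latching_cat R Rm r)) C (comp_func X (latching_proj R)) l \<iota>"

text \<open>\<open>X\<close> is a functor from \<open>op_cat R\<close> to \<open>C\<close>, and \<open>h\<close> is the map induced on the latching object.\<close>

definition reedy_cofibrant ::
    "('o, 'm) cat \<Rightarrow> 'm set \<Rightarrow> ('p, 'n) cat \<Rightarrow> 'n set \<Rightarrow> ('o, 'm, 'p, 'n) func \<Rightarrow> bool" where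
  "reedy_cofibrant R Rm C cof X \<longleftrightarrow>
     (\<forall>r\<in>Obj R. \<exists>l \<iota> h. is_latching_object R Rm C X r l \<iota> \<and>
        h \<in> hom C l (Fob X r) \<and>
        (\<forall>f\<in>Obj (latching_cat R Rm r). h \<cdot>\<^bsub>C\<^esub> \<iota> f = Far X f) \<and>
        h \<in> cof)"

section \<open>Presheaves of small sets\<close>

text \<open>
  All functions below are extensional (undefined outside their domains), so that equality of
  presheaves and of natural transformations is the intended one.
\<close>

record ('o, 'm, 'v) presh =
  Ev :: "'o \<Rightarrow> 'v set"
  Act :: "'m \<Rightarrow> 'v \<Rightarrow> 'v"

record ('o, 'm, 'v) nat_trans =
  Src :: "('o, 'm, 'v) presh"
  Tgt :: "('o, 'm, 'v) presh"
  Cpt :: "'o \<Rightarrow> 'v \<Rightarrow> 'v"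

definition presheaf :: "'v set set \<Rightarrow> ('o, 'm) cat \<Rightarrow> ('o, 'm, 'v) presh \<Rightarrow> bool" where
  "presheaf U C X \<longleftrightarrow>
     Ev X \<in> Obj C \<rightarrow>\<^sub>E U \<and>
     Act X \<in> (\<Pi>\<^sub>E f\<in>Arr C. Ev X (Cod C f) \<rightarrow>\<^sub>E Ev X (Dom C f)) \<and>
     (\<forall>a\<in>Obj C. \<forall>x\<in>Ev X a. Act X (Idt C a) x = x) \<and>
     (\<forall>f\<in>Arr C. \<forall>g\<in>Arr C. Cod C f = Dom C g \<longrightarrow>
        (\<forall>x\<in>Ev X (Cod C g). Act X (g \<cdot>\<^bsub>C\<^esub> f) x = Act X f (Act X g x)))"

definition natural_trans :: "('o, 'm) cat \<Rightarrow> ('o, 'm, 'v) nat_trans \<Rightarrow> bool" where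
  "natural_trans C t \<longleftrightarrow>
     Cpt t \<in> (\<Pi>\<^sub>E a\<in>Obj C. Ev (Src t) a \<rightarrow>\<^sub>E Ev (Tgt t) a) \<and>
     (\<forall>f\<in>Arr C. \<forall>x\<in>Ev (Src t) (Cod C f).
        Cpt t (Dom C f) (Act (Src t) f x) = Act (Tgt t) f (Cpt t (Cod C f) x))"

definition psh ::
    "'v set set \<Rightarrow> ('o, 'm) cat \<Rightarrow> (('o, 'm, 'v) presh, ('o, 'm, 'v) nat_trans) cat" where
  "psh U C = \<lparr>Obj = {X. presheaf U C X},
     Arr = {t. presheaf U C (Src t) \<and> presheaf U C (Tgt t) \<and> natural_trans C t},
     Dom = Src, Cod = Tgt,
     Idt = (\<lambda>X. \<lparr>Src = X, Tgt = X, Cpt = (\<lambda>a\<in>Obj C. \<lambda>x\<in>Ev X a. x)\<rparr>),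
     Cmp = (\<lambda>s t. \<lparr>Src = Src t, Tgt = Tgt s,
       Cpt = (\<lambda>a\<in>Obj C. \<lambda>x\<in>Ev (Src t) a. Cpt s a (Cpt t a x))\<rparr>)\<rparr>"

text \<open>For a presheaf \<open>X\<close> on \<open>A \<times> R\<close>: the presheaf \<open>X\<^sub>r\<close>, the map \<open>f\<^sub>r\<close>, and the diagram \<open>r \<mapsto> X\<^sub>r\<close>.\<close>

definition slice_obj ::
    "('a, 'b) cat \<Rightarrow> ('r, 's) cat \<Rightarrow> ('a \<times> 'r, 'b \<times> 's, 'v) presh \<Rightarrow> 'r \<Rightarrow> ('a, 'b, 'v) presh" where
  "slice_obj A R X r =
     \<lparr>Ev = (\<lambda>a\<in>Obj A. Ev X (a, r)), Act = (\<lambda>u\<in>Arr A. Act X (u, Idt R r))\<rparr>"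

definition slice_map ::
    "('a, 'b) cat \<Rightarrow> ('r, 's) cat \<Rightarrow> ('a \<times> 'r, 'b \<times> 's, 'v) nat_trans \<Rightarrow> 'r \<Rightarrow> ('a, 'b, 'v) nat_trans"
  where
  "slice_map A R t r = \<lparr>Src = slice_obj A R (Src t) r, Tgt = slice_obj A R (Tgt t) r,
     Cpt = (\<lambda>a\<in>Obj A. Cpt t (a, r))\<rparr>"

definition diagram ::
    "('a, 'b) cat \<Rightarrow> ('r, 's) cat \<Rightarrow> ('a \<times> 'r, 'b \<times> 's, 'v) presh \<Rightarrow>
     ('r, 's, ('a, 'b, 'v) presh, ('a, 'b, 'v) nat_trans) func" where
  "diagram A R X =
     \<lparr>Fob = slice_obj A R X,
      Far = (\<lambda>\<phi>. \<lparr>Src = slice_obj A R X (Cod R \<phi>), Tgt = slice_obj A R X (Dom R \<phi>),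
                    Cpt = (\<lambda>a\<in>Obj A. Act X (Idt A a, \<phi>))\<rparr>)\<rparr>"

text \<open>The functor that sends \<open>K\<close> to its external product with \<open>L\<close>.\<close>

definition ext_prod_obj ::
    "('a, 'b) cat \<Rightarrow> ('r, 's) cat \<Rightarrow> ('r, 's, 'v) presh \<Rightarrow> ('a, 'b, 'v) presh \<Rightarrow>
     ('a \<times> 'r, 'b \<times> 's, 'v) presh" where
  "ext_prod_obj A R L K =
     \<lparr>Ev = (\<lambda>(a, r)\<in>Obj A \<times> Obj R. vpair ` (Ev K a \<times> Ev L r)),
      Act = (\<lambda>(u, \<phi>)\<in>Arr A \<times> Arr R. \<lambda>z\<in>vpair ` (Ev K (Cod A u) \<times> Ev L (Cod R \<phi>)).
               vpair (map_prod (Act K u) (Act L \<phi>) (inv vpair z)))\<rparr>"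

definition ext_prod ::
    "('a, 'b) cat \<Rightarrow> ('r, 's) cat \<Rightarrow> ('r, 's, 'v) presh \<Rightarrow>
     (('a, 'b, 'v) presh, ('a, 'b, 'v) nat_trans,
      ('a \<times> 'r, 'b \<times> 's, 'v) presh, ('a \<times> 'r, 'b \<times> 's, 'v) nat_trans) func" where
  "ext_prod A R L =
     \<lparr>Fob = ext_prod_obj A R L,
      Far = (\<lambda>t. \<lparr>Src = ext_prod_obj A R L (Src t), Tgt = ext_prod_obj A R L (Tgt t),
        Cpt = (\<lambda>(a, r)\<in>Obj A \<times> Obj R. \<lambda>z\<in>vpair ` (Ev (Src t) a \<times> Ev L r).
                 vpair (map_prod (Cpt t a) id (inv vpair z)))\<rparr>)\<rparr>"

section \<open>Cisinski structures and diagonal functors\<close>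

definition cisinski_structure ::
    "'v set set \<Rightarrow> ('a, 'b) cat \<Rightarrow> ('a, 'b, 'v) nat_trans set \<Rightarrow> ('a, 'b, 'v) nat_trans set \<Rightarrow> bool"
  where
  "cisinski_structure U A cof we \<longleftrightarrow>
     cofibration_category U (psh U A) cof we \<and> cof = mono_arrows (psh U A)"

definition diagonal_functor ::
    "'v set set \<Rightarrow> ('a, 'b) cat \<Rightarrow> ('r, 's) cat \<Rightarrow> ('a, 'b, 'v) nat_trans set \<Rightarrow>
     (('a \<times> 'r, 'b \<times> 's, 'v) presh, ('a \<times> 'r, 'b \<times> 's, 'v) nat_trans,
      ('a, 'b, 'v) presh, ('a, 'b, 'v) nat_trans) func \<Rightarrow> bool" where
  "diagonal_functor U A R we d \<longleftrightarrow>
     is_functor (psh U (prod_cat A R)) (psh U A) d \<and>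
     preserves_colimits U (psh U (prod_cat A R)) (psh U A) d \<and>
     preserves_monos (psh U (prod_cat A R)) (psh U A) d \<and>
     (\<forall>K\<in>Obj (psh U R). \<forall>w\<in>we. Far (comp_func d (ext_prod A R K)) w \<in> we)"

end

theory Submission
  imports Defs
begin

text \<open>
  A Reedy cofibrant \<open>X\<close> has the Eilenberg--Zilber property: every element is uniquely \<open>\<sigma>\<^sup>* y\<close> with \<open>\<sigma> \<in> R\<^sub>-\<close>
  and \<open>y\<close> nondegenerate. Hence \<open>X\<close> is filtered by the presheaves \<open>F\<^sub>m X\<close> of elements that come from degrees
  below \<open>m\<close>, with pushouts \<open>F\<^sub>m\<^sub>+\<^sub>1 X = F\<^sub>m X \<squnion> Q\<close> along \<open>P \<subseteq> Q\<close>, where \<open>Q\<close> is the coproduct of \<open>X\<^sub>r \<times> R(-, r)\<close> over \<open>deg r = m\<close>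
  and \<open>P\<close> is the union of \<open>L\<^sub>r X \<times> R(-, r)\<close> and \<open>X\<^sub>r \<times> \<partial>R(-, r)\<close>, with \<open>L\<^sub>r X = (F\<^sub>m X)\<^sub>r\<close>. Every functor that
  preserves these colimits and monomorphisms and sends \<open>w \<times> K\<close> to a weak equivalence for each weak
  equivalence \<open>w\<close> can be compared along the filtration by the gluing lemma, as soon as \<open>L\<^sub>r f\<close> is a weak
  equivalence for all \<open>r\<close>. The evaluations at objects of \<open>R\<close> are such functors and yield this by induction
  on the degree; then \<open>d\<close> is one, and \<open>d f\<close> is a sequential colimit of weak equivalences along cofibrations.
\<close>

section \<open>Composition, typed pushout squares and pasting in an arbitrary category\<close>

section \<open>Pushouts\<close>

text \<open>The gluing step at degree \<open>m\<close> needs \<open>L\<^sub>r f\<close> for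
  \<open>deg r = m\<close>, and \<open>L\<^sub>r f\<close> is itself the value at \<open>r\<close>
  of the map on stage \<open>m\<close>. This is not circular: stage \<open>m\<close> is built from
  cells of degree below \<open>m\<close>, so a comparison at \<open>r\<close> only uses latching
  maps at objects of smaller degree. Evaluations qualify because the value of an external product at
  \<open>r\<close> is a coproduct of copies of its first factor. Cofibrancy enters through the
  Eilenberg-Zilber property: elements identified in \<open>X\<^sub>r\<close> are already identified
  in the colimit \<open>L\<^sub>r X\<close>, hence by every cocone, and the cocone of formal normal
  forms separates them. The axioms close only the acyclic cofibrations under colimits, while the
  maps to be compared are arbitrary weak equivalences. As all objects are cofibrant, mapping
  cylinders bridge the gap. They are not functorial, so along a sequence each cylinder is chosen
  relative to its predecessor. Presheaves take values in subsets of one type; pairs, tagged sums and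
  arrows of \<open>R\<close> are therefore coded by its elements.\<close>

locale category_locale =
  fixes C :: "('o, 'm) cat" (structure)
  assumes category: "category C"
begin

lemma comp_hom [intro]: "f \<in> hom C a b \<Longrightarrow> g \<in> hom C b c \<Longrightarrow> g \<cdot> f \<in> hom C a c"
  using category unfolding category_def hom_def by auto

lemma assoc: "f \<in> hom C a b \<Longrightarrow> g \<in> hom C b c \<Longrightarrow> h \<in> hom C c e \<Longrightarrow> (h \<cdot> g) \<cdot> f = h \<cdot> (g \<cdot> f)"
  using category unfolding category_def hom_def by auto

lemma id_hom [intro]: "a \<in> Obj C \<Longrightarrow> Idt C a \<in> hom C a a"
  using category unfolding category_def by auto

lemma id_left: "f \<in> hom C a b \<Longrightarrow> Idt C b \<cdot> f = f"
  and id_right: "f \<in> hom C a b \<Longrightarrow> f \<cdot> Idt C a = f"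
  using category unfolding category_def hom_def by auto

lemma hom_obj: "f \<in> hom C a b \<Longrightarrow> a \<in> Obj C" "f \<in> hom C a b \<Longrightarrow> b \<in> Obj C"
  using category unfolding category_def hom_def by auto

text \<open>\<open>is_pushout\<close> records arrows only. With the four corners as arguments every
  leg has a hom set, which is what \<open>comp_hom\<close> and \<open>assoc\<close> consume;
  \<open>i'\<close> is the cobase change of \<open>i\<close>, and \<open>g'\<close> that of
  \<open>g\<close>.\<close>

definition po where
  "po a b c p i g g' i' \<longleftrightarrow> i \<in> hom C a b \<and> g \<in> hom C a c \<and> g' \<in> hom C b p \<and> i' \<in> hom C c p \<and>
     is_pushout C i g g' i'"

lemma po_hom:
  assumes "po a b c p i g g' i'"
  shows "i \<in> hom C a b" "g \<in> hom C a c" "g' \<in> hom C b p" "i' \<in> hom C c p"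
  using assms unfolding po_def by auto

lemma po_comm: "po a b c p i g g' i' \<Longrightarrow> g' \<cdot> i = i' \<cdot> g"
  unfolding po_def is_pushout_def by auto

lemma po_ex:
  assumes "po a b c p i g g' i'" "s \<in> hom C b y" "t \<in> hom C c y" "s \<cdot> i = t \<cdot> g"
  obtains h where "h \<in> hom C p y" "h \<cdot> g' = s" "h \<cdot> i' = t"
proof -
  have "y \<in> Obj C" using assms hom_obj by blast
  moreover have "Cod C i = b" "Cod C g = c" "Cod C g' = p"
    using assms(1) unfolding po_def hom_def by auto
  ultimately have "\<exists>!h. h \<in> hom C p y \<and> h \<cdot> g' = s \<and> h \<cdot> i' = t"
    using assms unfolding po_def is_pushout_def by blast
  then show ?thesis using that by blast
qed

lemma po_eq:
  assumes "po a b c p i g g' i'" "h \<in> hom C p y" "k \<in> hom C p y" "h \<cdot> g' = k \<cdot> g'" "h \<cdot> i' = k \<cdot> i'"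
  shows "h = k"
proof -
  have y: "y \<in> Obj C" using assms hom_obj by blast
  have c: "Cod C i = b" "Cod C g = c" "Cod C g' = p"
    using assms(1) unfolding po_def hom_def by auto
  note hs = po_hom[OF assms(1)]
  have "(h \<cdot> g') \<cdot> i = (h \<cdot> i') \<cdot> g"
    using assoc[OF hs(1,3) assms(2)] assoc[OF hs(2,4) assms(2)] po_comm[OF assms(1)] by simp
  moreover have "h \<cdot> g' \<in> hom C b y" "h \<cdot> i' \<in> hom C c y" using hs assms(2) by auto
  ultimately have "\<exists>!l. l \<in> hom C p y \<and> l \<cdot> g' = h \<cdot> g' \<and> l \<cdot> i' = h \<cdot> i'"
    using y assms(1) c unfolding po_def is_pushout_def by blast
  then show ?thesis using assms by metis
qed

lemma poI:
  assumes "i \<in> hom C a b" "g \<in> hom C a c" "g' \<in> hom C b p" "i' \<in> hom C c p" "g' \<cdot> i = i' \<cdot> g"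
    and "\<And>y s t. s \<in> hom C b y \<Longrightarrow> t \<in> hom C c y \<Longrightarrow> s \<cdot> i = t \<cdot> g \<Longrightarrow>
      \<exists>h\<in>hom C p y. h \<cdot> g' = s \<and> h \<cdot> i' = t"
    and "\<And>y h k. h \<in> hom C p y \<Longrightarrow> k \<in> hom C p y \<Longrightarrow> h \<cdot> g' = k \<cdot> g' \<Longrightarrow> h \<cdot> i' = k \<cdot> i' \<Longrightarrow> h = k"
  shows "po a b c p i g g' i'"
proof -
  have "\<exists>!h. h \<in> hom C p y \<and> h \<cdot> g' = s \<and> h \<cdot> i' = t"
    if "s \<in> hom C b y" "t \<in> hom C c y" "s \<cdot> i = t \<cdot> g" for y s t
    using assms(6)[OF that] assms(7) by metis
  moreover have "i \<in> Arr C" "g \<in> Arr C" "g' \<in> Arr C" "i' \<in> Arr C" "Dom C i = a" "Dom C g = a"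
    "Dom C g' = b" "Dom C i' = c" "Cod C i' = p" "Cod C i = b" "Cod C g = c" "Cod C g' = p"
    using assms(1-4) unfolding hom_def by auto
  ultimately show ?thesis using assms(1-5) unfolding po_def is_pushout_def by simp
qed

lemma po_sym:
  assumes p: "po a b c p i g g' i'"
  shows "po a c b p g i i' g'"
proof (rule poI)
  note h = po_hom[OF p]
  show "g \<in> hom C a c" "i \<in> hom C a b" "i' \<in> hom C c p" "g' \<in> hom C b p" "i' \<cdot> g = g' \<cdot> i"
    using h po_comm[OF p] by auto
  fix y s t assume "s \<in> hom C c y" "t \<in> hom C b y" "s \<cdot> g = t \<cdot> i"
  then obtain h where "h \<in> hom C p y" "h \<cdot> g' = t" "h \<cdot> i' = s" using po_ex[OF p] by metis
  then show "\<exists>h\<in>hom C p y. h \<cdot> i' = s \<and> h \<cdot> g' = t" by blast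
next
  show "h = k" if "h \<in> hom C p y" "k \<in> hom C p y" "h \<cdot> i' = k \<cdot> i'" "h \<cdot> g' = k \<cdot> g'" for y h k
    using po_eq[OF p that(1,2,4,3)] .
qed

lemma is_pushout_po:
  assumes "is_pushout C i g g' i'" "i \<in> hom C a b" "g \<in> hom C a c"
  shows "po a b c (Cod C g') i g g' i'"
proof -
  have "g' \<in> hom C b (Cod C g')" "i' \<in> hom C c (Cod C g')"
    using assms unfolding is_pushout_def hom_def by auto
  then show ?thesis using assms unfolding po_def by blast
qed

lemma po_id:
  assumes i: "i \<in> hom C a b"
  shows "po a b a b i (Idt C a) (Idt C b) i"
proof (rule poI)
  show "i \<in> hom C a b" "Idt C a \<in> hom C a a" "Idt C b \<in> hom C b b" "i \<in> hom C a b" using i hom_obj by auto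
  show "Idt C b \<cdot> i = i \<cdot> Idt C a" using id_left[OF i] id_right[OF i] by simp
  fix y s t assume st: "s \<in> hom C b y" "t \<in> hom C a y" "s \<cdot> i = t \<cdot> Idt C a"
  then show "\<exists>h\<in>hom C b y. h \<cdot> Idt C b = s \<and> h \<cdot> i = t" using id_right[OF st(1)] id_right[OF st(2)] by auto
next
  fix y h k assume hk: "h \<in> hom C b y" "k \<in> hom C b y" "h \<cdot> Idt C b = k \<cdot> Idt C b"
  then show "h = k" using id_right[OF hk(1)] id_right[OF hk(2)] by simp
qed

lemma po_paste:
  assumes p1: "po a b c p i g g' i'" and p2: "po c p e q i' k k' i''"
  shows "po a b e q i (k \<cdot> g) (k' \<cdot> g') i''"
proof (rule poI)
  note h1 = po_hom[OF p1] and h2 = po_hom[OF p2]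
  show "i \<in> hom C a b" "k \<cdot> g \<in> hom C a e" "k' \<cdot> g' \<in> hom C b q" "i'' \<in> hom C e q" using h1 h2 by auto
  show "k' \<cdot> g' \<cdot> i = i'' \<cdot> (k \<cdot> g)"
    using assoc[OF h1(1,3) h2(3)] assoc[OF h1(2,4) h2(3)] assoc[OF h1(2) h2(2,4)] po_comm[OF p1] po_comm[OF p2]
    by simp
  fix y s t assume st: "s \<in> hom C b y" "t \<in> hom C e y" "s \<cdot> i = t \<cdot> (k \<cdot> g)"
  have "s \<cdot> i = (t \<cdot> k) \<cdot> g" using st assoc[OF h1(2) h2(2) st(2)] by simp
  moreover have "t \<cdot> k \<in> hom C c y" using st h2 by auto
  ultimately obtain l where l: "l \<in> hom C p y" "l \<cdot> g' = s" "l \<cdot> i' = t \<cdot> k" using po_ex[OF p1 st(1)] by metis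
  then obtain h where h: "h \<in> hom C q y" "h \<cdot> k' = l" "h \<cdot> i'' = t" using po_ex[OF p2 l(1) st(2)] by metis
  then show "\<exists>h\<in>hom C q y. h \<cdot> (k' \<cdot> g') = s \<and> h \<cdot> i'' = t" using l assoc[OF h1(3) h2(3) h(1)] by metis
next
  note h1 = po_hom[OF p1] and h2 = po_hom[OF p2]
  fix y h l assume A: "h \<in> hom C q y" "l \<in> hom C q y" "h \<cdot> (k' \<cdot> g') = l \<cdot> (k' \<cdot> g')" "h \<cdot> i'' = l \<cdot> i''"
  have "h \<cdot> k' = l \<cdot> k'"
  proof (rule po_eq[OF p1])
    show "h \<cdot> k' \<in> hom C p y" "l \<cdot> k' \<in> hom C p y" using A h2 by auto
    show "h \<cdot> k' \<cdot> g' = l \<cdot> k' \<cdot> g'" using assoc[OF h1(3) h2(3) A(1)] assoc[OF h1(3) h2(3) A(2)] A(3) by simp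
    show "h \<cdot> k' \<cdot> i' = l \<cdot> k' \<cdot> i'"
      using assoc[OF h2(1,3) A(1)] assoc[OF h2(1,3) A(2)] assoc[OF h2(2,4) A(1)] assoc[OF h2(2,4) A(2)]
        A(4) po_comm[OF p2] by simp
  qed
  then show "h = l" using po_eq[OF p2 A(1,2)] A(4) by simp
qed

text \<open>The cancellation half of the pasting law, and the usual way below to recognize a
  pushout. The outer rectangle has a leg \<open>l\<close> of its own because \<open>k'\<close>
  typically comes from \<open>po_ex\<close> with prescribed composites.\<close>

lemma po_cancel:
  assumes p1: "po a b c p i g g' i'" and p2: "po a b e q i (k \<cdot> g) l i''"
    and k: "k \<in> hom C c e" and k': "k' \<in> hom C p q" and e1: "k' \<cdot> g' = l" and e2: "k' \<cdot> i' = i'' \<cdot> k"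
  shows "po c p e q i' k k' i''"
proof (rule poI)
  note h1 = po_hom[OF p1] and h2 = po_hom[OF p2]
  show "i' \<in> hom C c p" "k \<in> hom C c e" "k' \<in> hom C p q" "i'' \<in> hom C e q" "k' \<cdot> i' = i'' \<cdot> k"
    using h1 h2 k k' e2 by auto
  fix y s t assume st: "s \<in> hom C p y" "t \<in> hom C e y" "s \<cdot> i' = t \<cdot> k"
  have "(s \<cdot> g') \<cdot> i = t \<cdot> (k \<cdot> g)"
    using assoc[OF h1(1,3) st(1)] assoc[OF h1(2,4) st(1)] assoc[OF h1(2) k st(2)] po_comm[OF p1] st(3) by simp
  moreover have "s \<cdot> g' \<in> hom C b y" using st h1 by auto
  ultimately obtain h where h: "h \<in> hom C q y" "h \<cdot> l = s \<cdot> g'" "h \<cdot> i'' = t"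
    using po_ex[OF p2 _ st(2)] by metis
  have "h \<cdot> k' = s"
  proof (rule po_eq[OF p1])
    show "h \<cdot> k' \<in> hom C p y" "s \<in> hom C p y" using h k' st by auto
    show "h \<cdot> k' \<cdot> g' = s \<cdot> g'" using assoc[OF h1(3) k' h(1)] h e1 by simp
    show "h \<cdot> k' \<cdot> i' = s \<cdot> i'" using assoc[OF h1(4) k' h(1)] assoc[OF k h2(4) h(1)] h e2 st by simp
  qed
  then show "\<exists>h\<in>hom C q y. h \<cdot> k' = s \<and> h \<cdot> i'' = t" using h by auto
next
  note h1 = po_hom[OF p1] and h2 = po_hom[OF p2]
  fix y h m assume A: "h \<in> hom C q y" "m \<in> hom C q y" "h \<cdot> k' = m \<cdot> k'" "h \<cdot> i'' = m \<cdot> i''"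
  show "h = m"
  proof (rule po_eq[OF p2 A(1,2) _ A(4)])
    show "h \<cdot> l = m \<cdot> l" using assoc[OF h1(3) k' A(1)] assoc[OF h1(3) k' A(2)] A(3) e1 by simp
  qed
qed

end

section \<open>From the axioms to mapping cylinders, left properness and the gluing lemma\<close>

section \<open>Cofibration categories\<close>

locale cof_category = category_locale C for C :: "('o, 'm) cat" (structure) +
  fixes U :: "'v set set" and cof we
  assumes cofcat: "cofibration_category U C cof we"
begin

lemmas cofcat_axioms = cofcat[unfolded cofibration_category_def]

lemma wide_cof: "wide_subcategory C cof"
  using cofcat_axioms by (elim conjE)

lemma wide_we: "wide_subcategory C we"
  using cofcat_axioms by (elim conjE)

lemma cof_comp: "f \<in> hom C a b \<Longrightarrow> g \<in> hom C b c \<Longrightarrow> f \<in> cof \<Longrightarrow> g \<in> cof \<Longrightarrow> g \<cdot> f \<in> cof"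
  using wide_cof unfolding wide_subcategory_def hom_def by auto

lemma id_we: "a \<in> Obj C \<Longrightarrow> Idt C a \<in> we"
  using wide_we unfolding wide_subcategory_def by blast

lemma cof_arr: "f \<in> cof \<Longrightarrow> f \<in> Arr C" and we_arr: "f \<in> we \<Longrightarrow> f \<in> Arr C"
  using wide_cof wide_we unfolding wide_subcategory_def by blast+

lemma two_of_three: "\<forall>f\<in>Arr C. \<forall>g\<in>Arr C. Cod C f = Dom C g \<longrightarrow>
        (f \<in> we \<and> g \<in> we \<longrightarrow> g \<cdot> f \<in> we) \<and>
        (f \<in> we \<and> g \<cdot> f \<in> we \<longrightarrow> g \<in> we) \<and>
        (g \<in> we \<and> g \<cdot> f \<in> we \<longrightarrow> f \<in> we)"
  using cofcat_axioms by (elim conjE)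

lemma initial_cof: "is_initial C e \<Longrightarrow> u \<in> hom C e x \<Longrightarrow> u \<in> cof"
proof -
  have "\<forall>e x. is_initial C e \<longrightarrow> hom C e x \<subseteq> cof" using cofcat_axioms by (elim conjE)
  then show "is_initial C e \<Longrightarrow> u \<in> hom C e x \<Longrightarrow> u \<in> cof" by blast
qed

lemma initial_exists: "\<exists>e. is_initial C e"
  using cofcat_axioms by (elim conjE)

lemma codiagonal_factorization: "\<forall>x\<in>Obj C. \<forall>p \<iota> \<delta>. is_coproduct C (UNIV :: bool set) (\<lambda>_. x) p \<iota> \<longrightarrow>
        \<delta> \<in> hom C p x \<longrightarrow> (\<forall>b. \<delta> \<cdot> \<iota> b = Idt C x) \<longrightarrow>
        (\<exists>i\<in>cof. \<exists>w\<in>we. Cod C i = Dom C w \<and> w \<cdot> i = \<delta>)"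
  using cofcat_axioms by (elim conjE)

lemma pushout_exists: "\<forall>i\<in>cof. \<forall>g\<in>Arr C. Dom C i = Dom C g \<longrightarrow> (\<exists>g' i'. is_pushout C i g g' i')"
  using cofcat_axioms by (elim conjE)

lemma pushout_cof: "\<forall>S\<in>{cof, cof \<inter> we}. \<forall>i\<in>S. \<forall>g g' i'. is_pushout C i g g' i' \<longrightarrow> i' \<in> S"
  using cofcat_axioms by (elim conjE)

lemma coproduct_exists: "\<forall>I\<in>U. \<forall>X. (\<forall>i\<in>I. X i \<in> Obj C) \<longrightarrow> (\<exists>p \<iota>. is_coproduct C I X p \<iota>)"
  using cofcat_axioms by (elim conjE)

lemma coproduct_cof: "\<forall>S\<in>{cof, cof \<inter> we}. \<forall>I\<in>U. \<forall>X Y f p \<iota> q \<kappa> h.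
        (\<forall>i\<in>I. f i \<in> S \<and> f i \<in> hom C (X i) (Y i)) \<longrightarrow>
        is_coproduct C I X p \<iota> \<longrightarrow> is_coproduct C I Y q \<kappa> \<longrightarrow>
        h \<in> hom C p q \<longrightarrow> (\<forall>i\<in>I. h \<cdot> \<iota> i = \<kappa> i \<cdot> f i) \<longrightarrow> h \<in> S"
  using cofcat_axioms by (elim conjE)

lemma seq_colimit_exists: "\<forall>X f. (\<forall>n. f n \<in> cof \<and> f n \<in> hom C (X n) (X (Suc n))) \<longrightarrow>
        (\<exists>x \<iota>. is_seq_colimit C X f x \<iota>)"
  using cofcat_axioms by (elim conjE)

lemma seq_colimit_cof: "\<forall>S\<in>{cof, cof \<inter> we}. \<forall>X f x \<iota>.
        (\<forall>n. f n \<in> S \<and> f n \<in> hom C (X n) (X (Suc n))) \<longrightarrow>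
        is_seq_colimit C X f x \<iota> \<longrightarrow> (\<forall>n. \<iota> n \<in> S)"
  using cofcat_axioms by (elim conjE)

lemma we_comp: "f \<in> hom C a b \<Longrightarrow> g \<in> hom C b c \<Longrightarrow> f \<in> we \<Longrightarrow> g \<in> we \<Longrightarrow> g \<cdot> f \<in> we"
  and we_cancel_right: "f \<in> hom C a b \<Longrightarrow> g \<in> hom C b c \<Longrightarrow> f \<in> we \<Longrightarrow> g \<cdot> f \<in> we \<Longrightarrow> g \<in> we"
  and we_cancel_left: "f \<in> hom C a b \<Longrightarrow> g \<in> hom C b c \<Longrightarrow> g \<in> we \<Longrightarrow> g \<cdot> f \<in> we \<Longrightarrow> f \<in> we"
  using two_of_three unfolding hom_def by auto

lemma po_exists:
  assumes "i \<in> hom C a b" "g \<in> hom C a c" "i \<in> cof"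
  obtains p g' i' where "po a b c p i g g' i'"
proof -
  have "g \<in> Arr C" "Dom C i = Dom C g" using assms unfolding hom_def by auto
  then obtain g' i' where "is_pushout C i g g' i'" using assms(3) pushout_exists by blast
  then show ?thesis using is_pushout_po assms that by blast
qed

lemma po_is_pushout: "po a b c p i g g' i' \<Longrightarrow> is_pushout C i g g' i'"
  by (simp add: po_def)

lemma po_cof: "po a b c p i g g' i' \<Longrightarrow> i \<in> cof \<Longrightarrow> i' \<in> cof"
  by (rule pushout_cof[rule_format, OF _ _ po_is_pushout]) auto

lemma po_we:
  assumes "po a b c p i g g' i'" "i \<in> cof" "i \<in> we"
  shows "i' \<in> we"
proof -
  have "i' \<in> cof \<inter> we"
    by (rule pushout_cof[rule_format, OF _ _ po_is_pushout[OF assms(1)]]) (use assms in auto)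
  then show ?thesis by simp
qed

lemma section_we: "s \<in> hom C a b \<Longrightarrow> p \<in> hom C b a \<Longrightarrow> p \<cdot> s = Idt C a \<Longrightarrow> s \<in> we \<Longrightarrow> p \<in> we"
  and retraction_we: "s \<in> hom C a b \<Longrightarrow> p \<in> hom C b a \<Longrightarrow> p \<cdot> s = Idt C a \<Longrightarrow> p \<in> we \<Longrightarrow> s \<in> we"
  using we_cancel_right we_cancel_left id_we hom_obj by metis+

text \<open>Mapping cylinder: the cylinder of the codiagonal, glued to the target.\<close>

lemma factorization:
  assumes f: "f \<in> hom C x y"
  obtains z i p j where "i \<in> hom C x z" "i \<in> cof" "p \<in> hom C z y" "p \<in> we" "p \<cdot> i = f"
    "j \<in> hom C y z" "j \<in> cof" "p \<cdot> j = Idt C y"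
proof -
  obtain e where e: "is_initial C e" using initial_exists by blast
  have ecof: "u \<in> cof" if "u \<in> hom C e v" for u v
    using initial_cof[OF e that] .
  have x: "x \<in> Obj C" and y: "y \<in> Obj C" using f hom_obj by auto
  obtain ex ey where ex: "ex \<in> hom C e x" and ey: "ey \<in> hom C e y"
    using e x y unfolding is_initial_def by (metis (no_types))
  have einit: "u = v" if "u \<in> hom C e w" "v \<in> hom C e w" for u v w
    using e that hom_obj(2)[OF that(1)] unfolding is_initial_def by (metis (no_types))
  \<comment> \<open>The codiagonal axiom asks for a coproduct over \<open>bool\<close>, whereas the
    coproduct axiom offers index sets in \<open>U\<close>. So \<open>x \<squnion> x\<close> is built
    as a pushout under the initial object, which also shows that \<open>a0\<close> and
    \<open>a1\<close> are cofibrations.\<close>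
  obtain q a0 a1 where q: "po e x x q ex ex a0 a1" using po_exists[OF ex ex] ecof ex by blast
  note qh = po_hom[OF q]
  define \<iota> where "\<iota> b = (if b then a1 else a0)" for b
  have cp: "is_coproduct C (UNIV :: bool set) (\<lambda>_. x) q \<iota>"
    unfolding is_coproduct_def
  proof (intro conjI ballI allI impI)
    show "q \<in> Obj C" using qh hom_obj by blast
    show "\<iota> i \<in> hom C x q" for i using qh by (simp add: \<iota>_def)
    fix v \<kappa> assume k: "\<forall>i\<in>(UNIV :: bool set). \<kappa> i \<in> hom C x v"
    have "\<kappa> False \<cdot> ex = \<kappa> True \<cdot> ex" by (rule einit) (use k ex in auto)
    then obtain h where h: "h \<in> hom C q v" "h \<cdot> a0 = \<kappa> False" "h \<cdot> a1 = \<kappa> True" using po_ex[OF q] k by blast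
    then have "h \<in> hom C q v \<and> (\<forall>i\<in>UNIV. h \<cdot> \<iota> i = \<kappa> i)" unfolding \<iota>_def by auto
    moreover have "h' = h" if "h' \<in> hom C q v \<and> (\<forall>i\<in>UNIV. h' \<cdot> \<iota> i = \<kappa> i)" for h'
    proof (rule po_eq[OF q])
      show "h' \<in> hom C q v" "h \<in> hom C q v" using that h by auto
      have "h' \<cdot> \<iota> False = \<kappa> False" "h' \<cdot> \<iota> True = \<kappa> True" using that by auto
      then show "h' \<cdot> a0 = h \<cdot> a0" "h' \<cdot> a1 = h \<cdot> a1" using h by (auto simp: \<iota>_def)
    qed
    ultimately show "\<exists>!h. h \<in> hom C q v \<and> (\<forall>i\<in>UNIV. h \<cdot> \<iota> i = \<kappa> i)" by blast
  qed
  have idx: "Idt C x \<in> hom C x x" using x by auto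
  obtain \<delta> where d: "\<delta> \<in> hom C q x" "\<delta> \<cdot> a0 = Idt C x" "\<delta> \<cdot> a1 = Idt C x"
    using po_ex[OF q idx idx] by metis
  have "\<exists>i\<in>cof. \<exists>w\<in>we. Cod C i = Dom C w \<and> w \<cdot> i = \<delta>"
  proof -
    have "\<forall>b. \<delta> \<cdot> \<iota> b = Idt C x" using d by (simp add: \<iota>_def)
    then show ?thesis using codiagonal_factorization cp d x by blast
  qed
  then obtain k w where kw: "k \<in> cof" "w \<in> we" "Cod C k = Dom C w" "w \<cdot> k = \<delta>" by blast
  have wA: "w \<in> Arr C" using kw(2) we_arr by blast
  define c where "c = Cod C k"
  have "\<delta> \<in> hom C (Dom C k) (Cod C w)"
    using kw wA cof_arr[OF kw(1)] comp_hom[of k "Dom C k" "Cod C k" w "Cod C w"] unfolding hom_def by auto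
  then have k: "k \<in> hom C q c" and w: "w \<in> hom C c x"
    using kw wA cof_arr[OF kw(1)] d(1) unfolding hom_def c_def by auto
  define i0 where "i0 = k \<cdot> a0"
  define i1 where "i1 = k \<cdot> a1"
  have i0: "i0 \<in> hom C x c" and i1: "i1 \<in> hom C x c" unfolding i0_def i1_def using qh k by auto
  have a0c: "a0 \<in> cof" and a1c: "a1 \<in> cof" using po_cof[OF q] po_cof[OF po_sym[OF q]] ecof[OF ex] by auto
  have i1c: "i1 \<in> cof" unfolding i1_def using cof_comp[OF qh(4) k a1c kw(1)] .
  have wi0: "w \<cdot> i0 = Idt C x" and wi1: "w \<cdot> i1 = Idt C x"
    unfolding i0_def i1_def using assoc[OF qh(3) k w] assoc[OF qh(4) k w] kw d by auto
  have i1w: "i1 \<in> we" using retraction_we[OF i1 w wi1 kw(2)] .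
  \<comment> \<open>The cylinder \<open>c\<close> of \<open>x\<close>, glued to \<open>y\<close>
    along its end \<open>i1\<close>; the free end \<open>i0\<close> becomes \<open>i\<close>. As
    \<open>i1\<close> is an acyclic cofibration, so is \<open>j\<close>, and \<open>p\<close> is a
    weak equivalence because it retracts \<open>j\<close>.\<close>
  obtain z l j where z: "po x c y z i1 f l j" using po_exists[OF i1 f i1c] .
  note zh = po_hom[OF z]
  have jc: "j \<in> cof" and jw: "j \<in> we" using po_cof[OF z] po_we[OF z] i1c i1w by auto
  have idy: "Idt C y \<in> hom C y y" using y by auto
  have fw: "f \<cdot> w \<in> hom C c y" using f w by auto
  have "(f \<cdot> w) \<cdot> i1 = Idt C y \<cdot> f" using assoc[OF i1 w f] wi1 id_left[OF f] id_right[OF f] by simp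
  then obtain p where p: "p \<in> hom C z y" "p \<cdot> l = f \<cdot> w" "p \<cdot> j = Idt C y" by (rule po_ex[OF z fw idy])
  have pw: "p \<in> we" using section_we[OF zh(4) p(1,3) jw] .
  define i where "i = l \<cdot> i0"
  have i: "i \<in> hom C x z" unfolding i_def using i0 zh by auto
  have "p \<cdot> i = f" unfolding i_def
    using assoc[OF i0 zh(3) p(1)] p(2) assoc[OF i0 w f] wi0 id_right[OF f] by simp
  \<comment> \<open>Nothing makes \<open>l\<close> a cofibration, so \<open>i\<close> is rewritten
    as \<open>m \<cdot> b0\<close> with \<open>b0\<close> the inclusion of \<open>x\<close> into
    \<open>r = x \<squnion> y\<close>. Two cancellations of pushouts show that \<open>m\<close> is
    the cobase change of the cylinder inclusion \<open>k\<close> along \<open>t\<close>, the map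
    from \<open>x \<squnion> x\<close> to \<open>x \<squnion> y\<close> induced by
    \<open>f\<close>.\<close>
  moreover have "i \<in> cof"
  proof -
    obtain r b0 b1 where r: "po e x y r ex ey b0 b1" using po_exists[OF ex ey] ecof ex by blast
    note rh = po_hom[OF r]
    have b0: "b0 \<in> cof" using po_cof[OF po_sym[OF r]] ecof ey by blast
    have b1f: "b1 \<cdot> f \<in> hom C x r" using rh f by auto
    have "b0 \<cdot> ex = (b1 \<cdot> f) \<cdot> ex" by (rule einit) (use ex rh b1f in auto)
    then obtain t where t: "t \<in> hom C q r" "t \<cdot> a0 = b0" "t \<cdot> a1 = b1 \<cdot> f" by (rule po_ex[OF q rh(3) b1f])
    have fex: "f \<cdot> ex = ey" by (rule einit) (use f ex ey in auto)
    have pt: "po x q y r a1 f t b1"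
      using po_cancel[OF q _ f t(1)] r fex t by simp
    have "i \<cdot> ex = j \<cdot> ey" by (rule einit) (use i ex ey zh in auto)
    then obtain m where m: "m \<in> hom C r z" "m \<cdot> b0 = i" "m \<cdot> b1 = j" by (rule po_ex[OF r i zh(4)])
    have eq: "m \<cdot> t = l \<cdot> k"
    proof (rule po_eq[OF q])
      show "m \<cdot> t \<in> hom C q z" "l \<cdot> k \<in> hom C q z" using m t zh k by auto
      show "m \<cdot> t \<cdot> a0 = l \<cdot> k \<cdot> a0"
        using assoc[OF qh(3) t(1) m(1)] assoc[OF qh(3) k zh(3)] t m by (simp add: i_def i0_def)
      show "m \<cdot> t \<cdot> a1 = l \<cdot> k \<cdot> a1"
        using assoc[OF qh(4) t(1) m(1)] assoc[OF qh(4) k zh(3)] t m assoc[OF f rh(4) m(1)] po_comm[OF z]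
        by (simp add: i1_def)
    qed
    have "po q r c z t k m l"
    proof (rule po_cancel[OF po_sym[OF pt]])
      show "po x y c z f (k \<cdot> a1) j l" using po_sym[OF z] i1_def by simp
      show "k \<in> hom C q c" "m \<in> hom C r z" "m \<cdot> b1 = j" "m \<cdot> t = l \<cdot> k" using k m eq by auto
    qed
    then have "m \<in> cof" using po_cof[OF po_sym] kw(1) by blast
    then show ?thesis using cof_comp[OF rh(3) m(1) b0] m(2) by simp
  qed
  ultimately show ?thesis using that[OF i _ p(1) pw _ zh(4) jc p(3)] by blast
qed

text \<open>Ken Brown's lemma for the cobase change along \<open>g\<close>, on objects cofibrant under \<open>a\<close>.\<close>

lemma cobase_change_we:
  assumes k: "k \<in> cof" and k': "k' \<in> cof" and w: "w \<in> hom C e b" "w \<in> we" "w \<cdot> k = k'"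
    and p1: "po a e c p k g g1 c1" and p2: "po a b c q k' g g2 c2"
    and h: "h \<in> hom C p q" "h \<cdot> g1 = g2 \<cdot> w" "h \<cdot> c1 = c2"
  shows "h \<in> we"
proof -
  note h1 = po_hom[OF p1] and h2 = po_hom[OF p2]
  obtain v e' b' where v: "po a e b v k k' e' b'" using po_exists[OF h1(1) h2(1) k] .
  note vh = po_hom[OF v]
  have e'c: "e' \<in> cof" and b'c: "b' \<in> cof" using po_cof[OF v k] po_cof[OF po_sym[OF v] k'] by auto
  have b: "b \<in> Obj C" using w hom_obj by blast
  obtain m where m: "m \<in> hom C v b" "m \<cdot> e' = w" "m \<cdot> b' = Idt C b"
    using po_ex[OF v w(1) id_hom[OF b]] w(3) id_left[OF h2(1)] by auto
  \<comment> \<open>\<open>m\<close> is \<open>w\<close> on \<open>e\<close> and the identity on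
    \<open>b\<close>. Its factorization presents \<open>w\<close> as
    \<open>r \<cdot> \<alpha>\<close> with \<open>\<alpha>\<close> an acyclic cofibration, and
    \<open>r\<close> as a retraction of the acyclic cofibration \<open>\<beta>\<close>. Both
    properties survive cobase change.\<close>
  obtain z n r where n: "n \<in> hom C v z" "n \<in> cof" and r: "r \<in> hom C z b" "r \<in> we" "r \<cdot> n = m"
    using factorization[OF m(1)] by metis
  define \<alpha> where "\<alpha> = n \<cdot> e'"
  define \<beta> where "\<beta> = n \<cdot> b'"
  have al: "\<alpha> \<in> hom C e z" and be: "\<beta> \<in> hom C b z" unfolding \<alpha>_def \<beta>_def using n vh by auto
  have alc: "\<alpha> \<in> cof" and bec: "\<beta> \<in> cof" unfolding \<alpha>_def \<beta>_def using cof_comp n vh e'c b'c by blast+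
  have ra: "r \<cdot> \<alpha> = w" and rb: "r \<cdot> \<beta> = Idt C b"
    unfolding \<alpha>_def \<beta>_def using assoc[OF vh(3) n(1) r(1)] assoc[OF vh(4) n(1) r(1)] r m by auto
  have alw: "\<alpha> \<in> we" using we_cancel_left[OF al r(1,2)] ra w by simp
  have bew: "\<beta> \<in> we" using retraction_we[OF be r(1) rb r(2)] .
  have ak: "\<alpha> \<cdot> k = \<beta> \<cdot> k'" unfolding \<alpha>_def \<beta>_def
    using assoc[OF vh(1,3) n(1)] assoc[OF vh(2,4) n(1)] po_comm[OF v] by simp
  \<comment> \<open>\<open>y\<close> is the cobase change of \<open>z\<close> along
    \<open>g\<close>. Reached through \<open>e\<close> it exhibits \<open>\<alpha>1\<close> as a
    cobase change of \<open>\<alpha>\<close>; reached through \<open>b\<close> it exhibits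
    \<open>\<beta>1\<close> as one of \<open>\<beta>\<close>. Hence both are weak
    equivalences.\<close>
  obtain y \<gamma> \<alpha>1 where y: "po e z p y \<alpha> g1 \<gamma> \<alpha>1" using po_exists[OF al h1(3) alc] .
  note yh = po_hom[OF y]
  have a1c: "\<alpha>1 \<in> we" using po_we[OF y alc alw] .
  have big: "po a c z y g (\<beta> \<cdot> k') (\<alpha>1 \<cdot> c1) \<gamma>"
    using po_paste[OF po_sym[OF p1] po_sym[OF y]] ak by simp
  have "(\<gamma> \<cdot> \<beta>) \<cdot> k' = (\<alpha>1 \<cdot> c1) \<cdot> g"
    using po_comm[OF big] assoc[OF h2(1) be yh(3)] by simp
  then obtain \<beta>1 where b1: "\<beta>1 \<in> hom C q y" "\<beta>1 \<cdot> g2 = \<gamma> \<cdot> \<beta>" "\<beta>1 \<cdot> c2 = \<alpha>1 \<cdot> c1"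
    by (rule po_ex[OF p2 comp_hom[OF be yh(3)] comp_hom[OF h1(4) yh(4)]])
  have "po b q z y g2 \<beta> \<beta>1 \<gamma>"
    using po_cancel[OF po_sym[OF p2] big be b1(1) b1(3) b1(2)] .
  then have b1c: "\<beta>1 \<in> we" using po_we[OF po_sym] bec bew by blast
  have "(g2 \<cdot> r) \<cdot> \<alpha> = h \<cdot> g1" using assoc[OF al r(1) h2(3)] ra h by simp
  then obtain s where s: "s \<in> hom C y q" "s \<cdot> \<gamma> = g2 \<cdot> r" "s \<cdot> \<alpha>1 = h"
    by (rule po_ex[OF y comp_hom[OF r(1) h2(3)] h(1)])
  have q: "q \<in> Obj C" using h hom_obj by blast
  have "s \<cdot> \<beta>1 = Idt C q"
  proof (rule po_eq[OF p2])
    show "s \<cdot> \<beta>1 \<in> hom C q q" "Idt C q \<in> hom C q q" using s b1 q by auto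
    show "s \<cdot> \<beta>1 \<cdot> g2 = Idt C q \<cdot> g2"
      using assoc[OF h2(3) b1(1) s(1)] b1(2) assoc[OF be yh(3) s(1)] s(2) assoc[OF be r(1) h2(3)] rb
        id_left[OF h2(3)] id_right[OF h2(3)] by simp
    show "s \<cdot> \<beta>1 \<cdot> c2 = Idt C q \<cdot> c2"
      using assoc[OF h2(4) b1(1) s(1)] b1(3) assoc[OF h1(4) yh(4) s(1)] s(3) h(3) id_left[OF h2(4)] by simp
  qed
  then have "s \<in> we" using section_we[OF b1(1) s(1) _ b1c] by blast
  then show ?thesis using we_comp[OF yh(4) s(1) a1c] s(3) by simp
qed

text \<open>
  The pushout \<open>e\<close> of \<open>s\<close> along \<open>i \<cdot> s\<close> is cofibrant under \<open>a\<close>, and its cobase change along \<open>u\<close> is \<open>b\<close>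
  itself. Ken Brown's lemma for the retraction \<open>e \<rightarrow> b\<close> therefore yields \<open>u'\<close>.
\<close>

lemma left_proper_section:
  assumes i: "i \<in> cof" and po: "po a b c q i u u' i'" and s: "s \<in> hom C c a" "s \<in> cof" "s \<in> we" "u \<cdot> s = Idt C c"
  shows "u' \<in> we"
proof -
  note h = po_hom[OF po]
  have is_hom: "i \<cdot> s \<in> hom C c b" and isc: "i \<cdot> s \<in> cof" using h s i cof_comp by blast+
  obtain e m n where e: "po c a b e s (i \<cdot> s) m n" using po_exists[OF s(1) is_hom s(2)] .
  note eh = po_hom[OF e]
  have nw: "n \<in> we" using po_we[OF e s(2,3)] .
  have mc: "m \<in> cof" using po_cof[OF po_sym[OF e] isc] .
  have b: "b \<in> Obj C" using h hom_obj by blast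
  note idb = id_hom[OF b]
  obtain w where w: "w \<in> hom C e b" "w \<cdot> m = i" "w \<cdot> n = Idt C b"
    using po_ex[OF e h(1) idb] id_left[OF is_hom] by auto
  have ww: "w \<in> we" using section_we[OF eh(4) w(1,3) nw] .
  have isu: "(i \<cdot> s) \<cdot> u \<in> hom C a b" using is_hom h by auto
  have "((i \<cdot> s) \<cdot> u) \<cdot> s = Idt C b \<cdot> (i \<cdot> s)"
    using assoc[OF s(1) h(2) is_hom] s(4) id_left[OF is_hom] id_right[OF is_hom] by simp
  then obtain r where r: "r \<in> hom C e b" "r \<cdot> m = (i \<cdot> s) \<cdot> u" "r \<cdot> n = Idt C b"
    by (rule po_ex[OF e isu idb])
  have p1: "po a e c b m u r (i \<cdot> s)"
  proof (rule po_cancel[OF po_sym[OF e]])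
    show "po c b c b (i \<cdot> s) (u \<cdot> s) (Idt C b) (i \<cdot> s)" using po_id[OF is_hom] s(4) by simp
    show "u \<in> hom C a c" "r \<in> hom C e b" "r \<cdot> n = Idt C b" "r \<cdot> m = (i \<cdot> s) \<cdot> u" using h r by auto
  qed
  have uis: "u' \<cdot> (i \<cdot> s) = i'"
    using assoc[OF s(1) h(1,3)] assoc[OF s(1) h(2,4)] po_comm[OF po] s(4) id_right[OF h(4)] by simp
  \<comment> \<open>On \<open>a\<close> the two maps differ, being
    \<open>(i \<cdot> s) \<cdot> u\<close> and \<open>i\<close>, but \<open>u'\<close> identifies
    them. So \<open>u'\<close> is the map that \<open>w\<close> induces on cobase changes along
    \<open>u\<close>, as \<open>cobase_change_we\<close> requires.\<close>
  have "u' \<cdot> r = u' \<cdot> w"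
  proof (rule po_eq[OF e])
    show "u' \<cdot> r \<in> hom C e q" "u' \<cdot> w \<in> hom C e q" using h r w by auto
    show "u' \<cdot> r \<cdot> m = u' \<cdot> w \<cdot> m"
      using assoc[OF eh(3) r(1) h(3)] assoc[OF eh(3) w(1) h(3)] r w assoc[OF h(2) is_hom h(3)] uis po_comm[OF po] by simp
    show "u' \<cdot> r \<cdot> n = u' \<cdot> w \<cdot> n"
      using assoc[OF eh(4) r(1) h(3)] assoc[OF eh(4) w(1) h(3)] r w by simp
  qed
  then show ?thesis using cobase_change_we[OF mc i w(1) ww w(2) p1 po h(3)] uis by blast
qed

text \<open>A mapping cylinder writes \<open>u\<close> as \<open>p \<cdot> j\<close>, with
  \<open>j\<close> an acyclic cofibration and \<open>p\<close> a retraction of the acyclic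
  cofibration \<open>s\<close>. The first factor is covered by the pushout axiom, the second by
  \<open>left_proper_section\<close>.\<close>

lemma left_proper:
  assumes i: "i \<in> cof" and u: "u \<in> we" and po: "po a b c q i u u' i'"
  shows "u' \<in> we"
proof -
  note h = po_hom[OF po]
  obtain z j p s where j: "j \<in> hom C a z" "j \<in> cof" and p: "p \<in> hom C z c" "p \<in> we" "p \<cdot> j = u"
    and s: "s \<in> hom C c z" "s \<in> cof" "p \<cdot> s = Idt C c"
    using factorization[OF h(2)] .
  have jw: "j \<in> we" using we_cancel_left[OF j(1) p(1,2)] p(3) u by simp
  have sw: "s \<in> we" using retraction_we[OF s(1) p(1) s(3) p(2)] .
  obtain d j1 i1 where d: "po a b z d i j j1 i1" using po_exists[OF h(1) j(1) i] .
  note dh = po_hom[OF d]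
  have "j1 \<in> we" using po_we[OF po_sym[OF d] j(2) jw] .
  moreover have i1c: "i1 \<in> cof" using po_cof[OF d i] .
  have "u' \<cdot> i = (i' \<cdot> p) \<cdot> j" using po_comm[OF po] assoc[OF j(1) p(1) h(4)] p(3) by simp
  then obtain p1 where p1: "p1 \<in> hom C d q" "p1 \<cdot> j1 = u'" "p1 \<cdot> i1 = i' \<cdot> p"
    by (rule po_ex[OF d h(3) comp_hom[OF p(1) h(4)]])
  have "po z d c q i1 p p1 i'"
    using po_cancel[OF d _ p(1) p1(1,2,3)] po p(3) by simp
  then have "p1 \<in> we" using left_proper_section[OF i1c _ s(1,2) sw s(3)] by blast
  ultimately show ?thesis using we_comp[OF dh(3) p1(1)] p1(2) by simp
qed

text \<open>Pushing the upper span out along \<open>\<alpha>\<close> and \<open>\<gamma>\<close>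
  changes \<open>b\<close> and \<open>p\<close> only by weak equivalences, by left properness. What
  remains has the same apex \<open>a'\<close> and the same map \<open>g'\<close> on both sides, and
  only the cofibration varies, from \<open>k1\<close> to \<open>k'\<close>: this is the case of
  \<open>cobase_change_we\<close>.\<close>

lemma gluing:
  assumes k: "k \<in> cof" and k': "k' \<in> cof"
    and p: "po a b c p k g gb kc" and p': "po a' b' c' p' k' g' gb' kc'"
    and \<alpha>: "\<alpha> \<in> hom C a a'" "\<alpha> \<in> we" and \<beta>: "\<beta> \<in> hom C b b'" "\<beta> \<in> we" and \<gamma>: "\<gamma> \<in> hom C c c'" "\<gamma> \<in> we"
    and c1: "\<beta> \<cdot> k = k' \<cdot> \<alpha>" and c2: "\<gamma> \<cdot> g = g' \<cdot> \<alpha>"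
    and h: "h \<in> hom C p p'" "h \<cdot> gb = gb' \<cdot> \<beta>" "h \<cdot> kc = kc' \<cdot> \<gamma>"
  shows "h \<in> we"
proof -
  note h1 = po_hom[OF p] and h2 = po_hom[OF p']
  obtain e \<alpha>1 k1 where e: "po a b a' e k \<alpha> \<alpha>1 k1" using po_exists[OF h1(1) \<alpha>(1) k] .
  note eh = po_hom[OF e]
  have k1c: "k1 \<in> cof" using po_cof[OF e k] .
  have a1w: "\<alpha>1 \<in> we" using left_proper[OF k \<alpha>(2) e] .
  obtain w where w: "w \<in> hom C e b'" "w \<cdot> \<alpha>1 = \<beta>" "w \<cdot> k1 = k'" by (rule po_ex[OF e \<beta>(1) h2(1) c1])
  have ww: "w \<in> we" using we_cancel_right[OF eh(3) w(1) a1w] w(2) \<beta> by simp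
  have kcc: "kc \<in> cof" using po_cof[OF p k] .
  obtain q \<gamma>1 kq where q: "po c p c' q kc \<gamma> \<gamma>1 kq" using po_exists[OF h1(4) \<gamma>(1) kcc] .
  note qh = po_hom[OF q]
  have g1w: "\<gamma>1 \<in> we" using left_proper[OF kcc \<gamma>(2) q] .
  have big: "po a b c' q k (g' \<cdot> \<alpha>) (\<gamma>1 \<cdot> gb) kq" using po_paste[OF p q] c2 by simp
  have "(\<gamma>1 \<cdot> gb) \<cdot> k = (kq \<cdot> g') \<cdot> \<alpha>" using po_comm[OF big] assoc[OF \<alpha>(1) h2(2) qh(4)] by simp
  then obtain x where x: "x \<in> hom C e q" "x \<cdot> \<alpha>1 = \<gamma>1 \<cdot> gb" "x \<cdot> k1 = kq \<cdot> g'"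
    by (rule po_ex[OF e comp_hom[OF h1(3) qh(3)] comp_hom[OF h2(2) qh(4)]])
  \<comment> \<open>\<open>q\<close> was formed from \<open>p\<close> along \<open>\<gamma>\<close>;
    pasting and cancelling show that it is also the cobase change of \<open>e\<close> along
    \<open>g'\<close>.\<close>
  have p1: "po a' e c' q k1 g' x kq" using po_cancel[OF e big h2(2) x(1,2,3)] .
  obtain h' where h': "h' \<in> hom C q p'" "h' \<cdot> \<gamma>1 = h" "h' \<cdot> kq = kc'" by (rule po_ex[OF q h(1) h2(4) h(3)])
  have "h' \<cdot> x = gb' \<cdot> w"
  proof (rule po_eq[OF e])
    show "h' \<cdot> x \<in> hom C e p'" "gb' \<cdot> w \<in> hom C e p'" using h' x h2 w by auto
    show "h' \<cdot> x \<cdot> \<alpha>1 = gb' \<cdot> w \<cdot> \<alpha>1"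
      using assoc[OF eh(3) x(1) h'(1)] x(2) assoc[OF h1(3) qh(3) h'(1)] h'(2) h(2) assoc[OF eh(3) w(1) h2(3)] w by simp
    show "h' \<cdot> x \<cdot> k1 = gb' \<cdot> w \<cdot> k1"
      using assoc[OF eh(4) x(1) h'(1)] x(3) assoc[OF h2(2) qh(4) h'(1)] h'(3) po_comm[OF p'] assoc[OF eh(4) w(1) h2(3)] w by simp
  qed
  then have "h' \<in> we" using cobase_change_we[OF k1c k' w(1) ww w(3) p1 p' h'(1)] h'(3) by blast
  then show ?thesis using we_comp[OF qh(3) h'(1) g1w] h'(2) by simp
qed

end

section \<open>Homotopy invariance of coproducts and of sequential colimits along
  cofibrations\<close>

section \<open>Coproducts and sequential colimits of weak equivalences\<close>

context category_locale begin

lemma cop_ex1: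
  "is_coproduct C I X p \<iota> \<Longrightarrow> y \<in> Obj C \<Longrightarrow> \<forall>i\<in>I. \<kappa> i \<in> hom C (X i) y \<Longrightarrow>
    \<exists>!h. h \<in> hom C p y \<and> (\<forall>i\<in>I. h \<cdot> \<iota> i = \<kappa> i)"
  by (simp add: is_coproduct_def)

lemma cop_ex:
  assumes "is_coproduct C I X p \<iota>" "y \<in> Obj C" "\<And>i. i \<in> I \<Longrightarrow> \<kappa> i \<in> hom C (X i) y"
  obtains h where "h \<in> hom C p y" "\<And>i. i \<in> I \<Longrightarrow> h \<cdot> \<iota> i = \<kappa> i"
proof -
  have "\<exists>!h. h \<in> hom C p y \<and> (\<forall>i\<in>I. h \<cdot> \<iota> i = \<kappa> i)"
    using cop_ex1[OF assms(1,2)] assms(3) by simp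
  then show ?thesis using that by blast
qed

lemma cop_hom: "is_coproduct C I X p \<iota> \<Longrightarrow> i \<in> I \<Longrightarrow> \<iota> i \<in> hom C (X i) p"
  unfolding is_coproduct_def by blast

lemma cop_eq:
  assumes c: "is_coproduct C I X p \<iota>" and h: "h \<in> hom C p y" and k: "k \<in> hom C p y"
    and eq: "\<And>i. i \<in> I \<Longrightarrow> h \<cdot> \<iota> i = k \<cdot> \<iota> i"
  shows "h = k"
proof -
  have "\<forall>i\<in>I. h \<cdot> \<iota> i \<in> hom C (X i) y" using cop_hom[OF c] h by blast
  then have "\<exists>!l. l \<in> hom C p y \<and> (\<forall>i\<in>I. l \<cdot> \<iota> i = h \<cdot> \<iota> i)"
    by (rule cop_ex1[OF c hom_obj(2)[OF h]])
  then show ?thesis using h k eq by (metis (no_types, lifting))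
qed

lemma seq_hom:
  assumes "is_seq_colimit C X f x \<iota>"
  shows "\<iota> n \<in> hom C (X n) x" "\<iota> (Suc n) \<cdot> f n = \<iota> n"
  using assms unfolding is_seq_colimit_def by auto

lemma seq_ex1:
  "is_seq_colimit C X f x \<iota> \<Longrightarrow> y \<in> Obj C \<Longrightarrow> \<forall>n. \<kappa> n \<in> hom C (X n) y \<Longrightarrow> \<forall>n. \<kappa> (Suc n) \<cdot> f n = \<kappa> n \<Longrightarrow>
    \<exists>!h. h \<in> hom C x y \<and> (\<forall>n. h \<cdot> \<iota> n = \<kappa> n)"
  by (simp add: is_seq_colimit_def)

lemma seq_ex:
  assumes "is_seq_colimit C X f x \<iota>" "y \<in> Obj C" "\<And>n. \<kappa> n \<in> hom C (X n) y" "\<And>n. \<kappa> (Suc n) \<cdot> f n = \<kappa> n"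
  obtains h where "h \<in> hom C x y" "\<And>n. h \<cdot> \<iota> n = \<kappa> n"
proof -
  have "\<exists>!h. h \<in> hom C x y \<and> (\<forall>n. h \<cdot> \<iota> n = \<kappa> n)"
    using seq_ex1[OF assms(1,2)] assms(3,4) by simp
  then show ?thesis using that by blast
qed

lemma seq_eq:
  assumes c: "is_seq_colimit C X f x \<iota>" and f: "\<And>n. f n \<in> hom C (X n) (X (Suc n))"
    and h: "h \<in> hom C x y" and k: "k \<in> hom C x y" and eq: "\<And>n. h \<cdot> \<iota> n = k \<cdot> \<iota> n"
  shows "h = k"
proof -
  have "\<forall>n. h \<cdot> \<iota> n \<in> hom C (X n) y" using seq_hom[OF c] h by blast
  moreover have "\<forall>n. (h \<cdot> \<iota> (Suc n)) \<cdot> f n = h \<cdot> \<iota> n"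
    using assoc[OF f seq_hom(1)[OF c] h] seq_hom(2)[OF c] by simp
  ultimately have "\<exists>!l. l \<in> hom C x y \<and> (\<forall>n. l \<cdot> \<iota> n = h \<cdot> \<iota> n)"
    by (rule seq_ex1[OF c hom_obj(2)[OF h]])
  then show ?thesis using h k eq by (metis (no_types, lifting))
qed

lemma seqI:
  assumes "x \<in> Obj C" "\<And>n. \<iota> n \<in> hom C (X n) x" "\<And>n. \<iota> (Suc n) \<cdot> f n = \<iota> n"
    and "\<And>y \<kappa>. y \<in> Obj C \<Longrightarrow> (\<And>n. \<kappa> n \<in> hom C (X n) y) \<Longrightarrow> (\<And>n. \<kappa> (Suc n) \<cdot> f n = \<kappa> n) \<Longrightarrow>
       \<exists>h\<in>hom C x y. \<forall>n. h \<cdot> \<iota> n = \<kappa> n"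
    and "\<And>y h k. h \<in> hom C x y \<Longrightarrow> k \<in> hom C x y \<Longrightarrow> (\<And>n. h \<cdot> \<iota> n = k \<cdot> \<iota> n) \<Longrightarrow> h = k"
  shows "is_seq_colimit C X f x \<iota>"
  unfolding is_seq_colimit_def
proof (intro conjI ballI allI impI)
  fix y \<kappa> assume "y \<in> Obj C" "\<forall>n. \<kappa> n \<in> hom C (X n) y" "\<forall>n. \<kappa> (Suc n) \<cdot> f n = \<kappa> n"
  then obtain h where h: "h \<in> hom C x y" "\<forall>n. h \<cdot> \<iota> n = \<kappa> n" using assms(4)[of y \<kappa>] by auto
  then show "\<exists>!h. h \<in> hom C x y \<and> (\<forall>n. h \<cdot> \<iota> n = \<kappa> n)" using assms(5)[of _ y] by (intro ex1I[of _ h]) auto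
qed (use assms in auto)

end

context cof_category begin

text \<open>The axiom treats acyclic cofibrations only. Mapping cylinders give
  \<open>f i = p i \<cdot> u i\<close> with \<open>p i\<close> a retraction of \<open>s i\<close>,
  where \<open>u i\<close> and \<open>s i\<close> are acyclic cofibrations; the coproduct of the
  \<open>p i\<close> is then a weak equivalence because it retracts the coproduct of the
  \<open>s i\<close>.\<close>

lemma coproduct_we:
  assumes I: "I \<in> U" and f: "\<And>i. i \<in> I \<Longrightarrow> f i \<in> hom C (X i) (Y i)" "\<And>i. i \<in> I \<Longrightarrow> f i \<in> we"
    and cx: "is_coproduct C I X x \<iota>" and cy: "is_coproduct C I Y y \<kappa>"
    and h: "h \<in> hom C x y" "\<And>i. i \<in> I \<Longrightarrow> h \<cdot> \<iota> i = \<kappa> i \<cdot> f i"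
  shows "h \<in> we"
proof -
  have "\<exists>z u p s. u \<in> hom C (X i) z \<and> u \<in> cof \<and> p \<in> hom C z (Y i) \<and> p \<in> we \<and> p \<cdot> u = f i \<and>
    s \<in> hom C (Y i) z \<and> s \<in> cof \<and> p \<cdot> s = Idt C (Y i)" if "i \<in> I" for i
    by (rule factorization[OF f(1)[OF that]]) blast
  then have "\<forall>i\<in>I. \<exists>z u p s. u \<in> hom C (X i) z \<and> u \<in> cof \<and> p \<in> hom C z (Y i) \<and> p \<in> we \<and> p \<cdot> u = f i \<and>
    s \<in> hom C (Y i) z \<and> s \<in> cof \<and> p \<cdot> s = Idt C (Y i)" by blast
  then obtain Z u p s where "\<forall>i\<in>I. u i \<in> hom C (X i) (Z i) \<and> u i \<in> cof \<and> p i \<in> hom C (Z i) (Y i) \<and> p i \<in> we \<and>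
     p i \<cdot> u i = f i \<and> s i \<in> hom C (Y i) (Z i) \<and> s i \<in> cof \<and> p i \<cdot> s i = Idt C (Y i)"
    unfolding bchoice_iff by blast
  then have zs: "\<And>i. i \<in> I \<Longrightarrow> u i \<in> hom C (X i) (Z i)" "\<And>i. i \<in> I \<Longrightarrow> u i \<in> cof"
      "\<And>i. i \<in> I \<Longrightarrow> p i \<in> hom C (Z i) (Y i)" "\<And>i. i \<in> I \<Longrightarrow> p i \<in> we" "\<And>i. i \<in> I \<Longrightarrow> p i \<cdot> u i = f i"
      "\<And>i. i \<in> I \<Longrightarrow> s i \<in> hom C (Y i) (Z i)" "\<And>i. i \<in> I \<Longrightarrow> s i \<in> cof" "\<And>i. i \<in> I \<Longrightarrow> p i \<cdot> s i = Idt C (Y i)"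
    by auto
  have uw: "u i \<in> we" if "i \<in> I" for i
    using we_cancel_left[OF zs(1)[OF that] zs(3)[OF that] zs(4)[OF that]] zs(5) f that by simp
  have sw: "s i \<in> we" if "i \<in> I" for i
    using retraction_we[OF zs(6)[OF that] zs(3)[OF that] zs(8)[OF that] zs(4)[OF that]] .
  have "\<forall>i\<in>I. Z i \<in> Obj C" using hom_obj(2)[OF zs(1)] by blast
  then obtain z \<zeta> where z: "is_coproduct C I Z z \<zeta>" using coproduct_exists I by blast
  have zO: "z \<in> Obj C" and yO: "y \<in> Obj C" using z cy unfolding is_coproduct_def by blast+
  note ch = cop_hom[OF cx] cop_hom[OF cy] cop_hom[OF z]
  obtain u' where u': "u' \<in> hom C x z" "\<And>i. i \<in> I \<Longrightarrow> u' \<cdot> \<iota> i = \<zeta> i \<cdot> u i"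
    by (rule cop_ex[OF cx zO, of "\<lambda>i. \<zeta> i \<cdot> u i"]) (use zs(1) ch(3) in blast)+
  obtain s' where s': "s' \<in> hom C y z" "\<And>i. i \<in> I \<Longrightarrow> s' \<cdot> \<kappa> i = \<zeta> i \<cdot> s i"
    by (rule cop_ex[OF cy zO, of "\<lambda>i. \<zeta> i \<cdot> s i"]) (use zs(6) ch(3) in blast)+
  obtain p' where p': "p' \<in> hom C z y" "\<And>i. i \<in> I \<Longrightarrow> p' \<cdot> \<zeta> i = \<kappa> i \<cdot> p i"
    by (rule cop_ex[OF z yO, of "\<lambda>i. \<kappa> i \<cdot> p i"]) (use zs(3) ch(2) in blast)+
  have "u' \<in> cof \<inter> we"
    by (rule coproduct_cof[rule_format, OF _ I _ cx z u'(1), of _ u]) (use u'(2) zs uw in auto)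
  moreover have s'w: "s' \<in> cof \<inter> we"
    by (rule coproduct_cof[rule_format, OF _ I _ cy z s'(1), of _ s]) (use s'(2) zs sw in auto)
  moreover have "p' \<cdot> s' = Idt C y"
  proof (rule cop_eq[OF cy])
    show "p' \<cdot> s' \<in> hom C y y" "Idt C y \<in> hom C y y" using p' s' yO by auto
    fix i assume i: "i \<in> I"
    have "(p' \<cdot> s') \<cdot> \<kappa> i = p' \<cdot> (\<zeta> i \<cdot> s i)" using assoc[OF ch(2)[OF i] s'(1) p'(1)] s'(2)[OF i] by simp
    also have "\<dots> = (p' \<cdot> \<zeta> i) \<cdot> s i" using assoc[OF zs(6)[OF i] ch(3)[OF i] p'(1)] by simp
    also have "\<dots> = \<kappa> i \<cdot> (p i \<cdot> s i)" using assoc[OF zs(6)[OF i] zs(3)[OF i] ch(2)[OF i]] p'(2)[OF i] by simp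
    also have "\<dots> = Idt C y \<cdot> \<kappa> i" using zs(8)[OF i] id_left[OF ch(2)[OF i]] id_right[OF ch(2)[OF i]] by simp
    finally show "(p' \<cdot> s') \<cdot> \<kappa> i = Idt C y \<cdot> \<kappa> i" .
  qed
  then have "p' \<in> we" using section_we[OF s'(1) p'(1)] s'w by simp
  moreover have "h = p' \<cdot> u'"
  proof (rule cop_eq[OF cx])
    show "h \<in> hom C x y" "p' \<cdot> u' \<in> hom C x y" using h u' p' by auto
    fix i assume i: "i \<in> I"
    have "(p' \<cdot> u') \<cdot> \<iota> i = p' \<cdot> (\<zeta> i \<cdot> u i)" using assoc[OF ch(1)[OF i] u'(1) p'(1)] u'(2)[OF i] by simp
    also have "\<dots> = (p' \<cdot> \<zeta> i) \<cdot> u i" using assoc[OF zs(1)[OF i] ch(3)[OF i] p'(1)] by simp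
    also have "\<dots> = \<kappa> i \<cdot> (p i \<cdot> u i)" using assoc[OF zs(1)[OF i] zs(3)[OF i] ch(2)[OF i]] p'(2)[OF i] by simp
    finally show "h \<cdot> \<iota> i = (p' \<cdot> u') \<cdot> \<iota> i" using h(2)[OF i] zs(5)[OF i] by simp
  qed
  ultimately show ?thesis using we_comp[OF u'(1) p'(1)] by simp
qed

text \<open>The corner map from the pushout of \<open>X'\<close> and \<open>Z\<close> under
  \<open>X\<close> to \<open>Z'\<close> is an acyclic cofibration: one stage of a Reedy acyclic
  cofibration between sequences. Controlling the corner map, and not \<open>i'\<close> alone, lets
  the map on colimits be built up by cobase changes.\<close>

definition relative_acyclic where
  "relative_acyclic X X' f Z Z' e i i' \<longleftrightarrow>
     (\<exists>P a b m. po X X' Z P f i a b \<and> m \<in> hom C P Z' \<and> m \<in> cof \<and> m \<in> we \<and> m \<cdot> a = i' \<and> m \<cdot> b = e)"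

text \<open>
  The map on colimits is the composite of \<open>x \<rightarrow> W\<^sub>0 \<rightarrow> W\<^sub>1 \<rightarrow> \<dots>\<close> with \<open>W\<^sub>n\<close> the pushout of \<open>x\<close> and \<open>Z\<^sub>n\<close>
  under \<open>X\<^sub>n\<close>; each step is a cobase change of an acyclic relative map.
\<close>

lemma seq_colimit_acyclic:
  assumes i: "\<And>n. i n \<in> hom C (X n) (Z n)" "\<And>n. i n \<in> cof" "i 0 \<in> we"
    and f: "\<And>n. f n \<in> hom C (X n) (X (Suc n))" and e: "\<And>n. e n \<in> hom C (Z n) (Z (Suc n))"
    and rel: "\<And>n. relative_acyclic (X n) (X (Suc n)) (f n) (Z n) (Z (Suc n)) (e n) (i n) (i (Suc n))"
    and cx: "is_seq_colimit C X f x \<iota>" and cz: "is_seq_colimit C Z e z \<zeta>"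
    and t: "t \<in> hom C x z" "\<And>n. t \<cdot> \<iota> n = \<zeta> n \<cdot> i n"
  shows "t \<in> we"
proof -
  obtain P a b m where P: "\<And>n. po (X n) (X (Suc n)) (Z n) (P n) (f n) (i n) (a n) (b n)"
    and m: "\<And>n. m n \<in> hom C (P n) (Z (Suc n))" "\<And>n. m n \<in> cof" "\<And>n. m n \<in> we"
    and mab: "\<And>n. m n \<cdot> a n = i (Suc n)" "\<And>n. m n \<cdot> b n = e n"
    using rel unfolding relative_acyclic_def by metis
  have xO: "x \<in> Obj C" and zO: "z \<in> Obj C" using cx cz unfolding is_seq_colimit_def by auto
  note \<iota> = seq_hom[OF cx] and \<zeta> = seq_hom[OF cz]
  have "\<exists>W A B. po (X n) x (Z n) W (\<iota> n) (i n) A B" for n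
    using po_exists[OF i(1) \<iota>(1) i(2), of n] po_sym by metis
  then obtain W A B where W: "\<And>n. po (X n) x (Z n) (W n) (\<iota> n) (i n) (A n) (B n)" by metis
  have A: "A n \<in> hom C x (W n)" and B: "B n \<in> hom C (Z n) (W n)" for n using po_hom[OF W] by auto
  have ah: "a n \<in> hom C (X (Suc n)) (P n)" and bh: "b n \<in> hom C (Z n) (P n)" for n using po_hom[OF P] by auto
  have "\<exists>w. w \<in> hom C (W n) (W (Suc n)) \<and> w \<in> cof \<and> w \<in> we \<and> w \<cdot> A n = A (Suc n) \<and> w \<cdot> B n = B (Suc n) \<cdot> e n" for n
  proof -
    have As: "A n \<cdot> \<iota> (Suc n) \<in> hom C (X (Suc n)) (W n)" using A \<iota> by auto
    have "(A n \<cdot> \<iota> (Suc n)) \<cdot> f n = B n \<cdot> i n"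
      using assoc[OF f \<iota>(1) A] \<iota>(2) po_comm[OF W] by simp
    then obtain u where u: "u \<in> hom C (P n) (W n)" "u \<cdot> a n = A n \<cdot> \<iota> (Suc n)" "u \<cdot> b n = B n"
      by (rule po_ex[OF P As B])
    \<comment> \<open>Attaching \<open>Z n\<close> to \<open>x\<close> over \<open>X n\<close> can
      pass through \<open>P n\<close>; thus \<open>W n\<close> is the pushout of \<open>x\<close>
      and \<open>P n\<close> under \<open>X (Suc n)\<close>, and \<open>W (Suc n)\<close> arises
      from it by cobase change of \<open>m n\<close>.\<close>
    have "po (X (Suc n)) (P n) x (W n) (a n) (\<iota> (Suc n)) u (A n)"
      using po_cancel[OF po_sym[OF P] _ \<iota>(1) u(1,3,2)] po_sym[OF W[of n]] \<iota>(2) by simp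
    then have q: "po (X (Suc n)) x (P n) (W n) (\<iota> (Suc n)) (a n) (A n) u" using po_sym by blast
    have Bm: "B (Suc n) \<cdot> m n \<in> hom C (P n) (W (Suc n))" using B m by auto
    have "A (Suc n) \<cdot> \<iota> (Suc n) = (B (Suc n) \<cdot> m n) \<cdot> a n"
      using po_comm[OF W[of "Suc n"]] assoc[OF ah m(1) B] mab by simp
    then obtain w where w: "w \<in> hom C (W n) (W (Suc n))" "w \<cdot> A n = A (Suc n)" "w \<cdot> u = B (Suc n) \<cdot> m n"
      by (rule po_ex[OF q A Bm])
    have "po (P n) (W n) (Z (Suc n)) (W (Suc n)) u (m n) w (B (Suc n))"
      using po_cancel[OF q _ m(1) w] W[of "Suc n"] mab by simp
    then have "po (P n) (Z (Suc n)) (W n) (W (Suc n)) (m n) u (B (Suc n)) w" using po_sym by blast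
    then have "w \<in> cof" "w \<in> we" using po_cof po_we m by blast+
    moreover have "w \<cdot> B n = B (Suc n) \<cdot> e n"
      using assoc[OF bh u(1) w(1)] u(3) w(3) assoc[OF bh m(1) B] mab(2) by simp
    ultimately show ?thesis using w by blast
  qed
  then obtain w where w: "\<And>n. w n \<in> hom C (W n) (W (Suc n))" "\<And>n. w n \<in> cof" "\<And>n. w n \<in> we"
    "\<And>n. w n \<cdot> A n = A (Suc n)" "\<And>n. w n \<cdot> B n = B (Suc n) \<cdot> e n" by metis
  have "\<exists>T. T \<in> hom C (W n) z \<and> T \<cdot> A n = t \<and> T \<cdot> B n = \<zeta> n" for n
    by (rule po_ex[OF W t(1) \<zeta>(1) t(2)]) blast
  then obtain T where T: "\<And>n. T n \<in> hom C (W n) z" "\<And>n. T n \<cdot> A n = t" "\<And>n. T n \<cdot> B n = \<zeta> n" by metis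
  \<comment> \<open>In the limit \<open>z\<close> is attached to \<open>x\<close> along all of
    \<open>x\<close>, so the colimit of the \<open>W n\<close> is \<open>z\<close> itself. Hence
    \<open>T 0\<close> is a leg of the colimit of a sequence of acyclic cofibrations.\<close>
  have "is_seq_colimit C W w z T"
  proof (rule seqI[OF zO T(1)])
    fix n show "T (Suc n) \<cdot> w n = T n"
    proof (rule po_eq[OF W[of n]])
      show "T (Suc n) \<cdot> w n \<in> hom C (W n) z" "T n \<in> hom C (W n) z" using comp_hom[OF w(1) T(1)] T(1) by auto
      show "T (Suc n) \<cdot> w n \<cdot> A n = T n \<cdot> A n" using assoc[OF A w(1) T(1)] w(4) T(2) by simp
      show "T (Suc n) \<cdot> w n \<cdot> B n = T n \<cdot> B n" using assoc[OF B w(1) T(1)] w(5) T(3) assoc[OF e B T(1)] \<zeta>(2) by simp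
    qed
  next
    fix y \<kappa> assume y: "y \<in> Obj C" and k: "\<And>n. \<kappa> n \<in> hom C (W n) y" "\<And>n. \<kappa> (Suc n) \<cdot> w n = \<kappa> n"
    have kb: "\<kappa> n \<cdot> B n \<in> hom C (Z n) y" for n using comp_hom[OF B k(1)] .
    have kb2: "(\<kappa> (Suc n) \<cdot> B (Suc n)) \<cdot> e n = \<kappa> n \<cdot> B n" for n
      using assoc[OF e B k(1)] assoc[OF B w(1) k(1)] w(5) k(2) by simp
    obtain h where h: "h \<in> hom C z y" "\<And>n. h \<cdot> \<zeta> n = \<kappa> n \<cdot> B n"
      by (rule seq_ex[OF cz y kb kb2]) blast
    have kA: "\<kappa> n \<cdot> A n = \<kappa> 0 \<cdot> A 0" for n
    proof (induction n)
      case (Suc n)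
      then show ?case using assoc[OF A w(1) k(1), of n] w(4) k(2) by simp
    qed simp
    have ht: "h \<cdot> t = \<kappa> 0 \<cdot> A 0"
    proof (rule seq_eq[OF cx f])
      show "h \<cdot> t \<in> hom C x y" "\<kappa> 0 \<cdot> A 0 \<in> hom C x y" using comp_hom[OF t(1) h(1)] comp_hom[OF A k(1)] by auto
      fix n
      have "(h \<cdot> t) \<cdot> \<iota> n = (h \<cdot> \<zeta> n) \<cdot> i n" using assoc[OF \<iota>(1) t(1) h(1)] t(2) assoc[OF i(1) \<zeta>(1) h(1)] by simp
      also have "\<dots> = \<kappa> n \<cdot> (A n \<cdot> \<iota> n)" using h(2) assoc[OF i(1) B k(1)] po_comm[OF W] by simp
      also have "\<dots> = (\<kappa> 0 \<cdot> A 0) \<cdot> \<iota> n" using assoc[OF \<iota>(1) A k(1), of n n] kA[of n] by simp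
      finally show "(h \<cdot> t) \<cdot> \<iota> n = (\<kappa> 0 \<cdot> A 0) \<cdot> \<iota> n" .
    qed
    have "h \<cdot> T n = \<kappa> n" for n
    proof (rule po_eq[OF W[of n]])
      show "h \<cdot> T n \<in> hom C (W n) y" "\<kappa> n \<in> hom C (W n) y" using comp_hom[OF T(1) h(1)] k(1) by auto
      show "h \<cdot> T n \<cdot> A n = \<kappa> n \<cdot> A n" using assoc[OF A T(1) h(1)] T(2) ht kA by metis
      show "h \<cdot> T n \<cdot> B n = \<kappa> n \<cdot> B n" using assoc[OF B T(1) h(1)] T(3) h(2) by simp
    qed
    then show "\<exists>h\<in>hom C z y. \<forall>n. h \<cdot> T n = \<kappa> n" using h by blast
  next
    fix y h k assume hk: "h \<in> hom C z y" "k \<in> hom C z y" "\<And>n. h \<cdot> T n = k \<cdot> T n"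
    show "h = k"
    proof (rule seq_eq[OF cz e hk(1,2)])
      fix n show "h \<cdot> \<zeta> n = k \<cdot> \<zeta> n" using assoc[OF B T(1) hk(1)] assoc[OF B T(1) hk(2)] T(3) hk(3) by metis
    qed
  qed
  then have "T 0 \<in> cof \<inter> we"
    using seq_colimit_cof[rule_format, of "cof \<inter> we" w W z T] w by auto
  moreover have "A 0 \<in> we" using po_we[OF po_sym[OF W] i(2,3)] .
  ultimately show ?thesis using we_comp[OF A T(1)] T(2) by (metis IntD2)
qed

text \<open>A factorization of \<open>Z \<rightarrow> Y'\<close> alone would not control the corner
  maps. Therefore the next cylinder factors the map to \<open>Y'\<close> from \<open>V\<close>, the
  pushout of \<open>P\<close> and \<open>P'\<close> under \<open>Z\<close>, which receives
  cofibrations from both corners; two-out-of-three then makes the two corner maps acyclic.\<close>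

lemma relative_cylinder:
  assumes f: "f \<in> hom C X X'" "f \<in> cof" and g: "g \<in> hom C Y Y'" "g \<in> cof"
    and t: "t \<in> hom C X Y" "t \<in> we" and t': "t' \<in> hom C X' Y'" "t' \<in> we" and tt: "t' \<cdot> f = g \<cdot> t"
    and i: "i \<in> hom C X Z" "i \<in> cof" and j: "j \<in> hom C Y Z" "j \<in> cof" and p: "p \<in> hom C Z Y" "p \<in> we"
    and pi: "p \<cdot> i = t" and pj: "p \<cdot> j = Idt C Y"
  shows "\<exists>Z' i' j' p' e. i' \<in> hom C X' Z' \<and> i' \<in> cof \<and> j' \<in> hom C Y' Z' \<and> j' \<in> cof \<and> p' \<in> hom C Z' Y' \<and> p' \<in> we \<and>
     p' \<cdot> i' = t' \<and> p' \<cdot> j' = Idt C Y' \<and> e \<in> hom C Z Z' \<and> e \<in> cof \<and> p' \<cdot> e = g \<cdot> p \<and>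
     relative_acyclic X X' f Z Z' e i i' \<and> relative_acyclic Y Y' g Z Z' e j j'"
proof -
  obtain P a b where P: "po X X' Z P f i a b" using po_exists[OF f(1) i(1) f(2)] .
  obtain P' a' b' where P': "po Y Y' Z P' g j a' b'" using po_exists[OF g(1) j(1) g(2)] .
  note h = po_hom[OF P] and h' = po_hom[OF P']
  have bc: "b \<in> cof" and bc': "b' \<in> cof" using po_cof[OF P f(2)] po_cof[OF P' g(2)] by auto
  have ac: "a \<in> cof" and ac': "a' \<in> cof" using po_cof[OF po_sym[OF P] i(2)] po_cof[OF po_sym[OF P'] j(2)] by auto
  have Y': "Y' \<in> Obj C" using g hom_obj by auto
  have gp: "g \<cdot> p \<in> hom C Z Y'" using g p by auto
  have "t' \<cdot> f = (g \<cdot> p) \<cdot> i" using tt pi assoc[OF i(1) p(1) g(1)] by simp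
  then obtain \<pi> where \<pi>: "\<pi> \<in> hom C P Y'" "\<pi> \<cdot> a = t'" "\<pi> \<cdot> b = g \<cdot> p" by (rule po_ex[OF P t'(1) gp])
  have "Idt C Y' \<cdot> g = (g \<cdot> p) \<cdot> j" using pj assoc[OF j(1) p(1) g(1)] id_left[OF g(1)] id_right[OF g(1)] by simp
  then obtain \<pi>' where \<pi>': "\<pi>' \<in> hom C P' Y'" "\<pi>' \<cdot> a' = Idt C Y'" "\<pi>' \<cdot> b' = g \<cdot> p"
    by (rule po_ex[OF P' id_hom[OF Y'] gp])
  obtain V c c' where V: "po Z P P' V b b' c c'" using po_exists[OF h(4) h'(4) bc] .
  note vh = po_hom[OF V]
  have cc: "c \<in> cof" "c' \<in> cof" using po_cof[OF V bc] po_cof[OF po_sym[OF V] bc'] by auto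
  have "\<pi> \<cdot> b = \<pi>' \<cdot> b'" using \<pi> \<pi>' by simp
  then obtain v where v: "v \<in> hom C V Y'" "v \<cdot> c = \<pi>" "v \<cdot> c' = \<pi>'" by (rule po_ex[OF V \<pi>(1) \<pi>'(1)])
  obtain Z' n q where n: "n \<in> hom C V Z'" "n \<in> cof" and q: "q \<in> hom C Z' Y'" "q \<in> we" "q \<cdot> n = v"
    using factorization[OF v(1)] by metis
  define m where "m = n \<cdot> c"
  define m' where "m' = n \<cdot> c'"
  have m: "m \<in> hom C P Z'" and m': "m' \<in> hom C P' Z'" unfolding m_def m'_def using n vh by auto
  have mc: "m \<in> cof" "m' \<in> cof"
    unfolding m_def m'_def using cof_comp[OF vh(3) n(1) cc(1) n(2)] cof_comp[OF vh(4) n(1) cc(2) n(2)] by auto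
  have qm: "q \<cdot> m = \<pi>" "q \<cdot> m' = \<pi>'"
    unfolding m_def m'_def using assoc[OF vh(3) n(1) q(1)] assoc[OF vh(4) n(1) q(1)] q(3) v by auto
  have mb: "m \<cdot> b = m' \<cdot> b'" unfolding m_def m'_def
    using assoc[OF h(4) vh(3) n(1)] assoc[OF h'(4) vh(4) n(1)] po_comm[OF V] by simp
  have ma: "m \<cdot> a \<in> hom C X' Z'" "m' \<cdot> a' \<in> hom C Y' Z'" "m \<cdot> b \<in> hom C Z Z'" using m m' h h' by auto
  have qma: "q \<cdot> (m \<cdot> a) = t'" "q \<cdot> (m' \<cdot> a') = Idt C Y'" "q \<cdot> (m \<cdot> b) = g \<cdot> p"
    using assoc[OF h(3) m q(1)] assoc[OF h'(3) m' q(1)] assoc[OF h(4) m q(1)] qm \<pi> \<pi>' by auto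
  have iw: "i \<in> we" using we_cancel_left[OF i(1) p] pi t by simp
  have jw: "j \<in> we" using retraction_we[OF j(1) p(1) pj p(2)] .
  have aw: "a \<in> we" "a' \<in> we" using po_we[OF po_sym[OF P] i(2) iw] po_we[OF po_sym[OF P'] j(2) jw] by auto
  have "m \<cdot> a \<in> we" using we_cancel_left[OF ma(1) q(1,2)] qma t' by simp
  then have mw: "m \<in> we" using we_cancel_right[OF h(3) m aw(1)] by simp
  have "m' \<cdot> a' \<in> we" using retraction_we[OF ma(2) q(1) qma(2) q(2)] .
  then have mw': "m' \<in> we" using we_cancel_right[OF h'(3) m' aw(2)] by simp
  have "relative_acyclic X X' f Z Z' (m \<cdot> b) i (m \<cdot> a)" unfolding relative_acyclic_def using P m mc mw by blast
  moreover have "relative_acyclic Y Y' g Z Z' (m \<cdot> b) j (m' \<cdot> a')"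
    unfolding relative_acyclic_def mb using P' m' mc mw' by blast
  moreover have "m \<cdot> a \<in> cof" "m' \<cdot> a' \<in> cof" "m \<cdot> b \<in> cof"
    using cof_comp[OF h(3) m ac mc(1)] cof_comp[OF h'(3) m' ac' mc(2)] cof_comp[OF h(4) m bc mc(1)] by auto
  ultimately show ?thesis using ma qma q(1,2) by blast
qed

text \<open>The axiom concerns maps inside one sequence, not a map between two. The sequence of
  cylinders \<open>Z\<close> receives relatively acyclic maps from \<open>X\<close> and from
  \<open>Y\<close>; on colimits these become weak equivalences \<open>u\<close> and
  \<open>v\<close>. Since \<open>q\<close> retracts \<open>v\<close>, it is a weak equivalence, and
  so is \<open>h = q \<cdot> u\<close>.\<close>

lemma seq_colimit_we:
  assumes f: "\<And>n. f n \<in> hom C (X n) (X (Suc n))" "\<And>n. f n \<in> cof"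
    and g: "\<And>n. g n \<in> hom C (Y n) (Y (Suc n))" "\<And>n. g n \<in> cof"
    and t: "\<And>n. t n \<in> hom C (X n) (Y n)" "\<And>n. t n \<in> we" "\<And>n. t (Suc n) \<cdot> f n = g n \<cdot> t n"
    and cx: "is_seq_colimit C X f x \<iota>" and cy: "is_seq_colimit C Y g y \<kappa>"
    and h: "h \<in> hom C x y" "\<And>n. h \<cdot> \<iota> n = \<kappa> n \<cdot> t n"
  shows "h \<in> we"
proof -
  define Cyl where "Cyl n s \<longleftrightarrow> (case s of (Z, i, j, p) \<Rightarrow>
    i \<in> hom C (X n) Z \<and> i \<in> cof \<and> j \<in> hom C (Y n) Z \<and> j \<in> cof \<and> p \<in> hom C Z (Y n) \<and> p \<in> we \<and>
     p \<cdot> i = t n \<and> p \<cdot> j = Idt C (Y n))" for n s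
  define Ext where "Ext n s s' \<longleftrightarrow> (case (s, s') of ((Z, i, j, p), (Z', i', j', p')) \<Rightarrow>
    \<exists>e. e \<in> hom C Z Z' \<and> e \<in> cof \<and> p' \<cdot> e = g n \<cdot> p \<and>
     relative_acyclic (X n) (X (Suc n)) (f n) Z Z' e i i' \<and> relative_acyclic (Y n) (Y (Suc n)) (g n) Z Z' e j j')" for n s s'
  \<comment> \<open>Dependent choice replaces functoriality of the cylinders; \<open>Ext\<close>
    records the transition map and both corner conditions.\<close>
  have "\<exists>s. \<forall>n. Cyl n (s n) \<and> Ext n (s n) (s (Suc n))"
  proof (rule dependent_nat_choice)
    show "\<exists>s. Cyl 0 s"
      by (rule factorization[OF t(1)[of 0]]) (auto simp: Cyl_def)
    fix s n assume "Cyl n s"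
    then obtain Z i j p where s: "s = (Z, i, j, p)" "i \<in> hom C (X n) Z" "i \<in> cof" "j \<in> hom C (Y n) Z" "j \<in> cof"
      "p \<in> hom C Z (Y n)" "p \<in> we" "p \<cdot> i = t n" "p \<cdot> j = Idt C (Y n)"
      unfolding Cyl_def by (cases s) auto
    show "\<exists>s'. Cyl (Suc n) s' \<and> Ext n s s'"
      using relative_cylinder[OF f(1,2) g(1,2) t(1,2) t(1,2,3) s(2-9)]
      unfolding Cyl_def Ext_def s(1) by simp
  qed
  then obtain s where s: "\<And>n. Cyl n (s n)" "\<And>n. Ext n (s n) (s (Suc n))" by blast
  define Z where "Z n = fst (s n)" for n
  define i where "i n = fst (snd (s n))" for n
  define j where "j n = fst (snd (snd (s n)))" for n
  define p where "p n = snd (snd (snd (s n)))" for n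
  have sn: "s n = (Z n, i n, j n, p n)" for n by (simp add: Z_def i_def j_def p_def)
  have i: "\<And>n. i n \<in> hom C (X n) (Z n)" "\<And>n. i n \<in> cof"
    and j: "\<And>n. j n \<in> hom C (Y n) (Z n)" "\<And>n. j n \<in> cof"
    and p: "\<And>n. p n \<in> hom C (Z n) (Y n)" "\<And>n. p n \<in> we"
    and pi: "\<And>n. p n \<cdot> i n = t n" and pj: "\<And>n. p n \<cdot> j n = Idt C (Y n)"
    using s(1) unfolding Cyl_def sn by auto
  have "\<exists>e. e \<in> hom C (Z n) (Z (Suc n)) \<and> e \<in> cof \<and> p (Suc n) \<cdot> e = g n \<cdot> p n \<and>
     relative_acyclic (X n) (X (Suc n)) (f n) (Z n) (Z (Suc n)) e (i n) (i (Suc n)) \<and>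
     relative_acyclic (Y n) (Y (Suc n)) (g n) (Z n) (Z (Suc n)) e (j n) (j (Suc n))" for n
    using s(2)[of n] unfolding Ext_def sn by simp
  then obtain e where e: "\<And>n. e n \<in> hom C (Z n) (Z (Suc n))" "\<And>n. e n \<in> cof" "\<And>n. p (Suc n) \<cdot> e n = g n \<cdot> p n"
    and rx: "\<And>n. relative_acyclic (X n) (X (Suc n)) (f n) (Z n) (Z (Suc n)) (e n) (i n) (i (Suc n))"
    and ry: "\<And>n. relative_acyclic (Y n) (Y (Suc n)) (g n) (Z n) (Z (Suc n)) (e n) (j n) (j (Suc n))"
    by metis
  obtain z \<zeta> where cz: "is_seq_colimit C Z e z \<zeta>" using seq_colimit_exists e by blast
  have zO: "z \<in> Obj C" and yO: "y \<in> Obj C" using cz cy unfolding is_seq_colimit_def by auto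
  note \<iota> = seq_hom[OF cx] and \<zeta> = seq_hom[OF cz] and \<kappa> = seq_hom[OF cy]
  have ie: "i (Suc n) \<cdot> f n = e n \<cdot> i n" and je: "j (Suc n) \<cdot> g n = e n \<cdot> j n" for n
  proof -
    obtain P a b m where A: "po (X n) (X (Suc n)) (Z n) P (f n) (i n) a b" "m \<in> hom C P (Z (Suc n))"
      "m \<cdot> a = i (Suc n)" "m \<cdot> b = e n"
      using rx[of n] unfolding relative_acyclic_def by blast
    show "i (Suc n) \<cdot> f n = e n \<cdot> i n"
      using assoc[OF po_hom(1,3)[OF A(1)] A(2)] assoc[OF po_hom(2,4)[OF A(1)] A(2)] po_comm[OF A(1)] A(3,4) by simp
    obtain P a b m where A: "po (Y n) (Y (Suc n)) (Z n) P (g n) (j n) a b" "m \<in> hom C P (Z (Suc n))"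
      "m \<cdot> a = j (Suc n)" "m \<cdot> b = e n"
      using ry[of n] unfolding relative_acyclic_def by blast
    show "j (Suc n) \<cdot> g n = e n \<cdot> j n"
      using assoc[OF po_hom(1,3)[OF A(1)] A(2)] assoc[OF po_hom(2,4)[OF A(1)] A(2)] po_comm[OF A(1)] A(3,4) by simp
  qed
  have c1: "(\<zeta> (Suc n) \<cdot> i (Suc n)) \<cdot> f n = \<zeta> n \<cdot> i n" for n
    using assoc[OF f(1) i(1) \<zeta>(1)] ie assoc[OF i(1) e(1) \<zeta>(1)] \<zeta>(2) by simp
  obtain u where u: "u \<in> hom C x z" "\<And>n. u \<cdot> \<iota> n = \<zeta> n \<cdot> i n"
    by (rule seq_ex[OF cx zO comp_hom[OF i(1) \<zeta>(1)] c1]) blast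
  have c2: "(\<zeta> (Suc n) \<cdot> j (Suc n)) \<cdot> g n = \<zeta> n \<cdot> j n" for n
    using assoc[OF g(1) j(1) \<zeta>(1)] je assoc[OF j(1) e(1) \<zeta>(1)] \<zeta>(2) by simp
  obtain v where v: "v \<in> hom C y z" "\<And>n. v \<cdot> \<kappa> n = \<zeta> n \<cdot> j n"
    by (rule seq_ex[OF cy zO comp_hom[OF j(1) \<zeta>(1)] c2]) blast
  have c3: "(\<kappa> (Suc n) \<cdot> p (Suc n)) \<cdot> e n = \<kappa> n \<cdot> p n" for n
    using assoc[OF e(1) p(1) \<kappa>(1)] e(3) assoc[OF p(1) g(1) \<kappa>(1)] \<kappa>(2) by simp
  obtain q where q: "q \<in> hom C z y" "\<And>n. q \<cdot> \<zeta> n = \<kappa> n \<cdot> p n"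
    by (rule seq_ex[OF cz yO comp_hom[OF p(1) \<kappa>(1)] c3]) blast
  have "i 0 \<in> we" using we_cancel_left[OF i(1) p] pi t by simp
  then have uw: "u \<in> we" using seq_colimit_acyclic[OF i _ f(1) e(1) rx cx cz u] by blast
  have "j 0 \<in> we" using retraction_we[OF j(1) p(1) pj p(2)] .
  then have vw: "v \<in> we" using seq_colimit_acyclic[OF j _ g(1) e(1) ry cy cz v] by blast
  have "q \<cdot> v = Idt C y"
  proof (rule seq_eq[OF cy g(1)])
    show "q \<cdot> v \<in> hom C y y" "Idt C y \<in> hom C y y" using q v yO by auto
    fix n show "q \<cdot> v \<cdot> \<kappa> n = Idt C y \<cdot> \<kappa> n"
      using assoc[OF \<kappa>(1) v(1) q(1)] v(2) assoc[OF j(1) \<zeta>(1) q(1)] q(2) assoc[OF j(1) p(1) \<kappa>(1)] pj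
        id_left[OF \<kappa>(1)] id_right[OF \<kappa>(1)] by simp
  qed
  then have "q \<in> we" using section_we[OF v(1) q(1) _ vw] by simp
  moreover have "h = q \<cdot> u"
  proof (rule seq_eq[OF cx f(1)])
    show "h \<in> hom C x y" "q \<cdot> u \<in> hom C x y" using h q u by auto
    fix n show "h \<cdot> \<iota> n = q \<cdot> u \<cdot> \<iota> n"
      using assoc[OF \<iota>(1) u(1) q(1)] u(2) assoc[OF i(1) \<zeta>(1) q(1)] q(2) assoc[OF i(1) p(1) \<kappa>(1)] pi h(2) by simp
  qed
  ultimately show ?thesis using we_comp[OF u(1) q(1) uw] by simp
qed

end

section \<open>Presheaves of small sets: monomorphisms and colimits in terms of elements\<close>

section \<open>Presheaf categories\<close>

locale universe =
  fixes U :: "'v set set"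
  assumes universe: "set_universe U"
begin

lemma U_subset: "S \<in> U \<Longrightarrow> T \<subseteq> S \<Longrightarrow> T \<in> U"
  and U_image: "S \<in> U \<Longrightarrow> f ` S \<in> U"
  using universe unfolding set_universe_def by auto

lemma U_UN: "I \<in> U \<Longrightarrow> (\<And>i. i \<in> I \<Longrightarrow> S i \<in> U) \<Longrightarrow> (\<Union>i\<in>I. S i) \<in> U"
  using universe unfolding set_universe_def by auto

lemma U_infinite: obtains S where "S \<in> U" "infinite S"
  using universe unfolding set_universe_def by auto

lemma inj_vpair_U: "inj (vpair :: 'v \<times> 'v \<Rightarrow> 'v)"
  using U_infinite inj_vpair infinite_super[OF subset_UNIV] by metis

lemma vpair_eq [simp]: "vpair p = vpair q \<longleftrightarrow> p = (q :: 'v \<times> 'v)"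
  using inj_vpair_U by (auto dest: injD)

lemma inv_vpair [simp]: "inv vpair (vpair (p :: 'v \<times> 'v)) = p"
  using inj_vpair_U by simp

lemma U_times: "S \<in> U \<Longrightarrow> T \<in> U \<Longrightarrow> vpair ` (S \<times> T) \<in> U"
proof -
  assume "S \<in> U" "T \<in> U"
  moreover have "vpair ` (S \<times> T) = (\<Union>s\<in>S. (\<lambda>t. vpair (s, t)) ` T)" by auto
  ultimately show ?thesis using U_UN U_image by simp
qed

text \<open>Replacement along an injection of the naturals into an infinite member of
  \<open>U\<close>. This makes the index sets of sequences and spans small.\<close>

lemma U_countable: "range (e :: nat \<Rightarrow> 'v) \<in> U"
proof -
  obtain S where S: "S \<in> U" "infinite S" by (rule U_infinite)
  then obtain k :: "nat \<Rightarrow> 'v" where k: "inj k" "range k \<subseteq> S" using infinite_countable_subset by blast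
  have "range k \<in> U" using U_subset[OF S(1) k(2)] .
  then have "(\<lambda>v. e (inv k v)) ` range k \<in> U" by (rule U_image)
  moreover have "(\<lambda>v. e (inv k v)) ` range k = range e" using k(1) by (simp add: image_image)
  ultimately show ?thesis by simp
qed

end

text \<open>The restrictions supply the extensionality that \<open>presheaf\<close> demands, so
  later constructions specify values only where they matter.\<close>

definition mk_presheaf :: "('o, 'm) cat \<Rightarrow> ('o \<Rightarrow> 'v set) \<Rightarrow> ('m \<Rightarrow> 'v \<Rightarrow> 'v) \<Rightarrow> ('o, 'm, 'v) presh" where
  "mk_presheaf C ev act = \<lparr>Ev = (\<lambda>a\<in>Obj C. ev a), Act = (\<lambda>f\<in>Arr C. \<lambda>x\<in>ev (Cod C f). act f x)\<rparr>"

definition mk_trans :: "('o, 'm) cat \<Rightarrow> ('o, 'm, 'v) presh \<Rightarrow> ('o, 'm, 'v) presh \<Rightarrow> ('o \<Rightarrow> 'v \<Rightarrow> 'v) \<Rightarrow> ('o, 'm, 'v) nat_trans"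
  where "mk_trans C X Y c = \<lparr>Src = X, Tgt = Y, Cpt = (\<lambda>a\<in>Obj C. \<lambda>x\<in>Ev X a. c a x)\<rparr>"

lemma mk_presheaf_simps [simp]:
  "a \<in> Obj C \<Longrightarrow> Ev (mk_presheaf C ev act) a = ev a"
  "f \<in> Arr C \<Longrightarrow> x \<in> ev (Cod C f) \<Longrightarrow> Act (mk_presheaf C ev act) f x = act f x"
  by (simp_all add: mk_presheaf_def)

lemma mk_trans_simps [simp]:
  "Src (mk_trans C X Y c) = X" "Tgt (mk_trans C X Y c) = Y"
  "a \<in> Obj C \<Longrightarrow> x \<in> Ev X a \<Longrightarrow> Cpt (mk_trans C X Y c) a x = c a x"
  by (simp_all add: mk_trans_def)

locale presheaf_category = universe U + base: category_locale C
  for U :: "'v set set" and C :: "('o, 'm) cat"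
begin

abbreviation "B \<equiv> psh U C"

lemma base_arr: "f \<in> Arr C \<Longrightarrow> Dom C f \<in> Obj C" "f \<in> Arr C \<Longrightarrow> Cod C f \<in> Obj C"
  using base.category unfolding category_def by auto

lemma base_id: "a \<in> Obj C \<Longrightarrow> Idt C a \<in> Arr C" "a \<in> Obj C \<Longrightarrow> Dom C (Idt C a) = a"
    "a \<in> Obj C \<Longrightarrow> Cod C (Idt C a) = a"
  using base.category unfolding category_def hom_def by auto

lemma base_cmp: "f \<in> Arr C \<Longrightarrow> g \<in> Arr C \<Longrightarrow> Cod C f = Dom C g \<Longrightarrow> g \<cdot>\<^bsub>C\<^esub> f \<in> Arr C"
    "f \<in> Arr C \<Longrightarrow> g \<in> Arr C \<Longrightarrow> Cod C f = Dom C g \<Longrightarrow> Dom C (g \<cdot>\<^bsub>C\<^esub> f) = Dom C f"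
    "f \<in> Arr C \<Longrightarrow> g \<in> Arr C \<Longrightarrow> Cod C f = Dom C g \<Longrightarrow> Cod C (g \<cdot>\<^bsub>C\<^esub> f) = Cod C g"
  using base.category unfolding category_def hom_def by auto

lemma Ev_U: "presheaf U C X \<Longrightarrow> a \<in> Obj C \<Longrightarrow> Ev X a \<in> U"
  unfolding presheaf_def by blast

lemma Act_in: "presheaf U C X \<Longrightarrow> f \<in> Arr C \<Longrightarrow> x \<in> Ev X (Cod C f) \<Longrightarrow> Act X f x \<in> Ev X (Dom C f)"
  unfolding presheaf_def PiE_def Pi_def by blast

lemma Act_id: "presheaf U C X \<Longrightarrow> a \<in> Obj C \<Longrightarrow> x \<in> Ev X a \<Longrightarrow> Act X (Idt C a) x = x"
  unfolding presheaf_def by blast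

lemma Act_cmp: "presheaf U C X \<Longrightarrow> f \<in> Arr C \<Longrightarrow> g \<in> Arr C \<Longrightarrow> Cod C f = Dom C g \<Longrightarrow> x \<in> Ev X (Cod C g) \<Longrightarrow>
    Act X (g \<cdot>\<^bsub>C\<^esub> f) x = Act X f (Act X g x)"
  unfolding presheaf_def by blast

lemma presheaf_mk_presheaf:
  assumes "\<And>a. a \<in> Obj C \<Longrightarrow> ev a \<in> U"
    and "\<And>f x. f \<in> Arr C \<Longrightarrow> x \<in> ev (Cod C f) \<Longrightarrow> act f x \<in> ev (Dom C f)"
    and "\<And>a x. a \<in> Obj C \<Longrightarrow> x \<in> ev a \<Longrightarrow> act (Idt C a) x = x"
    and "\<And>f g x. f \<in> Arr C \<Longrightarrow> g \<in> Arr C \<Longrightarrow> Cod C f = Dom C g \<Longrightarrow> x \<in> ev (Cod C g) \<Longrightarrow>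
      act (g \<cdot>\<^bsub>C\<^esub> f) x = act f (act g x)"
  shows "presheaf U C (mk_presheaf C ev act)"
  unfolding presheaf_def
proof (intro conjI ballI impI)
  show "Ev (mk_presheaf C ev act) \<in> Obj C \<rightarrow>\<^sub>E U" using assms(1) by (auto simp: mk_presheaf_def)
  show "Act (mk_presheaf C ev act) \<in> (\<Pi>\<^sub>E f\<in>Arr C. Ev (mk_presheaf C ev act) (Cod C f) \<rightarrow>\<^sub>E Ev (mk_presheaf C ev act) (Dom C f))"
    using assms(2) base_arr by (auto simp: mk_presheaf_def)
  show "Act (mk_presheaf C ev act) (Idt C a) x = x" if "a \<in> Obj C" "x \<in> Ev (mk_presheaf C ev act) a" for a x
    using that assms(3) base_id by simp
  show "Act (mk_presheaf C ev act) (g \<cdot>\<^bsub>C\<^esub> f) x = Act (mk_presheaf C ev act) f (Act (mk_presheaf C ev act) g x)"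
    if "f \<in> Arr C" "g \<in> Arr C" "Cod C f = Dom C g" "x \<in> Ev (mk_presheaf C ev act) (Cod C g)" for f g x
    using that assms(2)[of g x] assms(4)[of f g x] base_cmp[of f g] base_arr by simp
qed

lemma homB_iff: "t \<in> hom B X Y \<longleftrightarrow> presheaf U C X \<and> presheaf U C Y \<and> natural_trans C t \<and> Src t = X \<and> Tgt t = Y"
  unfolding hom_def psh_def by auto

lemma homB_presheaf: "t \<in> hom B X Y \<Longrightarrow> presheaf U C X" "t \<in> hom B X Y \<Longrightarrow> presheaf U C Y"
  by (auto simp: homB_iff)

lemma Cpt_in: "t \<in> hom B X Y \<Longrightarrow> a \<in> Obj C \<Longrightarrow> x \<in> Ev X a \<Longrightarrow> Cpt t a x \<in> Ev Y a"
  unfolding homB_iff natural_trans_def PiE_def Pi_def by auto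

lemma Cpt_nat: "t \<in> hom B X Y \<Longrightarrow> f \<in> Arr C \<Longrightarrow> x \<in> Ev X (Cod C f) \<Longrightarrow>
    Cpt t (Dom C f) (Act X f x) = Act Y f (Cpt t (Cod C f) x)"
  unfolding homB_iff natural_trans_def by auto

lemma homB_eqI:
  assumes s: "s \<in> hom B X Y" and t: "t \<in> hom B X Y"
    and eq: "\<And>a x. a \<in> Obj C \<Longrightarrow> x \<in> Ev X a \<Longrightarrow> Cpt s a x = Cpt t a x"
  shows "s = t"
proof -
  have s1: "Cpt s \<in> extensional (Obj C)" "\<And>a. a \<in> Obj C \<Longrightarrow> Cpt s a \<in> extensional (Ev X a)" "Src s = X" "Tgt s = Y"
    using s unfolding homB_iff natural_trans_def PiE_def by auto
  have t1: "Cpt t \<in> extensional (Obj C)" "\<And>a. a \<in> Obj C \<Longrightarrow> Cpt t a \<in> extensional (Ev X a)" "Src t = X" "Tgt t = Y"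
    using t unfolding homB_iff natural_trans_def PiE_def by auto
  have "Cpt s a = Cpt t a" if "a \<in> Obj C" for a
    by (rule extensionalityI[OF s1(2)[OF that] t1(2)[OF that]]) (use eq that in auto)
  then have "Cpt s = Cpt t" using extensionalityI[OF s1(1) t1(1)] by blast
  then show ?thesis using s1 t1 by simp
qed

lemma mk_trans_hom:
  assumes "presheaf U C X" "presheaf U C Y"
    and "\<And>a x. a \<in> Obj C \<Longrightarrow> x \<in> Ev X a \<Longrightarrow> c a x \<in> Ev Y a"
    and "\<And>f x. f \<in> Arr C \<Longrightarrow> x \<in> Ev X (Cod C f) \<Longrightarrow> c (Dom C f) (Act X f x) = Act Y f (c (Cod C f) x)"
  shows "mk_trans C X Y c \<in> hom B X Y"
  unfolding homB_iff natural_trans_def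
proof (intro conjI ballI)
  show "Cpt (mk_trans C X Y c) \<in> (\<Pi>\<^sub>E a\<in>Obj C. Ev (Src (mk_trans C X Y c)) a \<rightarrow>\<^sub>E Ev (Tgt (mk_trans C X Y c)) a)"
    using assms(3) by (auto simp: mk_trans_def)
  show "Cpt (mk_trans C X Y c) (Dom C f) (Act (Src (mk_trans C X Y c)) f x) = Act (Tgt (mk_trans C X Y c)) f (Cpt (mk_trans C X Y c) (Cod C f) x)"
    if "f \<in> Arr C" "x \<in> Ev (Src (mk_trans C X Y c)) (Cod C f)" for f x
    using that assms(4)[of f x] Act_in[OF assms(1), of f x] base_arr by simp
qed (use assms in simp_all)

lemma Cmp_B: "s \<cdot>\<^bsub>B\<^esub> t = \<lparr>Src = Src t, Tgt = Tgt s, Cpt = (\<lambda>a\<in>Obj C. \<lambda>x\<in>Ev (Src t) a. Cpt s a (Cpt t a x))\<rparr>"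
  by (simp add: psh_def)

lemma Cpt_cmp:
  "t \<in> hom B X Y \<Longrightarrow> a \<in> Obj C \<Longrightarrow> x \<in> Ev X a \<Longrightarrow> Cpt (s \<cdot>\<^bsub>B\<^esub> t) a x = Cpt s a (Cpt t a x)"
  by (simp add: Cmp_B homB_iff)

lemma Idt_B: "Idt B X = mk_trans C X X (\<lambda>_ x. x)"
  by (simp add: psh_def mk_trans_def)

lemma Obj_B: "X \<in> Obj B \<longleftrightarrow> presheaf U C X" by (simp add: psh_def)

lemma Arr_B: "t \<in> Arr B \<longleftrightarrow> t \<in> hom B (Src t) (Tgt t)"
  unfolding homB_iff by (simp add: psh_def)

lemma DomB [simp]: "Dom B = Src" and CodB [simp]: "Cod B = Tgt" by (simp_all add: psh_def)

lemma B_comp_hom: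
  assumes t: "t \<in> hom B X Y" and s: "s \<in> hom B Y Z"
  shows "s \<cdot>\<^bsub>B\<^esub> t \<in> hom B X Z"
proof -
  have "s \<cdot>\<^bsub>B\<^esub> t = mk_trans C X Z (\<lambda>a x. Cpt s a (Cpt t a x))"
    using s t unfolding Cmp_B mk_trans_def by (simp add: homB_iff)
  also have "\<dots> \<in> hom B X Z"
    by (rule mk_trans_hom) (use s t Cpt_in Cpt_nat homB_presheaf base_arr in \<open>auto\<close>)
  finally show ?thesis .
qed

lemma B_id_hom: "presheaf U C X \<Longrightarrow> Idt B X \<in> hom B X X"
  unfolding Idt_B by (rule mk_trans_hom) auto

lemma category_B: "category B"
  unfolding category_def
proof (intro conjI ballI impI)
  show "Dom B f \<in> Obj B" "Cod B f \<in> Obj B" if "f \<in> Arr B" for f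
    using that unfolding Arr_B homB_iff Obj_B by auto
  show "Idt B X \<in> hom B X X" if "X \<in> Obj B" for X using that B_id_hom Obj_B by blast
  show "g \<cdot>\<^bsub>B\<^esub> f \<in> hom B (Dom B f) (Cod B g)" if "f \<in> Arr B" "g \<in> Arr B" "Cod B f = Dom B g" for f g
    using that B_comp_hom unfolding Arr_B by simp
  fix f assume f: "f \<in> Arr B"
  then have fh: "f \<in> hom B (Src f) (Tgt f)" by (simp add: Arr_B)
  note ps = homB_presheaf[OF fh]
  show "Idt B (Cod B f) \<cdot>\<^bsub>B\<^esub> f = f"
  proof (rule homB_eqI[OF _ fh])
    show 1: "Idt B (Cod B f) \<cdot>\<^bsub>B\<^esub> f \<in> hom B (Src f) (Tgt f)"
      using B_comp_hom[OF fh B_id_hom[OF ps(2)]] by simp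
    fix a x assume "a \<in> Obj C" "x \<in> Ev (Src f) a"
    then show "Cpt (Idt B (Cod B f) \<cdot>\<^bsub>B\<^esub> f) a x = Cpt f a x"
      using Cpt_cmp[OF fh] Cpt_in[OF fh] by (simp add: Idt_B)
  qed
  show "f \<cdot>\<^bsub>B\<^esub> Idt B (Dom B f) = f"
  proof (rule homB_eqI[OF _ fh])
    show 1: "f \<cdot>\<^bsub>B\<^esub> Idt B (Dom B f) \<in> hom B (Src f) (Tgt f)"
      using B_comp_hom[OF B_id_hom[OF ps(1)] fh] by simp
    fix a x assume "a \<in> Obj C" "x \<in> Ev (Src f) a"
    then show "Cpt (f \<cdot>\<^bsub>B\<^esub> Idt B (Dom B f)) a x = Cpt f a x"
      using Cpt_cmp[OF B_id_hom[OF ps(1)]] by (simp add: Idt_B)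
  qed
next
  fix f g h assume "f \<in> Arr B" "g \<in> Arr B" "h \<in> Arr B" and c: "Cod B f = Dom B g" "Cod B g = Dom B h"
  then have f: "f \<in> hom B (Src f) (Src g)" and g: "g \<in> hom B (Src g) (Src h)" and h: "h \<in> hom B (Src h) (Tgt h)"
    by (simp_all add: Arr_B)
  show "(h \<cdot>\<^bsub>B\<^esub> g) \<cdot>\<^bsub>B\<^esub> f = h \<cdot>\<^bsub>B\<^esub> (g \<cdot>\<^bsub>B\<^esub> f)"
  proof (rule homB_eqI)
    show "(h \<cdot>\<^bsub>B\<^esub> g) \<cdot>\<^bsub>B\<^esub> f \<in> hom B (Src f) (Tgt h)" "h \<cdot>\<^bsub>B\<^esub> (g \<cdot>\<^bsub>B\<^esub> f) \<in> hom B (Src f) (Tgt h)"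
      using f g h B_comp_hom by blast+
    fix a x assume ax: "a \<in> Obj C" "x \<in> Ev (Src f) a"
    show "Cpt ((h \<cdot>\<^bsub>B\<^esub> g) \<cdot>\<^bsub>B\<^esub> f) a x = Cpt (h \<cdot>\<^bsub>B\<^esub> (g \<cdot>\<^bsub>B\<^esub> f)) a x"
      using ax Cpt_in[OF f ax] by (simp add: Cpt_cmp[OF f] Cpt_cmp[OF g] Cpt_cmp[OF B_comp_hom[OF f g]])
  qed
qed

sublocale psh: category_locale B
  by unfold_locales (rule category_B)

lemma injective_mono:
  assumes t: "t \<in> hom B X Y" and inj: "\<And>a. a \<in> Obj C \<Longrightarrow> inj_on (Cpt t a) (Ev X a)"
  shows "t \<in> mono_arrows B"
  unfolding mono_arrows_def
proof (intro CollectI conjI ballI impI)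
  show "t \<in> Arr B" using t by (simp add: hom_def)
  fix g h assume "g \<in> Arr B" "h \<in> Arr B" "Dom B g = Dom B h" "Cod B g = Dom B t" "Cod B h = Dom B t"
    and eq: "t \<cdot>\<^bsub>B\<^esub> g = t \<cdot>\<^bsub>B\<^esub> h"
  then have g: "g \<in> hom B (Src g) X" and h: "h \<in> hom B (Src g) X" using t by (auto simp: Arr_B homB_iff)
  show "g = h"
  proof (rule homB_eqI[OF g h])
    fix a x assume ax: "a \<in> Obj C" "x \<in> Ev (Src g) a"
    have "Cpt t a (Cpt g a x) = Cpt t a (Cpt h a x)"
      using eq Cpt_cmp[OF g ax] Cpt_cmp[OF h ax] by metis
    then show "Cpt g a x = Cpt h a x" using inj[OF ax(1)] Cpt_in[OF g ax] Cpt_in[OF h ax] by (auto dest: inj_onD)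
  qed
qed

text \<open>A monomorphism equalizes the two projections of its kernel pair.\<close>

lemma mono_injective:
  assumes m: "t \<in> mono_arrows B" and t: "t \<in> hom B X Y" and a: "a \<in> Obj C"
  shows "inj_on (Cpt t a) (Ev X a)"
proof (rule inj_onI)
  fix x y assume xy: "x \<in> Ev X a" "y \<in> Ev X a" "Cpt t a x = Cpt t a y"
  note X = homB_presheaf(1)[OF t]
  define ev where "ev a = vpair ` {(x, y). x \<in> Ev X a \<and> y \<in> Ev X a \<and> Cpt t a x = Cpt t a y}" for a
  define act where "act f z = vpair (map_prod (Act X f) (Act X f) (inv vpair z))" for f z
  define K where "K = mk_presheaf C ev act"
  have K: "presheaf U C K" unfolding K_def
  proof (rule presheaf_mk_presheaf)
    show "ev a \<in> U" if "a \<in> Obj C" for a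
      by (rule U_subset[OF U_times[OF Ev_U[OF X that] Ev_U[OF X that]]]) (auto simp: ev_def)
    show "act f z \<in> ev (Dom C f)" if "f \<in> Arr C" "z \<in> ev (Cod C f)" for f z
      using that Act_in[OF X] Cpt_nat[OF t] unfolding ev_def act_def by auto
    show "act (Idt C a) z = z" if "a \<in> Obj C" "z \<in> ev a" for a z
      using that Act_id[OF X] unfolding ev_def act_def by auto
    show "act (g \<cdot>\<^bsub>C\<^esub> f) z = act f (act g z)"
      if "f \<in> Arr C" "g \<in> Arr C" "Cod C f = Dom C g" "z \<in> ev (Cod C g)" for f g z
      using that Act_cmp[OF X] unfolding ev_def act_def by auto
  qed
  define p where "p = mk_trans C K X (\<lambda>a z. fst (inv vpair z))"
  define q where "q = mk_trans C K X (\<lambda>a z. snd (inv vpair z))"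
  have p: "p \<in> hom B K X" unfolding p_def
    by (rule mk_trans_hom[OF K X]) (use base_arr in \<open>auto simp: K_def ev_def act_def\<close>)
  have q: "q \<in> hom B K X" unfolding q_def
    by (rule mk_trans_hom[OF K X]) (use base_arr in \<open>auto simp: K_def ev_def act_def\<close>)
  have "t \<cdot>\<^bsub>B\<^esub> p = t \<cdot>\<^bsub>B\<^esub> q"
  proof (rule homB_eqI[OF B_comp_hom[OF p t] B_comp_hom[OF q t]])
    fix a z assume "a \<in> Obj C" "z \<in> Ev K a"
    then show "Cpt (t \<cdot>\<^bsub>B\<^esub> p) a z = Cpt (t \<cdot>\<^bsub>B\<^esub> q) a z"
      by (simp add: Cpt_cmp[OF p] Cpt_cmp[OF q]) (auto simp: p_def q_def K_def ev_def)
  qed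
  then have "p = q"
    using m p q t unfolding mono_arrows_def hom_def by auto
  moreover have z: "vpair (x, y) \<in> Ev K a" using a xy by (auto simp: K_def ev_def)
  moreover have "Cpt p a (vpair (x, y)) = x" "Cpt q a (vpair (x, y)) = y"
    unfolding p_def q_def using a z by simp_all
  ultimately show "x = y" by simp
qed

text \<open>The shape of a pushout along an inclusion: over each object, \<open>G\<close> is the
  disjoint union of \<open>F\<close> and the part of \<open>Q\<close> outside \<open>P\<close>. This
  form can be checked by normal forms, and it passes to slices at an object of \<open>R\<close> by
  mere substitution.\<close>

definition ptwise_po where
  "ptwise_po P Q F G i g g' i' \<longleftrightarrow> i \<in> hom B P Q \<and> g \<in> hom B P F \<and> g' \<in> hom B Q G \<and> i' \<in> hom B F G \<and>
    (\<forall>a\<in>Obj C. (\<forall>x\<in>Ev P a. Cpt g' a (Cpt i a x) = Cpt i' a (Cpt g a x)) \<and>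
      inj_on (Cpt i' a) (Ev F a) \<and>
      inj_on (Cpt g' a) (Ev Q a - Cpt i a ` Ev P a) \<and>
      Ev G a \<subseteq> Cpt i' a ` Ev F a \<union> Cpt g' a ` (Ev Q a - Cpt i a ` Ev P a) \<and>
      Cpt i' a ` Ev F a \<inter> Cpt g' a ` (Ev Q a - Cpt i a ` Ev P a) = {})"

lemma ptwise_po_po:
  assumes pp: "ptwise_po P Q F G i g g' i'"
  shows "psh.po P Q F G i g g' i'"
proof -
  have i: "i \<in> hom B P Q" and g: "g \<in> hom B P F" and g': "g' \<in> hom B Q G" and i': "i' \<in> hom B F G"
    using pp unfolding ptwise_po_def by auto
  have comm: "\<And>a x. a \<in> Obj C \<Longrightarrow> x \<in> Ev P a \<Longrightarrow> Cpt g' a (Cpt i a x) = Cpt i' a (Cpt g a x)"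
    and ii: "\<And>a. a \<in> Obj C \<Longrightarrow> inj_on (Cpt i' a) (Ev F a)"
    and ig: "\<And>a. a \<in> Obj C \<Longrightarrow> inj_on (Cpt g' a) (Ev Q a - Cpt i a ` Ev P a)"
    and cov: "\<And>a. a \<in> Obj C \<Longrightarrow> Ev G a \<subseteq> Cpt i' a ` Ev F a \<union> Cpt g' a ` (Ev Q a - Cpt i a ` Ev P a)"
    and dis: "\<And>a. a \<in> Obj C \<Longrightarrow> Cpt i' a ` Ev F a \<inter> Cpt g' a ` (Ev Q a - Cpt i a ` Ev P a) = {}"
    using pp unfolding ptwise_po_def by blast+
  show ?thesis
  proof (rule psh.poI[OF i g g' i'])
    show "g' \<cdot>\<^bsub>B\<^esub> i = i' \<cdot>\<^bsub>B\<^esub> g"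
      by (rule homB_eqI[OF B_comp_hom[OF i g'] B_comp_hom[OF g i']]) (simp add: Cpt_cmp[OF i] Cpt_cmp[OF g] comm)
  next
    fix y s t assume s: "s \<in> hom B Q y" and t: "t \<in> hom B F y" and st: "s \<cdot>\<^bsub>B\<^esub> i = t \<cdot>\<^bsub>B\<^esub> g"
    have st': "Cpt s a (Cpt i a x) = Cpt t a (Cpt g a x)" if "a \<in> Obj C" "x \<in> Ev P a" for a x
      using st Cpt_cmp[OF i that] Cpt_cmp[OF g that] by metis
    define c where "c a z = (if z \<in> Cpt i' a ` Ev F a then Cpt t a (inv_into (Ev F a) (Cpt i' a) z)
       else Cpt s a (inv_into (Ev Q a - Cpt i a ` Ev P a) (Cpt g' a) z))" for a z
    have ci: "c a (Cpt i' a x) = Cpt t a x" if "a \<in> Obj C" "x \<in> Ev F a" for a x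
      using that ii[OF that(1)] unfolding c_def by simp
    have cg: "c a (Cpt g' a x) = Cpt s a x" if a: "a \<in> Obj C" and x: "x \<in> Ev Q a" for a x
    proof (cases "x \<in> Cpt i a ` Ev P a")
      case True
      then obtain p where p: "p \<in> Ev P a" "x = Cpt i a p" by blast
      then show ?thesis using comm[OF a p(1)] ci[OF a Cpt_in[OF g a p(1)]] st'[OF a p(1)] by simp
    next
      case False
      then have "Cpt g' a x \<notin> Cpt i' a ` Ev F a" using dis[OF a] x by blast
      then show ?thesis using False x ig[OF a] unfolding c_def by simp
    qed
    note G = homB_presheaf(2)[OF g']
    have cov': "\<exists>x. (x \<in> Ev F a \<and> z = Cpt i' a x) \<or> (x \<in> Ev Q a \<and> z = Cpt g' a x)" if "a \<in> Obj C" "z \<in> Ev G a" for a z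
      using cov[OF that(1)] that(2) by blast
    have h: "mk_trans C G y c \<in> hom B G y"
    proof (rule mk_trans_hom[OF G homB_presheaf(2)[OF s]])
      fix a z assume a: "a \<in> Obj C" and z: "z \<in> Ev G a"
      from cov'[OF a z] show "c a z \<in> Ev y a" using ci cg Cpt_in[OF t] Cpt_in[OF s] a by auto
    next
      fix f z assume f: "f \<in> Arr C" and z: "z \<in> Ev G (Cod C f)"
      note o = base_arr[OF f]
      from cov'[OF o(2) z] obtain x where
        "(x \<in> Ev F (Cod C f) \<and> z = Cpt i' (Cod C f) x) \<or> (x \<in> Ev Q (Cod C f) \<and> z = Cpt g' (Cod C f) x)" by blast
      then show "c (Dom C f) (Act G f z) = Act y f (c (Cod C f) z)"
      proof
        assume x: "x \<in> Ev F (Cod C f) \<and> z = Cpt i' (Cod C f) x"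
        then have "Act G f z = Cpt i' (Dom C f) (Act F f x)" using Cpt_nat[OF i' f] by simp
        then show ?thesis
          using x ci[OF o(1) Act_in[OF homB_presheaf(1)[OF i'] f, of x]] ci[OF o(2), of x] Cpt_nat[OF t f, of x] by simp
      next
        assume x: "x \<in> Ev Q (Cod C f) \<and> z = Cpt g' (Cod C f) x"
        then have "Act G f z = Cpt g' (Dom C f) (Act Q f x)" using Cpt_nat[OF g' f] by simp
        then show ?thesis
          using x cg[OF o(1) Act_in[OF homB_presheaf(1)[OF g'] f, of x]] cg[OF o(2), of x] Cpt_nat[OF s f, of x] by simp
      qed
    qed
    have "mk_trans C G y c \<cdot>\<^bsub>B\<^esub> g' = s"
      by (rule homB_eqI[OF B_comp_hom[OF g' h] s]) (simp add: Cpt_cmp[OF g'] Cpt_in[OF g'] cg)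
    moreover have "mk_trans C G y c \<cdot>\<^bsub>B\<^esub> i' = t"
      by (rule homB_eqI[OF B_comp_hom[OF i' h] t]) (simp add: Cpt_cmp[OF i'] Cpt_in[OF i'] ci)
    ultimately show "\<exists>h\<in>hom B G y. h \<cdot>\<^bsub>B\<^esub> g' = s \<and> h \<cdot>\<^bsub>B\<^esub> i' = t" using h by blast
  next
    fix y h k assume h: "h \<in> hom B G y" and k: "k \<in> hom B G y"
      and eg: "h \<cdot>\<^bsub>B\<^esub> g' = k \<cdot>\<^bsub>B\<^esub> g'" and ei: "h \<cdot>\<^bsub>B\<^esub> i' = k \<cdot>\<^bsub>B\<^esub> i'"
    show "h = k"
    proof (rule homB_eqI[OF h k])
      fix a z assume a: "a \<in> Obj C" and z: "z \<in> Ev G a"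
      have 1: "Cpt h a (Cpt g' a x) = Cpt k a (Cpt g' a x)" if "x \<in> Ev Q a" for x
        using eg Cpt_cmp[OF g' a that] by metis
      have 2: "Cpt h a (Cpt i' a x) = Cpt k a (Cpt i' a x)" if "x \<in> Ev F a" for x
        using ei Cpt_cmp[OF i' a that] by metis
      show "Cpt h a z = Cpt k a z" using cov[OF a] z 1 2 by blast
    qed
  qed
qed

definition ptwise_coproduct where
  "ptwise_coproduct I X Y \<kappa> \<longleftrightarrow> presheaf U C Y \<and> (\<forall>i\<in>I. \<kappa> i \<in> hom B (X i) Y) \<and>
    (\<forall>a\<in>Obj C. (\<forall>i\<in>I. inj_on (Cpt (\<kappa> i) a) (Ev (X i) a)) \<and>
      (\<forall>i\<in>I. \<forall>j\<in>I. i \<noteq> j \<longrightarrow> Cpt (\<kappa> i) a ` Ev (X i) a \<inter> Cpt (\<kappa> j) a ` Ev (X j) a = {}) \<and>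
      Ev Y a \<subseteq> (\<Union>i\<in>I. Cpt (\<kappa> i) a ` Ev (X i) a))"

lemma ptwise_coproduct_coproduct:
  assumes pc: "ptwise_coproduct I X Y \<kappa>"
  shows "is_coproduct B I X Y \<kappa>"
proof -
  have Y: "presheaf U C Y" and k: "\<And>i. i \<in> I \<Longrightarrow> \<kappa> i \<in> hom B (X i) Y"
    and inj: "\<And>a i. a \<in> Obj C \<Longrightarrow> i \<in> I \<Longrightarrow> inj_on (Cpt (\<kappa> i) a) (Ev (X i) a)"
    and dis: "\<And>a i j. a \<in> Obj C \<Longrightarrow> i \<in> I \<Longrightarrow> j \<in> I \<Longrightarrow> i \<noteq> j \<Longrightarrow> Cpt (\<kappa> i) a ` Ev (X i) a \<inter> Cpt (\<kappa> j) a ` Ev (X j) a = {}"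
    and cov: "\<And>a. a \<in> Obj C \<Longrightarrow> Ev Y a \<subseteq> (\<Union>i\<in>I. Cpt (\<kappa> i) a ` Ev (X i) a)"
    using pc unfolding ptwise_coproduct_def by blast+
  show ?thesis unfolding is_coproduct_def
  proof (intro conjI ballI allI impI)
    show "Y \<in> Obj B" using Y Obj_B by simp
    show "\<kappa> i \<in> hom B (X i) Y" if "i \<in> I" for i using k that .
    fix Z \<mu> assume Z: "Z \<in> Obj B" and "\<forall>i\<in>I. \<mu> i \<in> hom B (X i) Z"
    then have m: "\<And>i. i \<in> I \<Longrightarrow> \<mu> i \<in> hom B (X i) Z" by blast
    define ix where "ix a z = (SOME i. i \<in> I \<and> z \<in> Cpt (\<kappa> i) a ` Ev (X i) a)" for a z
    have ix: "ix a (Cpt (\<kappa> i) a x) = i" if "a \<in> Obj C" "i \<in> I" "x \<in> Ev (X i) a" for a i x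
    proof -
      have "ix a (Cpt (\<kappa> i) a x) \<in> I \<and> Cpt (\<kappa> i) a x \<in> Cpt (\<kappa> (ix a (Cpt (\<kappa> i) a x))) a ` Ev (X (ix a (Cpt (\<kappa> i) a x))) a"
        unfolding ix_def by (rule someI[of _ i]) (use that in auto)
      then show ?thesis using dis[OF that(1) _ that(2)] that(3) by blast
    qed
    define c where "c a z = Cpt (\<mu> (ix a z)) a (inv_into (Ev (X (ix a z)) a) (Cpt (\<kappa> (ix a z)) a) z)" for a z
    have c: "c a (Cpt (\<kappa> i) a x) = Cpt (\<mu> i) a x" if "a \<in> Obj C" "i \<in> I" "x \<in> Ev (X i) a" for a i x
      unfolding c_def ix[OF that] using inj[OF that(1,2)] that(3) by simp
    have cov': "\<exists>i x. i \<in> I \<and> x \<in> Ev (X i) a \<and> z = Cpt (\<kappa> i) a x" if "a \<in> Obj C" "z \<in> Ev Y a" for a z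
      using cov[OF that(1)] that(2) by blast
    have h: "mk_trans C Y Z c \<in> hom B Y Z"
    proof (rule mk_trans_hom[OF Y])
      show "presheaf U C Z" using Z Obj_B by simp
      fix a z assume a: "a \<in> Obj C" and z: "z \<in> Ev Y a"
      from cov'[OF a z] show "c a z \<in> Ev Z a" using c[OF a] Cpt_in[OF m a] by auto
    next
      fix f z assume f: "f \<in> Arr C" and z: "z \<in> Ev Y (Cod C f)"
      note o = base_arr[OF f]
      from cov'[OF o(2) z] obtain i x where ix: "i \<in> I" "x \<in> Ev (X i) (Cod C f)" "z = Cpt (\<kappa> i) (Cod C f) x" by blast
      then have "Act Y f z = Cpt (\<kappa> i) (Dom C f) (Act (X i) f x)" using Cpt_nat[OF k f] by simp
      then show "c (Dom C f) (Act Y f z) = Act Z f (c (Cod C f) z)"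
        using ix c[OF o(1) ix(1) Act_in[OF homB_presheaf(1)[OF k[OF ix(1)]] f ix(2)]] c[OF o(2) ix(1,2)]
          Cpt_nat[OF m[OF ix(1)] f ix(2)] by simp
    qed
    have "mk_trans C Y Z c \<cdot>\<^bsub>B\<^esub> \<kappa> i = \<mu> i" if "i \<in> I" for i
      by (rule homB_eqI[OF B_comp_hom[OF k[OF that] h] m[OF that]])
        (simp add: Cpt_cmp[OF k[OF that]] Cpt_in[OF k[OF that]] c that)
    moreover have "h' = mk_trans C Y Z c" if h': "h' \<in> hom B Y Z" "\<forall>i\<in>I. h' \<cdot>\<^bsub>B\<^esub> \<kappa> i = \<mu> i" for h'
    proof (rule homB_eqI[OF h'(1) h])
      fix a z assume az: "a \<in> Obj C" "z \<in> Ev Y a"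
      from cov'[OF az] obtain i x where ix: "i \<in> I" "x \<in> Ev (X i) a" "z = Cpt (\<kappa> i) a x" by blast
      have "Cpt h' a z = Cpt (\<mu> i) a x" using h'(2) ix Cpt_cmp[OF k[OF ix(1)] az(1) ix(2)] by metis
      then show "Cpt h' a z = Cpt (mk_trans C Y Z c) a z" using az ix c by simp
    qed
    ultimately show "\<exists>!h. h \<in> hom B Y Z \<and> (\<forall>i\<in>I. h \<cdot>\<^bsub>B\<^esub> \<kappa> i = \<mu> i)" using h by (intro ex1I[of _ "mk_trans C Y Z c"]) blast+
  qed
qed

lemma ptwise_seq_colimit:
  assumes f: "\<And>n. f n \<in> hom B (X n) (X (Suc n))" and k: "\<And>n. \<kappa> n \<in> hom B (X n) Y"
    and comp: "\<And>n a x. a \<in> Obj C \<Longrightarrow> x \<in> Ev (X n) a \<Longrightarrow> Cpt (\<kappa> (Suc n)) a (Cpt (f n) a x) = Cpt (\<kappa> n) a x"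
    and inj: "\<And>n a. a \<in> Obj C \<Longrightarrow> inj_on (Cpt (\<kappa> n) a) (Ev (X n) a)"
    and cov: "\<And>a. a \<in> Obj C \<Longrightarrow> Ev Y a \<subseteq> (\<Union>n. Cpt (\<kappa> n) a ` Ev (X n) a)"
  shows "is_seq_colimit B X f Y \<kappa>"
proof (rule psh.seqI)
  note Y = homB_presheaf(2)[OF k]
  show "Y \<in> Obj B" using Y Obj_B by simp
  show "\<kappa> n \<in> hom B (X n) Y" for n using k .
  show "\<kappa> (Suc n) \<cdot>\<^bsub>B\<^esub> f n = \<kappa> n" for n
    by (rule homB_eqI[OF B_comp_hom[OF f k] k]) (simp add: Cpt_cmp[OF f] comp)
  fix Z \<mu> assume Z: "Z \<in> Obj B" and m: "\<And>n. \<mu> n \<in> hom B (X n) Z" and mf: "\<And>n. \<mu> (Suc n) \<cdot>\<^bsub>B\<^esub> f n = \<mu> n"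
  have mf': "Cpt (\<mu> (Suc n)) a (Cpt (f n) a x) = Cpt (\<mu> n) a x" if "a \<in> Obj C" "x \<in> Ev (X n) a" for n a x
    using mf[of n] Cpt_cmp[OF f that] by metis
  have step: "\<exists>y\<in>Ev (X (n + j)) a. Cpt (\<kappa> (n + j)) a y = Cpt (\<kappa> n) a x \<and> Cpt (\<mu> (n + j)) a y = Cpt (\<mu> n) a x"
    if a: "a \<in> Obj C" and x: "x \<in> Ev (X n) a" for n j a x
  proof (induction j)
    case (Suc j)
    then obtain y where "y \<in> Ev (X (n + j)) a" "Cpt (\<kappa> (n + j)) a y = Cpt (\<kappa> n) a x" "Cpt (\<mu> (n + j)) a y = Cpt (\<mu> n) a x" by blast
    then show ?case using comp[OF a, of y] mf'[OF a, of y] Cpt_in[OF f a, of y] by (intro bexI[of _ "Cpt (f (n + j)) a y"]) auto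
  qed (use x in auto)
  \<comment> \<open>Representatives at stages \<open>n\<close> and \<open>m\<close> are moved to
    stage \<open>n + m\<close>, where injectivity of the leg makes them equal; so the value may be
    read off from any representative.\<close>
  have wd: "Cpt (\<mu> n) a x = Cpt (\<mu> m) a y"
    if a: "a \<in> Obj C" and x: "x \<in> Ev (X n) a" and y: "y \<in> Ev (X m) a" and e: "Cpt (\<kappa> n) a x = Cpt (\<kappa> m) a y" for n m a x y
  proof -
    obtain x' where x': "x' \<in> Ev (X (n + m)) a" "Cpt (\<kappa> (n + m)) a x' = Cpt (\<kappa> n) a x" "Cpt (\<mu> (n + m)) a x' = Cpt (\<mu> n) a x"
      using step[OF a x, of m] by blast
    obtain y' where y': "y' \<in> Ev (X (n + m)) a" "Cpt (\<kappa> (n + m)) a y' = Cpt (\<kappa> m) a y" "Cpt (\<mu> (n + m)) a y' = Cpt (\<mu> m) a y"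
      using step[OF a y, of n] by (metis add.commute)
    have "x' = y'" by (rule inj_onD[OF inj[OF a] _ x'(1) y'(1)]) (use x' y' e in simp)
    then show ?thesis using x' y' by simp
  qed
  define c where "c a z = (let p = (SOME p. snd p \<in> Ev (X (fst p)) a \<and> z = Cpt (\<kappa> (fst p)) a (snd p)) in Cpt (\<mu> (fst p)) a (snd p))" for a z
  have c: "c a (Cpt (\<kappa> n) a x) = Cpt (\<mu> n) a x" if a: "a \<in> Obj C" and x: "x \<in> Ev (X n) a" for a n x
  proof -
    define p where "p = (SOME p. snd p \<in> Ev (X (fst p)) a \<and> Cpt (\<kappa> n) a x = Cpt (\<kappa> (fst p)) a (snd p))"
    have "snd p \<in> Ev (X (fst p)) a \<and> Cpt (\<kappa> n) a x = Cpt (\<kappa> (fst p)) a (snd p)"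
      unfolding p_def by (rule someI[of _ "(n, x)"]) (use x in simp)
    then have "Cpt (\<mu> (fst p)) a (snd p) = Cpt (\<mu> n) a x" using wd[OF a x, of "snd p" "fst p"] by simp
    then show ?thesis unfolding c_def p_def Let_def by simp
  qed
  have cov': "\<exists>i x. x \<in> Ev (X i) a \<and> z = Cpt (\<kappa> i) a x" if "a \<in> Obj C" "z \<in> Ev Y a" for a z
    using cov[OF that(1)] that(2) by blast
  have h: "mk_trans C Y Z c \<in> hom B Y Z"
  proof (rule mk_trans_hom[OF Y])
    show "presheaf U C Z" using Z Obj_B by simp
    fix a z assume a: "a \<in> Obj C" and z: "z \<in> Ev Y a"
    from cov'[OF a z] show "c a z \<in> Ev Z a" using c[OF a] Cpt_in[OF m a] by auto
  next
    fix u z assume u: "u \<in> Arr C" and z: "z \<in> Ev Y (Cod C u)"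
    note o = base_arr[OF u]
    from cov'[OF o(2) z] obtain i x where ix: "x \<in> Ev (X i) (Cod C u)" "z = Cpt (\<kappa> i) (Cod C u) x" by blast
    then have "Act Y u z = Cpt (\<kappa> i) (Dom C u) (Act (X i) u x)" using Cpt_nat[OF k u] by simp
    then show "c (Dom C u) (Act Y u z) = Act Z u (c (Cod C u) z)"
      using ix c[OF o(1) Act_in[OF homB_presheaf(1)[OF k] u ix(1)]] c[OF o(2) ix(1)]
        Cpt_nat[OF m u ix(1)] by simp
  qed
  have "mk_trans C Y Z c \<cdot>\<^bsub>B\<^esub> \<kappa> n = \<mu> n" for n
    by (rule homB_eqI[OF B_comp_hom[OF k h] m]) (simp add: Cpt_cmp[OF k] Cpt_in[OF k] c)
  then show "\<exists>h\<in>hom B Y Z. \<forall>n. h \<cdot>\<^bsub>B\<^esub> \<kappa> n = \<mu> n" using h by blast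
next
  fix Z h h' assume h: "h \<in> hom B Y Z" and h': "h' \<in> hom B Y Z" and e: "\<And>n. h \<cdot>\<^bsub>B\<^esub> \<kappa> n = h' \<cdot>\<^bsub>B\<^esub> \<kappa> n"
  show "h = h'"
  proof (rule homB_eqI[OF h h'])
    fix a z assume az: "a \<in> Obj C" "z \<in> Ev Y a"
    then obtain n x where x: "x \<in> Ev (X n) a" "z = Cpt (\<kappa> n) a x" using cov[OF az(1)] by blast
    then show "Cpt h a z = Cpt h' a z" using e[of n] Cpt_cmp[OF k az(1) x(1)] by metis
  qed
qed

end

section \<open>Coproducts, sequential colimits and pushouts as colimits over small preorders\<close>

section \<open>Preservation of colimits\<close>

text \<open>
  \<^const>\<open>preserves_colimits\<close> speaks only about index categories inside \<open>'v\<close>; spans, sequences and discrete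
  diagrams are therefore encoded as preorders on subsets of \<open>'v\<close>.
\<close>

definition vord :: "'v set \<Rightarrow> ('v \<Rightarrow> 'v \<Rightarrow> bool) \<Rightarrow> ('v, 'v) cat" where
  "vord I le = \<lparr>Obj = I, Arr = {vpair (i, j) |i j. i \<in> I \<and> j \<in> I \<and> le i j},
     Dom = (\<lambda>v. fst (inv vpair v)), Cod = (\<lambda>v. snd (inv vpair v)), Idt = (\<lambda>i. vpair (i, i)),
     Cmp = (\<lambda>v w. vpair (fst (inv vpair w), snd (inv vpair v)))\<rparr>"

definition is_order_cocone where
  "is_order_cocone C I le X u x \<iota> \<longleftrightarrow> x \<in> Obj C \<and> (\<forall>i\<in>I. \<iota> i \<in> hom C (X i) x) \<and>
     (\<forall>i\<in>I. \<forall>j\<in>I. le i j \<longrightarrow> \<iota> j \<cdot>\<^bsub>C\<^esub> u i j = \<iota> i)"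

definition is_order_colimit where
  "is_order_colimit C I le X u x \<iota> \<longleftrightarrow> is_order_cocone C I le X u x \<iota> \<and>
     (\<forall>y \<kappa>. is_order_cocone C I le X u y \<kappa> \<longrightarrow> (\<exists>!h. h \<in> hom C x y \<and> (\<forall>i\<in>I. h \<cdot>\<^bsub>C\<^esub> \<iota> i = \<kappa> i)))"

definition order_diagram where
  "order_diagram X u = \<lparr>Fob = X, Far = (\<lambda>v. u (fst (inv vpair v)) (snd (inv vpair v)))\<rparr>"

locale colimit_functor = universe U + C: category_locale C + D: category_locale D
  for U :: "'v set set" and C :: "('o, 'm) cat" and D :: "('p, 'n) cat" +
  fixes F :: "('o, 'm, 'p, 'n) func"
  assumes F: "is_functor C D F" and pres: "preserves_colimits U C D F"
begin

lemma F_hom: "t \<in> hom C x y \<Longrightarrow> Far F t \<in> hom D (Fob F x) (Fob F y)"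
  using F unfolding is_functor_def hom_def by auto

lemma F_comp: "t \<in> hom C x y \<Longrightarrow> s \<in> hom C y z \<Longrightarrow> Far F (s \<cdot>\<^bsub>C\<^esub> t) = Far F s \<cdot>\<^bsub>D\<^esub> Far F t"
  using F unfolding is_functor_def hom_def by auto

lemma F_id: "x \<in> Obj C \<Longrightarrow> Far F (Idt C x) = Idt D (Fob F x)"
  using F unfolding is_functor_def by auto

lemma cocone_vord:
  fixes I :: "'v set"
  shows "is_cocone (vord I le) E (order_diagram X u) x \<iota> \<longleftrightarrow> is_order_cocone E I le X u x \<iota>"
proof -
  have "(\<forall>v\<in>Arr (vord I le). \<iota> (Cod (vord I le) v) \<cdot>\<^bsub>E\<^esub> Far (order_diagram X u) v = \<iota> (Dom (vord I le) v)) \<longleftrightarrow>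
    (\<forall>i j. i \<in> I \<and> j \<in> I \<and> le i j \<longrightarrow> \<iota> j \<cdot>\<^bsub>E\<^esub> u i j = \<iota> i)"
    unfolding vord_def order_diagram_def by (simp add: Ball_def) (metis fst_conv snd_conv inv_vpair)
  then show ?thesis
    unfolding is_cocone_def is_order_cocone_def by (auto simp: vord_def order_diagram_def)
qed

lemma colimit_vord:
  fixes I :: "'v set"
  shows "is_colimit (vord I le) E (order_diagram X u) x \<iota> \<longleftrightarrow> is_order_colimit E I le X u x \<iota>"
  unfolding is_colimit_def is_order_colimit_def cocone_vord by (simp add: vord_def)

lemma small_vord:
  assumes I: "I \<in> U" and r: "\<And>i. i \<in> I \<Longrightarrow> le i i"
    and t: "\<And>i j k. i \<in> I \<Longrightarrow> j \<in> I \<Longrightarrow> k \<in> I \<Longrightarrow> le i j \<Longrightarrow> le j k \<Longrightarrow> le i k"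
  shows "small_category U (vord I le)"
proof -
  have "{vpair (i, j) |i j. i \<in> I \<and> j \<in> I \<and> le i j} \<in> U"
    by (rule U_subset[OF U_times[OF I I]]) auto
  then have "small U (Arr (vord I le))" "small U (Obj (vord I le))"
    unfolding small_def vord_def using I by (auto intro!: exI[of _ id])
  moreover have "category (vord I le)"
    unfolding category_def hom_def by (auto simp: vord_def intro: r t)
  ultimately show ?thesis unfolding small_category_def by blast
qed

lemma preserves_order_colimit:
  assumes I: "I \<in> U" and r: "\<And>i. i \<in> I \<Longrightarrow> le i i"
    and t: "\<And>i j k. i \<in> I \<Longrightarrow> j \<in> I \<Longrightarrow> k \<in> I \<Longrightarrow> le i j \<Longrightarrow> le j k \<Longrightarrow> le i k"
    and u: "\<And>i j. i \<in> I \<Longrightarrow> j \<in> I \<Longrightarrow> le i j \<Longrightarrow> u i j \<in> hom C (X i) (X j)"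
    and u_id: "\<And>i. i \<in> I \<Longrightarrow> u i i = Idt C (X i)"
    and u_cmp: "\<And>i j k. i \<in> I \<Longrightarrow> j \<in> I \<Longrightarrow> k \<in> I \<Longrightarrow> le i j \<Longrightarrow> le j k \<Longrightarrow> u j k \<cdot>\<^bsub>C\<^esub> u i j = u i k"
    and col: "is_order_colimit C I le X u x \<iota>"
  shows "is_order_colimit D I le (\<lambda>i. Fob F (X i)) (\<lambda>i j. Far F (u i j)) (Fob F x) (\<lambda>i. Far F (\<iota> i))"
proof -
  have X: "X i \<in> Obj C" if "i \<in> I" for i using C.hom_obj(1)[OF u[OF that that r[OF that]]] .
  have sm: "small_category U (vord I le)" by (rule small_vord[OF I]) (use r t in blast)+
  have "is_functor (vord I le) C (order_diagram X u)"
    unfolding is_functor_def order_diagram_def by (auto simp: vord_def X u u_id u_cmp)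
  moreover have "is_colimit (vord I le) C (order_diagram X u) x \<iota>" using col by (simp only: colimit_vord)
  ultimately have "is_colimit (vord I le) D (comp_func F (order_diagram X u)) (Fob F x) (\<lambda>i. Far F (\<iota> i))"
    using pres sm unfolding preserves_colimits_def by blast
  moreover have "comp_func F (order_diagram X u) = order_diagram (\<lambda>i. Fob F (X i)) (\<lambda>i j. Far F (u i j))"
    by (simp add: comp_func_def order_diagram_def comp_def)
  ultimately show ?thesis by (simp only: colimit_vord)
qed

text \<open>A discrete diagram is a diagram over equality as an order; its only transition maps are
  identities, so the cocone condition is void.\<close>

lemma preserves_coproduct:
  assumes I: "I \<in> U" and X: "\<And>i. i \<in> I \<Longrightarrow> X i \<in> Obj C" and c: "is_coproduct C I X p \<iota>"
  shows "is_coproduct D I (\<lambda>i. Fob F (X i)) (Fob F p) (\<lambda>i. Far F (\<iota> i))"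
proof -
  have c1: "is_order_cocone C I (=) X (\<lambda>i j. Idt C (X i)) x \<kappa> \<longleftrightarrow> x \<in> Obj C \<and> (\<forall>i\<in>I. \<kappa> i \<in> hom C (X i) x)" for x \<kappa>
    unfolding is_order_cocone_def using C.id_right by auto
  have c2: "is_order_cocone D I (=) (\<lambda>i. Fob F (X i)) (\<lambda>i j. Far F (Idt C (X i))) x \<kappa> \<longleftrightarrow>
      x \<in> Obj D \<and> (\<forall>i\<in>I. \<kappa> i \<in> hom D (Fob F (X i)) x)" for x \<kappa>
    unfolding is_order_cocone_def using D.id_right F_id X by auto
  have "is_order_colimit C I (=) X (\<lambda>i j. Idt C (X i)) p \<iota>"
    unfolding is_order_colimit_def c1 using c unfolding is_coproduct_def by simp
  then have "is_order_colimit D I (=) (\<lambda>i. Fob F (X i)) (\<lambda>i j. Far F (Idt C (X i))) (Fob F p) (\<lambda>i. Far F (\<iota> i))"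
    by (rule preserves_order_colimit[OF I, rotated -1])
      (use X in \<open>auto intro: C.id_hom C.id_left[OF C.id_hom]\<close>)
  then show ?thesis unfolding is_order_colimit_def c2 is_coproduct_def by simp
qed

text \<open>\<open>is_seq_colimit\<close> only sees the maps from stage \<open>n\<close> to stage
  \<open>Suc n\<close>, while the order on the naturals has an arrow for each
  \<open>m \<le> n\<close>. Hence a full system \<open>u m n\<close> is assumed.\<close>

lemma preserves_seq_colimit:
  assumes u: "\<And>m n. m \<le> n \<Longrightarrow> u m n \<in> hom C (X m) (X n)" and u_id: "\<And>n. u n n = Idt C (X n)"
    and u_cmp: "\<And>l m n. l \<le> m \<Longrightarrow> m \<le> n \<Longrightarrow> u m n \<cdot>\<^bsub>C\<^esub> u l m = u l n"
    and c: "is_seq_colimit C X (\<lambda>n. u n (Suc n)) x \<iota>"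
  shows "is_seq_colimit D (\<lambda>n. Fob F (X n)) (\<lambda>n. Far F (u n (Suc n))) (Fob F x) (\<lambda>n. Far F (\<iota> n))"
proof -
  obtain S :: "'v set" where "infinite S" using U_infinite by blast
  then obtain e :: "nat \<Rightarrow> 'v" where e: "inj e" using infinite_countable_subset by blast
  define I where "I = range e"
  define k where "k = inv e"
  have ke [simp]: "k (e n) = n" for n unfolding k_def using e by simp
  have I: "I \<in> U" unfolding I_def by (rule U_countable)
  define le where "le i j \<longleftrightarrow> k i \<le> k j" for i j
  \<comment> \<open>Compatibility with successive maps implies it for all \<open>m \<le> n\<close>.
    The category is left arbitrary because cocones in \<open>C\<close> and in \<open>D\<close> both
    need this.\<close>
  have step: "\<kappa> n \<cdot>\<^bsub>E\<^esub> v m n = \<kappa> m"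
    if E: "category E" and \<kappa>: "\<And>n. \<kappa> n \<in> hom E (Z n) z" and s: "\<And>n. \<kappa> (Suc n) \<cdot>\<^bsub>E\<^esub> v n (Suc n) = \<kappa> n"
      and v: "\<And>m n. m \<le> n \<Longrightarrow> v m n \<in> hom E (Z m) (Z n)" and vi: "\<And>n. v n n = Idt E (Z n)"
      and vc: "\<And>l m n. l \<le> m \<Longrightarrow> m \<le> n \<Longrightarrow> v m n \<cdot>\<^bsub>E\<^esub> v l m = v l n" and mn: "m \<le> n"
    for \<kappa> m n z Z v and E :: "('x, 'y) cat"
    using mn
  proof (induction n rule: dec_induct)
    case base
    interpret E: category_locale E by unfold_locales (rule E)
    show ?case using E.id_right[OF \<kappa>] vi by simp
  next
    case (step n)
    interpret E: category_locale E by unfold_locales (rule E)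
    show ?case using E.assoc[OF v[OF step(1)] v \<kappa>, of "Suc n"] vc[OF step(1), of "Suc n"] s[of n] step(3) by simp
  qed
  have c1: "is_order_cocone C I le (\<lambda>i. X (k i)) (\<lambda>i j. u (k i) (k j)) y \<kappa> \<longleftrightarrow>
     y \<in> Obj C \<and> (\<forall>n. \<kappa> (e n) \<in> hom C (X n) y) \<and> (\<forall>n. \<kappa> (e (Suc n)) \<cdot>\<^bsub>C\<^esub> u n (Suc n) = \<kappa> (e n))" for y \<kappa>
    unfolding is_order_cocone_def I_def le_def
    using step[OF C.category, of "\<lambda>n. \<kappa> (e n)" X y u] u u_id u_cmp by auto
  have c2: "is_order_cocone D I le (\<lambda>i. Fob F (X (k i))) (\<lambda>i j. Far F (u (k i) (k j))) y \<kappa> \<longleftrightarrow>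
     y \<in> Obj D \<and> (\<forall>n. \<kappa> (e n) \<in> hom D (Fob F (X n)) y) \<and> (\<forall>n. \<kappa> (e (Suc n)) \<cdot>\<^bsub>D\<^esub> Far F (u n (Suc n)) = \<kappa> (e n))" for y \<kappa>
  proof -
    have "\<And>m n. m \<le> n \<Longrightarrow> Far F (u m n) \<in> hom D (Fob F (X m)) (Fob F (X n))" using F_hom u by blast
    moreover have "\<And>n. Far F (u n n) = Idt D (Fob F (X n))" using u_id F_id C.hom_obj(1)[OF u[OF order_refl]] by simp
    moreover have "\<And>l m n. l \<le> m \<Longrightarrow> m \<le> n \<Longrightarrow> Far F (u m n) \<cdot>\<^bsub>D\<^esub> Far F (u l m) = Far F (u l n)"
      using u_cmp F_comp[OF u u] by metis
    ultimately show ?thesis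
      unfolding is_order_cocone_def I_def le_def
      using step[OF D.category, of "\<lambda>n. \<kappa> (e n)" "\<lambda>n. Fob F (X n)" y "\<lambda>m n. Far F (u m n)"] by auto
  qed
  have "is_order_colimit C I le (\<lambda>i. X (k i)) (\<lambda>i j. u (k i) (k j)) x (\<lambda>i. \<iota> (k i))"
    unfolding is_order_colimit_def c1 using c unfolding is_seq_colimit_def I_def by simp
  then have "is_order_colimit D I le (\<lambda>i. Fob F (X (k i))) (\<lambda>i j. Far F (u (k i) (k j))) (Fob F x) (\<lambda>i. Far F (\<iota> (k i)))"
    by (rule preserves_order_colimit[OF I, rotated -1]) (auto simp: le_def u u_id u_cmp)
  then have pc: "\<And>y \<kappa>. is_order_cocone D I le (\<lambda>i. Fob F (X (k i))) (\<lambda>i j. Far F (u (k i) (k j))) y (\<lambda>i. \<kappa> (k i)) \<Longrightarrow>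
      \<exists>!h. h \<in> hom D (Fob F x) y \<and> (\<forall>i\<in>I. h \<cdot>\<^bsub>D\<^esub> Far F (\<iota> (k i)) = \<kappa> (k i))"
    and cc: "is_order_cocone D I le (\<lambda>i. Fob F (X (k i))) (\<lambda>i j. Far F (u (k i) (k j))) (Fob F x) (\<lambda>i. Far F (\<iota> (k i)))"
    unfolding is_order_colimit_def by blast+
  show ?thesis unfolding is_seq_colimit_def
    using cc[unfolded c2] pc[unfolded c2] by (simp add: I_def)
qed

lemma preserves_po:
  assumes po: "C.po a b c p i g g' i'"
  shows "D.po (Fob F a) (Fob F b) (Fob F c) (Fob F p) (Far F i) (Far F g) (Far F g') (Far F i')"
proof -
  note h = C.po_hom[OF po]
  obtain S :: "'v set" where "infinite S" using U_infinite by blast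
  then obtain e :: "nat \<Rightarrow> 'v" where e: "inj e" using infinite_countable_subset by blast
  \<comment> \<open>Three codes for a span: the apex \<open>e 0\<close> lies below the feet
    \<open>e (Suc 0)\<close> and \<open>e 2\<close>.\<close>
  define I where "I = {e 0, e (Suc 0), e 2}"
  have ne: "e 0 \<noteq> e (Suc 0)" "e 0 \<noteq> e 2" "e (Suc 0) \<noteq> e 2" "e (Suc 0) \<noteq> e 0" "e 2 \<noteq> e 0" "e 2 \<noteq> e (Suc 0)" using e by (auto dest: injD)
  have I: "I \<in> U" using U_subset[OF U_countable[of e], of I] by (auto simp: I_def)
  define le where "le x y \<longleftrightarrow> x = y \<or> x = e 0" for x y
  define X where "X x = (if x = e 0 then a else if x = e (Suc 0) then b else c)" for x
  define u where "u x y = (if x = y then Idt C (X x) else if y = e (Suc 0) then i else g)" for x y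
  have X: "X (e 0) = a" "X (e (Suc 0)) = b" "X (e 2) = c" unfolding X_def using ne by auto
  have obs: "a \<in> Obj C" "b \<in> Obj C" "c \<in> Obj C" using h C.hom_obj by blast+
  have u: "u (e 0) (e (Suc 0)) = i" "u (e 0) (e 2) = g" "u (e 0) (e 0) = Idt C a" "u (e (Suc 0)) (e (Suc 0)) = Idt C b" "u (e 2) (e 2) = Idt C c"
    unfolding u_def using ne X by auto
  have c1: "is_order_cocone C I le X u y \<kappa> \<longleftrightarrow> y \<in> Obj C \<and> \<kappa> (e 0) \<in> hom C a y \<and> \<kappa> (e (Suc 0)) \<in> hom C b y \<and> \<kappa> (e 2) \<in> hom C c y \<and>
      \<kappa> (e (Suc 0)) \<cdot>\<^bsub>C\<^esub> i = \<kappa> (e 0) \<and> \<kappa> (e 2) \<cdot>\<^bsub>C\<^esub> g = \<kappa> (e 0)" for y \<kappa>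
    unfolding is_order_cocone_def I_def le_def using C.id_right ne by (auto simp: X u)
  have Fu: "Far F (u (e 0) (e 0)) = Idt D (Fob F a)" "Far F (u (e (Suc 0)) (e (Suc 0))) = Idt D (Fob F b)" "Far F (u (e 2) (e 2)) = Idt D (Fob F c)"
    using u F_id obs by auto
  have c2: "is_order_cocone D I le (\<lambda>i. Fob F (X i)) (\<lambda>i j. Far F (u i j)) y \<kappa> \<longleftrightarrow> y \<in> Obj D \<and> \<kappa> (e 0) \<in> hom D (Fob F a) y \<and>
      \<kappa> (e (Suc 0)) \<in> hom D (Fob F b) y \<and> \<kappa> (e 2) \<in> hom D (Fob F c) y \<and>
      \<kappa> (e (Suc 0)) \<cdot>\<^bsub>D\<^esub> Far F i = \<kappa> (e 0) \<and> \<kappa> (e 2) \<cdot>\<^bsub>D\<^esub> Far F g = \<kappa> (e 0)" for y \<kappa>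
    unfolding is_order_cocone_def I_def le_def using D.id_right ne by (auto simp: X u(1,2) Fu)
  \<comment> \<open>A cocone over the order also has a leg at the apex; it is forced to be the
    composite through either foot.\<close>
  define \<iota> where "\<iota> x = (if x = e 0 then g' \<cdot>\<^bsub>C\<^esub> i else if x = e (Suc 0) then g' else i')" for x
  have \<iota>: "\<iota> (e 0) = g' \<cdot>\<^bsub>C\<^esub> i" "\<iota> (e (Suc 0)) = g'" "\<iota> (e 2) = i'" unfolding \<iota>_def using ne by auto
  have col: "is_order_colimit C I le X u p \<iota>"
    unfolding is_order_colimit_def c1 \<iota>
  proof (intro conjI allI impI)
    show "p \<in> Obj C" "g' \<cdot>\<^bsub>C\<^esub> i \<in> hom C a p" "g' \<in> hom C b p" "i' \<in> hom C c p" using h C.hom_obj by blast+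
    show "g' \<cdot>\<^bsub>C\<^esub> i = g' \<cdot>\<^bsub>C\<^esub> i" "i' \<cdot>\<^bsub>C\<^esub> g = g' \<cdot>\<^bsub>C\<^esub> i" using C.po_comm[OF po] by auto
    fix y \<kappa> assume A: "y \<in> Obj C \<and> \<kappa> (e 0) \<in> hom C a y \<and> \<kappa> (e (Suc 0)) \<in> hom C b y \<and> \<kappa> (e 2) \<in> hom C c y \<and>
      \<kappa> (e (Suc 0)) \<cdot>\<^bsub>C\<^esub> i = \<kappa> (e 0) \<and> \<kappa> (e 2) \<cdot>\<^bsub>C\<^esub> g = \<kappa> (e 0)"
    then have "\<kappa> (e (Suc 0)) \<in> hom C b y" "\<kappa> (e 2) \<in> hom C c y" "\<kappa> (e (Suc 0)) \<cdot>\<^bsub>C\<^esub> i = \<kappa> (e 2) \<cdot>\<^bsub>C\<^esub> g" by auto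
    then obtain k where k: "k \<in> hom C p y" "k \<cdot>\<^bsub>C\<^esub> g' = \<kappa> (e (Suc 0))" "k \<cdot>\<^bsub>C\<^esub> i' = \<kappa> (e 2)"
      by (rule C.po_ex[OF po])
    have "k \<cdot>\<^bsub>C\<^esub> (g' \<cdot>\<^bsub>C\<^esub> i) = \<kappa> (e 0)" using C.assoc[OF h(1,3) k(1)] k A by simp
    then have "\<forall>j\<in>I. k \<cdot>\<^bsub>C\<^esub> \<iota> j = \<kappa> j" using k by (auto simp: I_def \<iota>)
    moreover have "k' = k" if "k' \<in> hom C p y" "\<forall>j\<in>I. k' \<cdot>\<^bsub>C\<^esub> \<iota> j = \<kappa> j" for k'
    proof (rule C.po_eq[OF po that(1) k(1)])
      have "k' \<cdot>\<^bsub>C\<^esub> \<iota> (e (Suc 0)) = \<kappa> (e (Suc 0))" "k' \<cdot>\<^bsub>C\<^esub> \<iota> (e 2) = \<kappa> (e 2)" using that(2) by (auto simp: I_def)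
      then show "k' \<cdot>\<^bsub>C\<^esub> g' = k \<cdot>\<^bsub>C\<^esub> g'" "k' \<cdot>\<^bsub>C\<^esub> i' = k \<cdot>\<^bsub>C\<^esub> i'" using k \<iota> by auto
    qed
    ultimately show "\<exists>!h. h \<in> hom C p y \<and> (\<forall>j\<in>I. h \<cdot>\<^bsub>C\<^esub> \<iota> j = \<kappa> j)" using k(1) by (metis (no_types, lifting))
  qed
  have "is_order_colimit D I le (\<lambda>i. Fob F (X i)) (\<lambda>i j. Far F (u i j)) (Fob F p) (\<lambda>i. Far F (\<iota> i))"
  proof (rule preserves_order_colimit[OF I _ _ _ _ _ col])
    show "le x x" for x by (simp add: le_def)
    show "le x z" if "le x y" "le y z" for x y z using that by (auto simp: le_def)
    show "u x y \<in> hom C (X x) (X y)" if "x \<in> I" "y \<in> I" "le x y" for x y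
      using that ne h C.id_hom[OF obs(1)] C.id_hom[OF obs(2)] C.id_hom[OF obs(3)]
      unfolding I_def le_def by (auto simp: u X)
    show "u x x = Idt C (X x)" for x by (simp add: u_def)
    show "u y z \<cdot>\<^bsub>C\<^esub> u x y = u x z" if "x \<in> I" "y \<in> I" "z \<in> I" "le x y" "le y z" for x y z
      using that ne C.id_left[OF h(1)] C.id_left[OF h(2)] C.id_right[OF h(1)] C.id_right[OF h(2)]
        C.id_left[OF C.id_hom[OF obs(1)]] C.id_left[OF C.id_hom[OF obs(2)]] C.id_left[OF C.id_hom[OF obs(3)]]
      unfolding I_def le_def by (auto simp: u X)
  qed
  note dcol = this[unfolded is_order_colimit_def c2]
  have up: "\<exists>!h. h \<in> hom D (Fob F p) y \<and> (\<forall>j\<in>I. h \<cdot>\<^bsub>D\<^esub> Far F (\<iota> j) = \<kappa> j)"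
    if "y \<in> Obj D \<and> \<kappa> (e 0) \<in> hom D (Fob F a) y \<and>
      \<kappa> (e (Suc 0)) \<in> hom D (Fob F b) y \<and> \<kappa> (e 2) \<in> hom D (Fob F c) y \<and>
      \<kappa> (e (Suc 0)) \<cdot>\<^bsub>D\<^esub> Far F i = \<kappa> (e 0) \<and> \<kappa> (e 2) \<cdot>\<^bsub>D\<^esub> Far F g = \<kappa> (e 0)" for y \<kappa>
    using dcol that by blast
  note Fh = F_hom[OF h(1)] F_hom[OF h(2)] F_hom[OF h(3)] F_hom[OF h(4)]
  show ?thesis
  proof (rule D.poI[OF Fh])
    show "Far F g' \<cdot>\<^bsub>D\<^esub> Far F i = Far F i' \<cdot>\<^bsub>D\<^esub> Far F g"
      using F_comp[OF h(1,3)] F_comp[OF h(2,4)] C.po_comm[OF po] by simp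
  next
    fix y s t assume st: "s \<in> hom D (Fob F b) y" "t \<in> hom D (Fob F c) y" "s \<cdot>\<^bsub>D\<^esub> Far F i = t \<cdot>\<^bsub>D\<^esub> Far F g"
    define \<kappa> where "\<kappa> x = (if x = e 0 then s \<cdot>\<^bsub>D\<^esub> Far F i else if x = e (Suc 0) then s else t)" for x
    have \<kappa>: "\<kappa> (e 0) = s \<cdot>\<^bsub>D\<^esub> Far F i" "\<kappa> (e (Suc 0)) = s" "\<kappa> (e 2) = t" unfolding \<kappa>_def using ne by auto
    have "\<exists>!h. h \<in> hom D (Fob F p) y \<and> (\<forall>j\<in>I. h \<cdot>\<^bsub>D\<^esub> Far F (\<iota> j) = \<kappa> j)"
      by (rule up) (use st Fh D.hom_obj(2)[OF st(1)] in \<open>auto simp: \<kappa>\<close>)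
    then obtain k where k: "k \<in> hom D (Fob F p) y" "\<forall>j\<in>I. k \<cdot>\<^bsub>D\<^esub> Far F (\<iota> j) = \<kappa> j" by blast
    have "k \<cdot>\<^bsub>D\<^esub> Far F (\<iota> (e (Suc 0))) = \<kappa> (e (Suc 0))" "k \<cdot>\<^bsub>D\<^esub> Far F (\<iota> (e 2)) = \<kappa> (e 2)" using k(2) by (auto simp: I_def)
    then show "\<exists>h\<in>hom D (Fob F p) y. h \<cdot>\<^bsub>D\<^esub> Far F g' = s \<and> h \<cdot>\<^bsub>D\<^esub> Far F i' = t" using k(1) \<iota> \<kappa> by auto
  next
    fix y k l assume kl: "k \<in> hom D (Fob F p) y" "l \<in> hom D (Fob F p) y"
      "k \<cdot>\<^bsub>D\<^esub> Far F g' = l \<cdot>\<^bsub>D\<^esub> Far F g'" "k \<cdot>\<^bsub>D\<^esub> Far F i' = l \<cdot>\<^bsub>D\<^esub> Far F i'"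
    define \<kappa> where "\<kappa> j = k \<cdot>\<^bsub>D\<^esub> Far F (\<iota> j)" for j
    have e0: "k \<cdot>\<^bsub>D\<^esub> Far F (\<iota> (e 0)) = (k \<cdot>\<^bsub>D\<^esub> Far F g') \<cdot>\<^bsub>D\<^esub> Far F i" "l \<cdot>\<^bsub>D\<^esub> Far F (\<iota> (e 0)) = (l \<cdot>\<^bsub>D\<^esub> Far F g') \<cdot>\<^bsub>D\<^esub> Far F i"
      using F_comp[OF h(1,3)] D.assoc[OF Fh(1,3) kl(1)] D.assoc[OF Fh(1,3) kl(2)] \<iota> by auto
    have e0': "k \<cdot>\<^bsub>D\<^esub> Far F (\<iota> (e 0)) = (k \<cdot>\<^bsub>D\<^esub> Far F i') \<cdot>\<^bsub>D\<^esub> Far F g"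
      using F_comp[OF h(2,4)] D.assoc[OF Fh(2,4) kl(1)] \<iota> C.po_comm[OF po] by auto
    have "\<exists>!h. h \<in> hom D (Fob F p) y \<and> (\<forall>j\<in>I. h \<cdot>\<^bsub>D\<^esub> Far F (\<iota> j) = \<kappa> j)"
    proof (rule up, intro conjI)
      show "\<kappa> (e (Suc 0)) \<cdot>\<^bsub>D\<^esub> Far F i = \<kappa> (e 0)" "\<kappa> (e 2) \<cdot>\<^bsub>D\<^esub> Far F g = \<kappa> (e 0)"
        unfolding \<kappa>_def using e0 e0' \<iota> by auto
      show "\<kappa> (e 0) \<in> hom D (Fob F a) y" "\<kappa> (e (Suc 0)) \<in> hom D (Fob F b) y" "\<kappa> (e 2) \<in> hom D (Fob F c) y"
        unfolding \<kappa>_def e0 using Fh kl(1) \<iota> by auto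
      show "y \<in> Obj D" using kl D.hom_obj by blast
    qed
    moreover have "\<forall>j\<in>I. l \<cdot>\<^bsub>D\<^esub> Far F (\<iota> j) = \<kappa> j" using kl e0 \<iota> unfolding I_def \<kappa>_def by auto
    moreover have "\<forall>j\<in>I. k \<cdot>\<^bsub>D\<^esub> Far F (\<iota> j) = \<kappa> j" unfolding \<kappa>_def by auto
    ultimately show "k = l" using kl by blast
  qed
qed

end

section \<open>Slices, external products, and functors that can be compared cell by cell\<close>

section \<open>Cellular functors\<close>

lemma prod_cat_simps [simp]:
  "Obj (prod_cat C D) = Obj C \<times> Obj D" "Arr (prod_cat C D) = Arr C \<times> Arr D"
  "Dom (prod_cat C D) (f, g) = (Dom C f, Dom D g)" "Cod (prod_cat C D) (f, g) = (Cod C f, Cod D g)"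
  "Idt (prod_cat C D) (a, r) = (Idt C a, Idt D r)"
  "(f', g') \<cdot>\<^bsub>prod_cat C D\<^esub> (f, g) = (f' \<cdot>\<^bsub>C\<^esub> f, g' \<cdot>\<^bsub>D\<^esub> g)"
  by (simp_all add: prod_cat_def)

lemma category_prod_cat: "category C \<Longrightarrow> category D \<Longrightarrow> category (prod_cat C D)"
  unfolding category_def hom_def by (auto simp: prod_cat_def)

context presheaf_category begin

text \<open>Summands are tagged by their index through \<open>vpair\<close>, which keeps them
  disjoint inside \<open>'v\<close>.\<close>

definition copr :: "'v set \<Rightarrow> ('v \<Rightarrow> ('o, 'm, 'v) presh) \<Rightarrow> ('o, 'm, 'v) presh" where
  "copr I X = mk_presheaf C (\<lambda>c. \<Union>i\<in>I. (\<lambda>x. vpair (i, x)) ` Ev (X i) c)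
     (\<lambda>f z. vpair (fst (inv vpair z), Act (X (fst (inv vpair z))) f (snd (inv vpair z))))"

definition copr_in :: "'v set \<Rightarrow> ('v \<Rightarrow> ('o, 'm, 'v) presh) \<Rightarrow> 'v \<Rightarrow> ('o, 'm, 'v) nat_trans" where
  "copr_in I X i = mk_trans C (X i) (copr I X) (\<lambda>_ x. vpair (i, x))"

lemma Ev_copr: "c \<in> Obj C \<Longrightarrow> Ev (copr I X) c = (\<Union>i\<in>I. (\<lambda>x. vpair (i, x)) ` Ev (X i) c)"
  by (simp add: copr_def)

lemma Act_copr: "f \<in> Arr C \<Longrightarrow> i \<in> I \<Longrightarrow> x \<in> Ev (X i) (Cod C f) \<Longrightarrow> Act (copr I X) f (vpair (i, x)) = vpair (i, Act (X i) f x)"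
  unfolding copr_def by (subst mk_presheaf_simps) auto

lemma presheaf_copr:
  assumes I: "I \<in> U" and X: "\<And>i. i \<in> I \<Longrightarrow> presheaf U C (X i)"
  shows "presheaf U C (copr I X)"
  unfolding copr_def
proof (rule presheaf_mk_presheaf)
  show "(\<Union>i\<in>I. (\<lambda>x. vpair (i, x)) ` Ev (X i) c) \<in> U" if "c \<in> Obj C" for c
    by (intro U_UN I U_image Ev_U X that)
  show "vpair (fst (inv vpair z), Act (X (fst (inv vpair z))) f (snd (inv vpair z))) \<in> (\<Union>i\<in>I. (\<lambda>x. vpair (i, x)) ` Ev (X i) (Dom C f))"
    if "f \<in> Arr C" "z \<in> (\<Union>i\<in>I. (\<lambda>x. vpair (i, x)) ` Ev (X i) (Cod C f))" for f z
    using that Act_in[OF X that(1)] by force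
qed (use X Act_in Act_id Act_cmp in auto)

lemma copr_in_hom:
  assumes I: "I \<in> U" and X: "\<And>i. i \<in> I \<Longrightarrow> presheaf U C (X i)" and i: "i \<in> I"
  shows "copr_in I X i \<in> hom B (X i) (copr I X)"
  unfolding copr_in_def
  by (rule mk_trans_hom[OF X[OF i] presheaf_copr[OF I X]]) (use i base_arr in \<open>auto simp: Ev_copr Act_copr\<close>)

lemma ptwise_coproduct_copr:
  assumes I: "I \<in> U" and X: "\<And>i. i \<in> I \<Longrightarrow> presheaf U C (X i)"
  shows "ptwise_coproduct I X (copr I X) (copr_in I X)"
  unfolding ptwise_coproduct_def
proof (intro conjI ballI impI)
  show "presheaf U C (copr I X)" by (rule presheaf_copr[OF I X])
  show "copr_in I X i \<in> hom B (X i) (copr I X)" if "i \<in> I" for i by (rule copr_in_hom[OF I X that])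
  fix a assume a: "a \<in> Obj C"
  have im: "Cpt (copr_in I X i) a ` Ev (X i) a = (\<lambda>x. vpair (i, x)) ` Ev (X i) a" for i
    by (rule image_cong) (use a in \<open>auto simp: copr_in_def\<close>)
  show "inj_on (Cpt (copr_in I X i) a) (Ev (X i) a)" for i
    by (rule inj_onI) (use a in \<open>simp add: copr_in_def\<close>)
  show "Cpt (copr_in I X i) a ` Ev (X i) a \<inter> Cpt (copr_in I X j) a ` Ev (X j) a = {}" if "i \<noteq> j" for i j
    unfolding im using that by auto
  show "Ev (copr I X) a \<subseteq> (\<Union>i\<in>I. Cpt (copr_in I X i) a ` Ev (X i) a)" unfolding im using Ev_copr[OF a] by simp
qed

end

locale cisinski_setting = universe U + A: presheaf_category U A + R: presheaf_category U R
    + AR: presheaf_category U "prod_cat A R" + H: cof_category "psh U A" U cof we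
  for U :: "'v set set" and A :: "('a, 'b) cat" and R :: "('r, 's) cat" and cof we +
  assumes cof_mono: "cof = mono_arrows (psh U A)"
begin

lemma prod_arr: "a \<in> Obj A \<Longrightarrow> \<phi> \<in> Arr R \<Longrightarrow> (Idt A a, \<phi>) \<in> Arr (prod_cat A R)"
  and arr_prod: "u \<in> Arr A \<Longrightarrow> r \<in> Obj R \<Longrightarrow> (u, Idt R r) \<in> Arr (prod_cat A R)"
  using A.base_id R.base_id by auto

lemma slice_obj_Ev [simp]: "a \<in> Obj A \<Longrightarrow> Ev (slice_obj A R X r) a = Ev X (a, r)"
  and slice_obj_Act [simp]: "u \<in> Arr A \<Longrightarrow> Act (slice_obj A R X r) u = Act X (u, Idt R r)"
  by (simp_all add: slice_obj_def)

lemma slice_map_simps [simp]: "a \<in> Obj A \<Longrightarrow> Cpt (slice_map A R t r) a = Cpt t (a, r)"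
  "Src (slice_map A R t r) = slice_obj A R (Src t) r" "Tgt (slice_map A R t r) = slice_obj A R (Tgt t) r"
  by (simp_all add: slice_map_def)

lemma slice_presheaf:
  assumes X: "presheaf U (prod_cat A R) X" and r: "r \<in> Obj R"
  shows "presheaf U A (slice_obj A R X r)"
proof -
  \<comment> \<open>\<open>slice_obj\<close> does not restrict the action to elements; the missing
    extensionality is inherited from \<open>Act X\<close>.\<close>
  have e: "slice_obj A R X r = mk_presheaf A (\<lambda>a. Ev X (a, r)) (\<lambda>u. Act X (u, Idt R r))"
  proof -
    have "Act X (u, Idt R r) = (\<lambda>x\<in>Ev X (Cod A u, r). Act X (u, Idt R r) x)" if "u \<in> Arr A" for u
    proof -
      have "Act X \<in> (\<Pi>\<^sub>E f\<in>Arr (prod_cat A R). Ev X (Cod (prod_cat A R) f) \<rightarrow>\<^sub>E Ev X (Dom (prod_cat A R) f))"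
        using X unfolding presheaf_def by blast
      from PiE_mem[OF this arr_prod[OF that r]] have "Act X (u, Idt R r) \<in> Ev X (Cod A u, r) \<rightarrow>\<^sub>E Ev X (Dom A u, r)"
        by (simp add: R.base_id[OF r])
      then show ?thesis by (simp add: PiE_def extensional_restrict)
    qed
    then show ?thesis unfolding slice_obj_def mk_presheaf_def by (auto simp: fun_eq_iff)
  qed
  show ?thesis unfolding e
  proof (rule A.presheaf_mk_presheaf)
    show "Ev X (a, r) \<in> U" if "a \<in> Obj A" for a using AR.Ev_U[OF X] that r by simp
    show "Act X (u, Idt R r) x \<in> Ev X (Dom A u, r)" if "u \<in> Arr A" "x \<in> Ev X (Cod A u, r)" for u x
      using AR.Act_in[OF X, of "(u, Idt R r)" x] that r R.base_id[OF r] by simp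
    show "Act X (Idt A a, Idt R r) x = x" if "a \<in> Obj A" "x \<in> Ev X (a, r)" for a x
      using AR.Act_id[OF X, of "(a, r)" x] that r by simp
    show "Act X (g \<cdot>\<^bsub>A\<^esub> f, Idt R r) x = Act X (f, Idt R r) (Act X (g, Idt R r) x)"
      if "f \<in> Arr A" "g \<in> Arr A" "Cod A f = Dom A g" "x \<in> Ev X (Cod A g, r)" for f g x
      using AR.Act_cmp[OF X, of "(f, Idt R r)" "(g, Idt R r)" x] that r R.base_id[OF r]
        R.base.id_left[OF R.base.id_hom[OF r]] by simp
  qed
qed

lemma slice_hom:
  assumes t: "t \<in> hom AR.B X Y" and r: "r \<in> Obj R"
  shows "slice_map A R t r \<in> hom A.B (slice_obj A R X r) (slice_obj A R Y r)"
proof -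
  note ps = slice_presheaf[OF AR.homB_presheaf(1)[OF t] r] slice_presheaf[OF AR.homB_presheaf(2)[OF t] r]
  have st: "Src t = X" "Tgt t = Y" using t AR.homB_iff by auto
  have "slice_map A R t r = mk_trans A (slice_obj A R X r) (slice_obj A R Y r) (\<lambda>a. Cpt t (a, r))"
  proof -
    have "Cpt t (a, r) = (\<lambda>x\<in>Ev X (a, r). Cpt t (a, r) x)" if "a \<in> Obj A" for a
    proof -
      have "Cpt t (a, r) \<in> Ev X (a, r) \<rightarrow>\<^sub>E Ev Y (a, r)"
        using t that r unfolding AR.homB_iff natural_trans_def PiE_def Pi_def by auto
      then show ?thesis by (simp add: PiE_def extensional_restrict)
    qed
    then show ?thesis unfolding slice_map_def mk_trans_def st by (auto simp: fun_eq_iff)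
  qed
  also have "\<dots> \<in> hom A.B (slice_obj A R X r) (slice_obj A R Y r)"
  proof (rule A.mk_trans_hom[OF ps])
    show "Cpt t (a, r) x \<in> Ev (slice_obj A R Y r) a" if "a \<in> Obj A" "x \<in> Ev (slice_obj A R X r) a" for a x
      using AR.Cpt_in[OF t, of "(a, r)" x] that r by simp
    show "Cpt t (Dom A f, r) (Act (slice_obj A R X r) f x) = Act (slice_obj A R Y r) f (Cpt t (Cod A f, r) x)"
      if "f \<in> Arr A" "x \<in> Ev (slice_obj A R X r) (Cod A f)" for f x
      using AR.Cpt_nat[OF t, of "(f, Idt R r)" x] that r R.base_id[OF r] A.base_arr by simp
  qed
  finally show ?thesis .
qed

lemma slice_comp:
  assumes t: "t \<in> hom AR.B X Y" and s: "s \<in> hom AR.B Y Z" and r: "r \<in> Obj R"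
  shows "slice_map A R (s \<cdot>\<^bsub>AR.B\<^esub> t) r = slice_map A R s r \<cdot>\<^bsub>A.B\<^esub> slice_map A R t r"
proof (rule A.homB_eqI[OF slice_hom[OF AR.B_comp_hom[OF t s] r] A.B_comp_hom[OF slice_hom[OF t r] slice_hom[OF s r]]])
  fix a x assume "a \<in> Obj A" "x \<in> Ev (slice_obj A R X r) a"
  then show "Cpt (slice_map A R (s \<cdot>\<^bsub>AR.B\<^esub> t) r) a x = Cpt (slice_map A R s r \<cdot>\<^bsub>A.B\<^esub> slice_map A R t r) a x"
    using A.Cpt_cmp[OF slice_hom[OF t r]] AR.Cpt_cmp[OF t, of "(a, r)" x] r by simp
qed

lemma injective_cof:
  assumes t: "t \<in> hom A.B X Y" and inj: "\<And>a. a \<in> Obj A \<Longrightarrow> inj_on (Cpt t a) (Ev X a)"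
  shows "t \<in> cof"
  unfolding cof_mono by (rule A.injective_mono[OF t inj])

lemma Ev_ext_prod: "a \<in> Obj A \<Longrightarrow> r \<in> Obj R \<Longrightarrow> Ev (ext_prod_obj A R L K) (a, r) = vpair ` (Ev K a \<times> Ev L r)"
  by (simp add: ext_prod_obj_def)

lemma Act_ext_prod:
  fixes K :: "('a, 'b, 'v) presh" and L :: "('r, 's, 'v) presh"
  shows "u \<in> Arr A \<Longrightarrow> \<phi> \<in> Arr R \<Longrightarrow> x \<in> Ev K (Cod A u) \<Longrightarrow> y \<in> Ev L (Cod R \<phi>) \<Longrightarrow>
    Act (ext_prod_obj A R L K) (u, \<phi>) (vpair (x, y)) = vpair (Act K u x, Act L \<phi> y)"
  by (simp add: ext_prod_obj_def)

lemma ext_prod_presheaf: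
  assumes L: "presheaf U R L" and K: "presheaf U A K"
  shows "presheaf U (prod_cat A R) (ext_prod_obj A R L K)"
proof -
  have "ext_prod_obj A R L K = mk_presheaf (prod_cat A R) (\<lambda>(a, r). vpair ` (Ev K a \<times> Ev L r))
     (\<lambda>(u, \<phi>) z. vpair (map_prod (Act K u) (Act L \<phi>) (inv vpair z)))"
    unfolding ext_prod_obj_def mk_presheaf_def prod_cat_def by (auto simp: fun_eq_iff restrict_def)
  also have "presheaf U (prod_cat A R) \<dots>"
  proof (rule AR.presheaf_mk_presheaf)
    show "(case c of (a, r) \<Rightarrow> vpair ` (Ev K a \<times> Ev L r)) \<in> U" if "c \<in> Obj (prod_cat A R)" for c
      using that U_times A.Ev_U[OF K] R.Ev_U[OF L] by auto
  qed (use A.Act_in[OF K] R.Act_in[OF L] A.Act_id[OF K] R.Act_id[OF L] A.Act_cmp[OF K] R.Act_cmp[OF L] in auto)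
  finally show ?thesis .
qed

lemma Cpt_ext_prod: "t \<in> hom A.B K K' \<Longrightarrow> a \<in> Obj A \<Longrightarrow> r \<in> Obj R \<Longrightarrow> x \<in> Ev K a \<Longrightarrow> y \<in> Ev L r \<Longrightarrow>
    Cpt (Far (ext_prod A R L) t) (a, r) (vpair (x, y)) = vpair (Cpt t a x, y)"
  by (simp add: ext_prod_def A.homB_iff)

lemma ext_prod_hom:
  assumes L: "presheaf U R L" and t: "t \<in> hom A.B K K'"
  shows "Far (ext_prod A R L) t \<in> hom AR.B (ext_prod_obj A R L K) (ext_prod_obj A R L K')"
proof -
  note K = A.homB_presheaf[OF t]
  have st: "Src t = K" "Tgt t = K'" using t A.homB_iff by auto
  have "Far (ext_prod A R L) t = mk_trans (prod_cat A R) (ext_prod_obj A R L K) (ext_prod_obj A R L K')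
      (\<lambda>(a, r) z. vpair (map_prod (Cpt t a) id (inv vpair z)))"
    unfolding ext_prod_def mk_trans_def st prod_cat_def by (auto simp: fun_eq_iff restrict_def Ev_ext_prod st)
  also have "\<dots> \<in> hom AR.B (ext_prod_obj A R L K) (ext_prod_obj A R L K')"
    by (rule AR.mk_trans_hom[OF ext_prod_presheaf[OF L K(1)] ext_prod_presheaf[OF L K(2)]])
      (use A.base_arr R.base_arr A.Cpt_in[OF t] A.Cpt_nat[OF t] A.Act_in[OF K(1)] in \<open>auto simp: Ev_ext_prod Act_ext_prod\<close>)
  finally show ?thesis .
qed

end

text \<open>
  Both the diagonal functor and the evaluations \<open>X \<mapsto> X\<^sub>r\<close> are cellular. Evaluations give the comparison
  of latching objects that the argument for the diagonal functor starts from.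
\<close>

locale cellular_functor = cisinski_setting U A R cof we
  for U :: "'v set set" and A :: "('a, 'b) cat" and R :: "('r, 's) cat" and cof we +
  fixes \<Phi> :: "(('a \<times> 'r, 'b \<times> 's, 'v) presh, ('a \<times> 'r, 'b \<times> 's, 'v) nat_trans,
                ('a, 'b, 'v) presh, ('a, 'b, 'v) nat_trans) func"
  assumes \<Phi>_hom: "t \<in> hom AR.B X Y \<Longrightarrow> Far \<Phi> t \<in> hom A.B (Fob \<Phi> X) (Fob \<Phi> Y)"
    and \<Phi>_comp: "t \<in> hom AR.B X Y \<Longrightarrow> s \<in> hom AR.B Y Z \<Longrightarrow> Far \<Phi> (s \<cdot>\<^bsub>AR.B\<^esub> t) = Far \<Phi> s \<cdot>\<^bsub>A.B\<^esub> Far \<Phi> t"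
    and \<Phi>_cof: "t \<in> hom AR.B X Y \<Longrightarrow> (\<And>c. c \<in> Obj (prod_cat A R) \<Longrightarrow> inj_on (Cpt t c) (Ev X c)) \<Longrightarrow> Far \<Phi> t \<in> cof"
    and \<Phi>_po: "AR.ptwise_po P Q F G i g g' i' \<Longrightarrow>
      A.psh.po (Fob \<Phi> P) (Fob \<Phi> Q) (Fob \<Phi> F) (Fob \<Phi> G) (Far \<Phi> i) (Far \<Phi> g) (Far \<Phi> g') (Far \<Phi> i')"
    and \<Phi>_coproduct: "I \<in> U \<Longrightarrow> (\<And>i. i \<in> I \<Longrightarrow> presheaf U (prod_cat A R) (W i)) \<Longrightarrow> AR.ptwise_coproduct I W V \<kappa> \<Longrightarrow>
      is_coproduct A.B I (\<lambda>i. Fob \<Phi> (W i)) (Fob \<Phi> V) (\<lambda>i. Far \<Phi> (\<kappa> i))"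
    and \<Phi>_ext_prod: "presheaf U R L \<Longrightarrow> w \<in> we \<Longrightarrow> Far \<Phi> (Far (ext_prod A R L) w) \<in> we"
begin

lemma copr_we:
  assumes I: "I \<in> U" and t: "\<And>i. i \<in> I \<Longrightarrow> t i \<in> hom AR.B (X i) (Y i)" and we: "\<And>i. i \<in> I \<Longrightarrow> Far \<Phi> (t i) \<in> we"
    and T: "T \<in> hom AR.B (AR.copr I X) (AR.copr I Y)"
    and eq: "\<And>c i x. c \<in> Obj (prod_cat A R) \<Longrightarrow> i \<in> I \<Longrightarrow> x \<in> Ev (X i) c \<Longrightarrow> Cpt T c (vpair (i, x)) = vpair (i, Cpt (t i) c x)"
  shows "Far \<Phi> T \<in> we"
proof -
  have X: "presheaf U (prod_cat A R) (X i)" and Y: "presheaf U (prod_cat A R) (Y i)" if "i \<in> I" for i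
    using AR.homB_presheaf[OF t[OF that]] by auto
  show ?thesis
  proof (rule H.coproduct_we[OF I _ we \<Phi>_coproduct[OF I X AR.ptwise_coproduct_copr[OF I X]]
        \<Phi>_coproduct[OF I Y AR.ptwise_coproduct_copr[OF I Y]] \<Phi>_hom[OF T]])
    show "Far \<Phi> (t i) \<in> hom A.B (Fob \<Phi> (X i)) (Fob \<Phi> (Y i))" if "i \<in> I" for i using \<Phi>_hom[OF t[OF that]] .
    fix i assume i: "i \<in> I"
    have hx: "AR.copr_in I X i \<in> hom AR.B (X i) (AR.copr I X)" and hy: "AR.copr_in I Y i \<in> hom AR.B (Y i) (AR.copr I Y)"
      using AR.copr_in_hom[OF I] X Y i by blast+
    have "T \<cdot>\<^bsub>AR.B\<^esub> AR.copr_in I X i = AR.copr_in I Y i \<cdot>\<^bsub>AR.B\<^esub> t i"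
    proof (rule AR.homB_eqI[OF AR.B_comp_hom[OF hx T] AR.B_comp_hom[OF t[OF i] hy]])
      fix c x assume cx: "c \<in> Obj (prod_cat A R)" "x \<in> Ev (X i) c"
      then show "Cpt (T \<cdot>\<^bsub>AR.B\<^esub> AR.copr_in I X i) c x = Cpt (AR.copr_in I Y i \<cdot>\<^bsub>AR.B\<^esub> t i) c x"
        using AR.Cpt_cmp[OF hx cx] AR.Cpt_cmp[OF t[OF i] cx] eq[OF cx(1) i cx(2)] AR.Cpt_in[OF t[OF i] cx]
        unfolding AR.copr_in_def by simp
    qed
    then show "Far \<Phi> T \<cdot>\<^bsub>A.B\<^esub> Far \<Phi> (AR.copr_in I X i) = Far \<Phi> (AR.copr_in I Y i) \<cdot>\<^bsub>A.B\<^esub> Far \<Phi> (t i)"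
      using \<Phi>_comp[OF hx T] \<Phi>_comp[OF t[OF i] hy] by simp
  qed auto
qed

end

context cisinski_setting begin

lemma cellular_diagonal:
  assumes d: "diagonal_functor U A R we d"
  shows "cellular_functor U A R cof we d"
proof -
  have F: "is_functor AR.B A.B d" and P: "preserves_colimits U AR.B A.B d"
    and M: "preserves_monos AR.B A.B d" and W: "\<And>K w. K \<in> Obj R.B \<Longrightarrow> w \<in> we \<Longrightarrow> Far (comp_func d (ext_prod A R K)) w \<in> we"
    using d unfolding diagonal_functor_def by auto
  interpret D: colimit_functor U AR.B A.B d by unfold_locales (rule F, rule P)
  show ?thesis
  proof unfold_locales
    show "Far d t \<in> hom A.B (Fob d X) (Fob d Y)" if "t \<in> hom AR.B X Y" for t X Y using D.F_hom[OF that] .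
    show "Far d (s \<cdot>\<^bsub>AR.B\<^esub> t) = Far d s \<cdot>\<^bsub>A.B\<^esub> Far d t" if "t \<in> hom AR.B X Y" "s \<in> hom AR.B Y Z" for s t X Y Z
      using D.F_comp[OF that] .
    show "Far d t \<in> cof" if "t \<in> hom AR.B X Y" "\<And>c. c \<in> Obj (prod_cat A R) \<Longrightarrow> inj_on (Cpt t c) (Ev X c)" for t X Y
      using AR.injective_mono[OF that] M unfolding preserves_monos_def cof_mono by blast
    show "A.psh.po (Fob d P) (Fob d Q) (Fob d F) (Fob d G) (Far d i) (Far d g) (Far d g') (Far d i')"
      if "AR.ptwise_po P Q F G i g g' i'" for P Q F G i g g' i'
      using D.preserves_po[OF AR.ptwise_po_po[OF that]] .
    show "is_coproduct A.B I (\<lambda>i. Fob d (Z i)) (Fob d Y) (\<lambda>i. Far d (\<kappa> i))"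
      if "I \<in> U" "\<And>i. i \<in> I \<Longrightarrow> presheaf U (prod_cat A R) (Z i)" "AR.ptwise_coproduct I Z Y \<kappa>" for I Z Y \<kappa>
      by (rule D.preserves_coproduct[OF that(1) _ AR.ptwise_coproduct_coproduct[OF that(3)]]) (use that(2) AR.Obj_B in blast)
    show "Far d (Far (ext_prod A R L) w) \<in> we" if "presheaf U R L" "w \<in> we" for L w
      using W[of L w] that R.Obj_B by (simp add: comp_func_def)
  qed
qed

definition slice_func :: "'r \<Rightarrow> (('a \<times> 'r, 'b \<times> 's, 'v) presh, ('a \<times> 'r, 'b \<times> 's, 'v) nat_trans, ('a, 'b, 'v) presh, ('a, 'b, 'v) nat_trans) func" where
  "slice_func r = \<lparr>Fob = (\<lambda>X. slice_obj A R X r), Far = (\<lambda>t. slice_map A R t r)\<rparr>"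

text \<open>Injections, attaching squares and disjoint unions are pointwise notions, so they survive
  evaluation at \<open>r\<close>. The real point is the external product: its value at
  \<open>r\<close> is a coproduct of copies of the first factor, indexed by the elements of
  \<open>L\<close> at \<open>r\<close>, and \<open>coproduct_we\<close> applies.\<close>

lemma cellular_slice:
  assumes r: "r \<in> Obj R"
  shows "cellular_functor U A R cof we (slice_func r)"
proof unfold_locales
  show "Far (slice_func r) t \<in> hom A.B (Fob (slice_func r) X) (Fob (slice_func r) Y)" if "t \<in> hom AR.B X Y" for t X Y
    using slice_hom[OF that r] by (simp add: slice_func_def)
  show "Far (slice_func r) (s \<cdot>\<^bsub>AR.B\<^esub> t) = Far (slice_func r) s \<cdot>\<^bsub>A.B\<^esub> Far (slice_func r) t"
    if "t \<in> hom AR.B X Y" "s \<in> hom AR.B Y Z" for s t X Y Z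
    using slice_comp[OF that r] by (simp add: slice_func_def)
  show "Far (slice_func r) t \<in> cof"
    if "t \<in> hom AR.B X Y" and inj: "\<And>c. c \<in> Obj (prod_cat A R) \<Longrightarrow> inj_on (Cpt t c) (Ev X c)" for t X Y
    using injective_cof[OF slice_hom[OF that(1) r]] inj r by (simp add: slice_func_def)
  show "A.psh.po (Fob (slice_func r) P) (Fob (slice_func r) Q) (Fob (slice_func r) F) (Fob (slice_func r) G)
     (Far (slice_func r) i) (Far (slice_func r) g) (Far (slice_func r) g') (Far (slice_func r) i')"
    if p: "AR.ptwise_po P Q F G i g g' i'" for P Q F G i g g' i'
  proof -
    have "A.ptwise_po (slice_obj A R P r) (slice_obj A R Q r) (slice_obj A R F r) (slice_obj A R G r)
       (slice_map A R i r) (slice_map A R g r) (slice_map A R g' r) (slice_map A R i' r)"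
      using p r unfolding AR.ptwise_po_def A.ptwise_po_def by (simp add: slice_hom)
    then show ?thesis using A.ptwise_po_po by (simp add: slice_func_def)
  qed
  show "is_coproduct A.B I (\<lambda>i. Fob (slice_func r) (Z i)) (Fob (slice_func r) Y) (\<lambda>i. Far (slice_func r) (\<kappa> i))"
    if p: "AR.ptwise_coproduct I Z Y \<kappa>" for I Z Y \<kappa>
  proof -
    have "A.ptwise_coproduct I (\<lambda>i. slice_obj A R (Z i) r) (slice_obj A R Y r) (\<lambda>i. slice_map A R (\<kappa> i) r)"
      using p r unfolding AR.ptwise_coproduct_def A.ptwise_coproduct_def by (simp add: slice_hom slice_presheaf)
    then show ?thesis using A.ptwise_coproduct_coproduct by (simp add: slice_func_def)
  qed
  show "Far (slice_func r) (Far (ext_prod A R L) w) \<in> we" if L: "presheaf U R L" and w: "w \<in> we" for L w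
  proof -
    have wh: "w \<in> hom A.B (Src w) (Tgt w)" using H.we_arr[OF w] A.Arr_B by blast
    note eh = ext_prod_hom[OF L wh]
    note K = A.homB_presheaf[OF wh]
    define \<kappa> where "\<kappa> K k = mk_trans A K (slice_obj A R (ext_prod_obj A R L K) r) (\<lambda>_ x. vpair (x, k))" for K k
    have kh: "\<kappa> K k \<in> hom A.B K (slice_obj A R (ext_prod_obj A R L K) r)"
      if "presheaf U A K" "k \<in> Ev L r" for K k unfolding \<kappa>_def
      by (rule A.mk_trans_hom[OF that(1) slice_presheaf[OF ext_prod_presheaf[OF L that(1)] r]])
        (use A.base_arr that(2) r R.base_id[OF r] R.Act_id[OF L r] in \<open>auto simp: Ev_ext_prod Act_ext_prod\<close>)
    have cp: "A.ptwise_coproduct (Ev L r) (\<lambda>_. K) (slice_obj A R (ext_prod_obj A R L K) r) (\<kappa> K)"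
      if K: "presheaf U A K" for K
      unfolding A.ptwise_coproduct_def
    proof (intro conjI ballI impI)
      show "presheaf U A (slice_obj A R (ext_prod_obj A R L K) r)" by (rule slice_presheaf[OF ext_prod_presheaf[OF L K] r])
      show "\<kappa> K k \<in> hom A.B K (slice_obj A R (ext_prod_obj A R L K) r)" if "k \<in> Ev L r" for k by (rule kh[OF K that])
      fix a assume a: "a \<in> Obj A"
      have im: "Cpt (\<kappa> K k) a ` Ev K a = (\<lambda>x. vpair (x, k)) ` Ev K a" for k
        by (rule image_cong) (use a in \<open>auto simp: \<kappa>_def\<close>)
      show "inj_on (Cpt (\<kappa> K k) a) (Ev K a)" for k
        by (rule inj_onI) (use a in \<open>simp add: \<kappa>_def\<close>)
      show "Cpt (\<kappa> K i) a ` Ev K a \<inter> Cpt (\<kappa> K j) a ` Ev K a = {}" if "i \<noteq> j" for i j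
        unfolding im using that by auto
      show "Ev (slice_obj A R (ext_prod_obj A R L K) r) a \<subseteq> (\<Union>i\<in>Ev L r. Cpt (\<kappa> K i) a ` Ev K a)"
        unfolding im using a r by (auto simp: Ev_ext_prod)
    qed
    have "slice_map A R (Far (ext_prod A R L) w) r \<in> we"
    proof (rule H.coproduct_we[OF R.Ev_U[OF L r] wh w A.ptwise_coproduct_coproduct[OF cp[OF K(1)]]
        A.ptwise_coproduct_coproduct[OF cp[OF K(2)]] slice_hom[OF eh r]])
      fix k assume k: "k \<in> Ev L r"
      show "slice_map A R (Far (ext_prod A R L) w) r \<cdot>\<^bsub>A.B\<^esub> \<kappa> (Src w) k = \<kappa> (Tgt w) k \<cdot>\<^bsub>A.B\<^esub> w"
      proof (rule A.homB_eqI[OF A.B_comp_hom[OF kh[OF K(1) k] slice_hom[OF eh r]] A.B_comp_hom[OF wh kh[OF K(2) k]]])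
        fix a x assume ax: "a \<in> Obj A" "x \<in> Ev (Src w) a"
        then show "Cpt (slice_map A R (Far (ext_prod A R L) w) r \<cdot>\<^bsub>A.B\<^esub> \<kappa> (Src w) k) a x = Cpt (\<kappa> (Tgt w) k \<cdot>\<^bsub>A.B\<^esub> w) a x"
          using A.Cpt_cmp[OF kh[OF K(1) k] ax] A.Cpt_cmp[OF wh ax] A.Cpt_in[OF wh ax] k r Cpt_ext_prod[OF wh ax(1) r ax(2) k]
          by (simp add: \<kappa>_def)
      qed
    qed
    then show ?thesis by (simp add: slice_func_def)
  qed
qed

end

section \<open>The Eilenberg-Zilber property of Reedy cofibrant diagrams\<close>

section \<open>Unique decomposition into nondegenerate elements\<close>

text \<open>Presheaves take values in subsets of \<open>'v\<close>, whereas normal forms and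
  representables involve arrows of \<open>R\<close>; \<open>enc\<close> names these arrows by
  elements of \<open>'v\<close>.\<close>

locale reedy_setting = cisinski_setting U A R cof we
  for U :: "'v set set" and A :: "('a, 'b) cat" and R :: "('r, 's) cat" and cof we +
  fixes deg Rm Rp and enc :: "'s \<Rightarrow> 'v"
  assumes reedy: "reedy_category R deg Rm Rp"
    and enc_inj: "inj_on enc (Arr R)" and enc_U: "enc ` Arr R \<in> U"
begin

definition dec where "dec = inv_into (Arr R) enc"

lemma dec_enc [simp]: "\<phi> \<in> Arr R \<Longrightarrow> dec (enc \<phi>) = \<phi>"
  unfolding dec_def using enc_inj by simp

lemma reedy_facts:
  shows Rm_wide: "wide_subcategory R Rm" and Rp_wide: "wide_subcategory R Rp"
    and Rm_deg': "\<forall>f\<in>Rm. f \<noteq> Idt R (Dom R f) \<longrightarrow> deg (Dom R f) > deg (Cod R f)"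
    and Rp_deg': "\<forall>f\<in>Rp. f \<noteq> Idt R (Dom R f) \<longrightarrow> deg (Dom R f) < deg (Cod R f)"
    and factor': "\<forall>f\<in>Arr R. \<exists>!(p, m). p \<in> Rp \<and> m \<in> Rm \<and> Cod R m = Dom R p \<and> p \<cdot>\<^bsub>R\<^esub> m = f"
  using reedy unfolding reedy_category_def by auto

lemma Rm_arr: "\<sigma> \<in> Rm \<Longrightarrow> \<sigma> \<in> Arr R" and Rp_arr: "\<sigma> \<in> Rp \<Longrightarrow> \<sigma> \<in> Arr R"
  and Rm_id: "r \<in> Obj R \<Longrightarrow> Idt R r \<in> Rm"
  and Rm_cmp: "\<sigma> \<in> Rm \<Longrightarrow> \<tau> \<in> Rm \<Longrightarrow> Cod R \<sigma> = Dom R \<tau> \<Longrightarrow> \<tau> \<cdot>\<^bsub>R\<^esub> \<sigma> \<in> Rm"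
  using Rm_wide Rp_wide unfolding wide_subcategory_def by auto

lemma Rm_deg: "\<sigma> \<in> Rm \<Longrightarrow> \<sigma> \<noteq> Idt R (Dom R \<sigma>) \<Longrightarrow> deg (Cod R \<sigma>) < deg (Dom R \<sigma>)"
  and Rp_deg: "\<sigma> \<in> Rp \<Longrightarrow> \<sigma> \<noteq> Idt R (Dom R \<sigma>) \<Longrightarrow> deg (Dom R \<sigma>) < deg (Cod R \<sigma>)"
  using Rm_deg' Rp_deg' by auto

lemma Rm_deg_le: "\<sigma> \<in> Rm \<Longrightarrow> deg (Cod R \<sigma>) \<le> deg (Dom R \<sigma>)"
  using Rm_deg[of \<sigma>] R.base_id(3)[of "Dom R \<sigma>"] R.base_arr[OF Rm_arr, of \<sigma>]
  by (cases "\<sigma> = Idt R (Dom R \<sigma>)") (metis order_refl, simp)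

lemma Rp_deg_le: "\<sigma> \<in> Rp \<Longrightarrow> deg (Dom R \<sigma>) \<le> deg (Cod R \<sigma>)"
  using Rp_deg[of \<sigma>] R.base_id(3)[of "Dom R \<sigma>"] R.base_arr[OF Rp_arr, of \<sigma>]
  by (cases "\<sigma> = Idt R (Dom R \<sigma>)") (metis order_refl, simp)

lemma factor:
  assumes "\<phi> \<in> Arr R"
  obtains p m where "p \<in> Rp" "m \<in> Rm" "Cod R m = Dom R p" "p \<cdot>\<^bsub>R\<^esub> m = \<phi>" "Dom R m = Dom R \<phi>" "Cod R p = Cod R \<phi>"
proof -
  obtain p m where pm: "p \<in> Rp" "m \<in> Rm" "Cod R m = Dom R p" "p \<cdot>\<^bsub>R\<^esub> m = \<phi>"
    using factor' assms by (auto dest!: ex1_implies_ex bspec[of "Arr R" _ \<phi>])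
  moreover have "Dom R m = Dom R \<phi>" "Cod R p = Cod R \<phi>"
    using R.base_cmp[OF Rm_arr[OF pm(2)] Rp_arr[OF pm(1)] pm(3)] pm(4) by auto
  ultimately show ?thesis using that by blast
qed

lemma R_assoc: "f \<in> Arr R \<Longrightarrow> g \<in> Arr R \<Longrightarrow> h \<in> Arr R \<Longrightarrow> Cod R f = Dom R g \<Longrightarrow> Cod R g = Dom R h \<Longrightarrow>
    (h \<cdot>\<^bsub>R\<^esub> g) \<cdot>\<^bsub>R\<^esub> f = h \<cdot>\<^bsub>R\<^esub> (g \<cdot>\<^bsub>R\<^esub> f)"
  using R.base.category unfolding category_def by blast

lemma R_id_left: "f \<in> Arr R \<Longrightarrow> Idt R (Cod R f) \<cdot>\<^bsub>R\<^esub> f = f"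
  and R_id_right: "f \<in> Arr R \<Longrightarrow> f \<cdot>\<^bsub>R\<^esub> Idt R (Dom R f) = f"
  using R.base.category unfolding category_def by blast+

lemma A_id_left: "f \<in> Arr A \<Longrightarrow> Idt A (Cod A f) \<cdot>\<^bsub>A\<^esub> f = f"
  and A_id_right: "f \<in> Arr A \<Longrightarrow> f \<cdot>\<^bsub>A\<^esub> Idt A (Dom A f) = f"
  using A.base.category unfolding category_def by blast+

abbreviation "reedy_cof X \<equiv> reedy_cofibrant R Rm (psh U A) cof (diagram A R X)"

text \<open>An arrow of the product acts in two commuting directions, see
  \<open>Act_factors\<close>. Degrees and degeneracy concern only the \<open>R\<close> direction;
  the \<open>A\<close> direction is carried along.\<close>

definition act_R :: "('a \<times> 'r, 'b \<times> 's, 'v) presh \<Rightarrow> 'a \<Rightarrow> 's \<Rightarrow> 'v \<Rightarrow> 'v" where "act_R X a \<phi> = Act X (Idt A a, \<phi>)"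

definition act_A :: "('a \<times> 'r, 'b \<times> 's, 'v) presh \<Rightarrow> 'b \<Rightarrow> 'r \<Rightarrow> 'v \<Rightarrow> 'v" where "act_A X u r = Act X (u, Idt R r)"

lemma act_R_in: "presheaf U (prod_cat A R) X \<Longrightarrow> a \<in> Obj A \<Longrightarrow> \<phi> \<in> Arr R \<Longrightarrow> x \<in> Ev X (a, Cod R \<phi>) \<Longrightarrow>
    act_R X a \<phi> x \<in> Ev X (a, Dom R \<phi>)"
  using AR.Act_in[of X "(Idt A a, \<phi>)" x] A.base_id[of a] by (simp add: act_R_def)

lemma act_A_in: "presheaf U (prod_cat A R) X \<Longrightarrow> u \<in> Arr A \<Longrightarrow> r \<in> Obj R \<Longrightarrow> x \<in> Ev X (Cod A u, r) \<Longrightarrow>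
    act_A X u r x \<in> Ev X (Dom A u, r)"
  using AR.Act_in[of X "(u, Idt R r)" x] R.base_id[of r] by (simp add: act_A_def)

lemma act_R_id: "presheaf U (prod_cat A R) X \<Longrightarrow> a \<in> Obj A \<Longrightarrow> r \<in> Obj R \<Longrightarrow> x \<in> Ev X (a, r) \<Longrightarrow> act_R X a (Idt R r) x = x"
  and act_A_id: "presheaf U (prod_cat A R) X \<Longrightarrow> a \<in> Obj A \<Longrightarrow> r \<in> Obj R \<Longrightarrow> x \<in> Ev X (a, r) \<Longrightarrow> act_A X (Idt A a) r x = x"
  using AR.Act_id[of X "(a, r)" x] by (simp_all add: act_R_def act_A_def)

lemma act_R_cmp: "presheaf U (prod_cat A R) X \<Longrightarrow> a \<in> Obj A \<Longrightarrow> \<phi> \<in> Arr R \<Longrightarrow> \<psi> \<in> Arr R \<Longrightarrow> Cod R \<phi> = Dom R \<psi> \<Longrightarrow>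
    x \<in> Ev X (a, Cod R \<psi>) \<Longrightarrow> act_R X a (\<psi> \<cdot>\<^bsub>R\<^esub> \<phi>) x = act_R X a \<phi> (act_R X a \<psi> x)"
  using AR.Act_cmp[of X "(Idt A a, \<phi>)" "(Idt A a, \<psi>)" x] A.base_id[of a] A_id_left[of "Idt A a"]
  by (simp add: act_R_def)

lemma act_A_cmp: "presheaf U (prod_cat A R) X \<Longrightarrow> r \<in> Obj R \<Longrightarrow> u \<in> Arr A \<Longrightarrow> v \<in> Arr A \<Longrightarrow> Cod A u = Dom A v \<Longrightarrow>
    x \<in> Ev X (Cod A v, r) \<Longrightarrow> act_A X (v \<cdot>\<^bsub>A\<^esub> u) r x = act_A X u r (act_A X v r x)"
  using AR.Act_cmp[of X "(u, Idt R r)" "(v, Idt R r)" x] R.base_id[of r] R_id_left[of "Idt R r"]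
  by (simp add: act_A_def)

lemma Act_factors:
  assumes X: "presheaf U (prod_cat A R) X" and u: "u \<in> Arr A" and p: "\<phi> \<in> Arr R" and x: "x \<in> Ev X (Cod A u, Cod R \<phi>)"
  shows "Act X (u, \<phi>) x = act_R X (Dom A u) \<phi> (act_A X u (Cod R \<phi>) x)"
    and "Act X (u, \<phi>) x = act_A X u (Dom R \<phi>) (act_R X (Cod A u) \<phi> x)"
proof -
  note o = A.base_arr[OF u] R.base_arr[OF p]
  show "Act X (u, \<phi>) x = act_R X (Dom A u) \<phi> (act_A X u (Cod R \<phi>) x)"
    using AR.Act_cmp[OF X, of "(Idt A (Dom A u), \<phi>)" "(u, Idt R (Cod R \<phi>))" x] u p x o A.base_id R.base_id
      A_id_right[OF u] R_id_left[OF p] by (simp add: act_R_def act_A_def)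
  show "Act X (u, \<phi>) x = act_A X u (Dom R \<phi>) (act_R X (Cod A u) \<phi> x)"
    using AR.Act_cmp[OF X, of "(u, Idt R (Dom R \<phi>))" "(Idt A (Cod A u), \<phi>)" x] u p x o A.base_id R.base_id
      A_id_left[OF u] R_id_right[OF p] by (simp add: act_R_def act_A_def)
qed

lemma diagram_hom:
  assumes X: "presheaf U (prod_cat A R) X" and p: "\<phi> \<in> Arr R"
  shows "Far (diagram A R X) \<phi> \<in> hom A.B (slice_obj A R X (Cod R \<phi>)) (slice_obj A R X (Dom R \<phi>))"
proof -
  note o = R.base_arr[OF p]
  have "Act X \<in> (\<Pi>\<^sub>E f\<in>Arr (prod_cat A R). Ev X (Cod (prod_cat A R) f) \<rightarrow>\<^sub>E Ev X (Dom (prod_cat A R) f))"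
    using X unfolding presheaf_def by blast
  from PiE_mem[OF this prod_arr[OF _ p]] have 1: "\<And>a. a \<in> Obj A \<Longrightarrow> Act X (Idt A a, \<phi>) \<in> Ev X (a, Cod R \<phi>) \<rightarrow>\<^sub>E Ev X (a, Dom R \<phi>)"
    by (simp add: A.base_id)
  have 2: "Act X (Idt A (Dom A u), \<phi>) (Act X (u, Idt R (Cod R \<phi>)) x) = Act X (u, Idt R (Dom R \<phi>)) (Act X (Idt A (Cod A u), \<phi>) x)"
    if "u \<in> Arr A" "x \<in> Ev X (Cod A u, Cod R \<phi>)" for u x
    using Act_factors[OF X that(1) p that(2)] unfolding act_R_def act_A_def by simp
  show ?thesis
    unfolding A.homB_iff natural_trans_def diagram_def
    using slice_presheaf[OF X o(1)] slice_presheaf[OF X o(2)] 1 2 A.base_arr by auto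
qed

lemma Cpt_diagram: "a \<in> Obj A \<Longrightarrow> Cpt (Far (diagram A R X) \<phi>) a = act_R X a \<phi>"
  by (simp add: diagram_def act_R_def)

lemma natural_act_R: "t \<in> hom AR.B X Y \<Longrightarrow> a \<in> Obj A \<Longrightarrow> \<phi> \<in> Arr R \<Longrightarrow> x \<in> Ev X (a, Cod R \<phi>) \<Longrightarrow>
    Cpt t (a, Dom R \<phi>) (act_R X a \<phi> x) = act_R Y a \<phi> (Cpt t (a, Cod R \<phi>) x)"
  using AR.Cpt_nat[of t X Y "(Idt A a, \<phi>)" x] A.base_id[of a] by (simp add: act_R_def)

text \<open>The skeleton below degree \<open>m\<close>. Arbitrary arrows \<open>\<phi>\<close> are
  allowed, so that stability under the action comes from composition;
  \<open>Fset_decomposition\<close> recovers arrows of \<open>Rm\<close>. The bound is strict: stage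
  \<open>0\<close> is empty, and all elements at \<open>r\<close> are present from stage
  \<open>Suc (deg r)\<close> on.\<close>

definition Fset where
  "Fset X m = (\<lambda>(a, s). {x. \<exists>\<phi>\<in>Arr R. \<exists>y\<in>Ev X (a, Cod R \<phi>). Dom R \<phi> = s \<and> deg (Cod R \<phi>) < m \<and> x = act_R X a \<phi> y})"

lemma FsetI: "\<phi> \<in> Arr R \<Longrightarrow> y \<in> Ev X (a, Cod R \<phi>) \<Longrightarrow> deg (Cod R \<phi>) < m \<Longrightarrow> act_R X a \<phi> y \<in> Fset X m (a, Dom R \<phi>)"
  unfolding Fset_def by auto

lemma Fset_subset:
  assumes X: "presheaf U (prod_cat A R) X" and a: "a \<in> Obj A"
  shows "Fset X m (a, s) \<subseteq> Ev X (a, s)"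
  unfolding Fset_def using act_R_in[OF X a] by auto

lemma Fset_Act:
  assumes X: "presheaf U (prod_cat A R) X" and u: "u \<in> Arr A" and p: "\<phi> \<in> Arr R" and x: "x \<in> Fset X m (Cod A u, Cod R \<phi>)"
  shows "Act X (u, \<phi>) x \<in> Fset X m (Dom A u, Dom R \<phi>)"
proof -
  note o = A.base_arr[OF u]
  obtain \<psi> y where y: "\<psi> \<in> Arr R" "y \<in> Ev X (Cod A u, Cod R \<psi>)" "Dom R \<psi> = Cod R \<phi>" "deg (Cod R \<psi>) < m" "x = act_R X (Cod A u) \<psi> y"
    using x unfolding Fset_def by auto
  have xX: "x \<in> Ev X (Cod A u, Cod R \<phi>)" using x Fset_subset[OF X o(2)] by blast
  have uy: "act_A X u (Cod R \<psi>) y \<in> Ev X (Dom A u, Cod R \<psi>)" using act_A_in[OF X u R.base_arr(2)[OF y(1)] y(2)] .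
  have "Act X (u, \<phi>) x = act_R X (Dom A u) \<phi> (act_A X u (Dom R \<psi>) (act_R X (Cod A u) \<psi> y))"
    using Act_factors(1)[OF X u p xX] y(3,5) by simp
  also have "\<dots> = act_R X (Dom A u) \<phi> (act_R X (Dom A u) \<psi> (act_A X u (Cod R \<psi>) y))"
    using Act_factors[OF X u y(1,2)] by simp
  also have "\<dots> = act_R X (Dom A u) (\<psi> \<cdot>\<^bsub>R\<^esub> \<phi>) (act_A X u (Cod R \<psi>) y)"
    using act_R_cmp[OF X o(1) p y(1) _ uy] y(3) by simp
  finally have "Act X (u, \<phi>) x = act_R X (Dom A u) (\<psi> \<cdot>\<^bsub>R\<^esub> \<phi>) (act_A X u (Cod R \<psi>) y)" .
  then show ?thesis
    using FsetI[of "\<psi> \<cdot>\<^bsub>R\<^esub> \<phi>" "act_A X u (Cod R \<psi>) y" X "Dom A u" m] R.base_cmp[OF p y(1)] y(3,4) uy by simp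
qed

definition nondeg where "nondeg X r a = {x \<in> Ev X (a, r). x \<notin> Fset X (deg r) (a, r)}"

text \<open>Split \<open>\<phi>\<close> into \<open>m\<close> in \<open>Rm\<close> followed by
  \<open>p\<close> in \<open>Rp\<close>. The source of \<open>p\<close> has at most the degree of
  its target, so \<open>dec\<close> applies to the restriction of \<open>y\<close> along
  \<open>p\<close>, and \<open>m\<close> is absorbed into the arrow of \<open>Rm\<close>. The bound
  in \<open>dec\<close> lets the lemma serve inside the induction of
  \<open>decomposition_exists\<close> as well as after it.\<close>

lemma decomposition_along:
  assumes X: "presheaf U (prod_cat A R) X" and a: "a \<in> Obj A"
    and f: "\<phi> \<in> Arr R" and y: "y \<in> Ev X (a, Cod R \<phi>)"
    and dec: "\<And>t x. t \<in> Obj R \<Longrightarrow> deg t \<le> deg (Cod R \<phi>) \<Longrightarrow> x \<in> Ev X (a, t) \<Longrightarrow>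
      \<exists>\<sigma> w. \<sigma> \<in> Rm \<and> Dom R \<sigma> = t \<and> w \<in> nondeg X (Cod R \<sigma>) a \<and> x = act_R X a \<sigma> w"
  shows "\<exists>\<sigma> w. \<sigma> \<in> Rm \<and> Dom R \<sigma> = Dom R \<phi> \<and> w \<in> nondeg X (Cod R \<sigma>) a \<and> act_R X a \<phi> y = act_R X a \<sigma> w \<and>
    deg (Cod R \<sigma>) \<le> deg (Cod R \<phi>)"
proof -
  obtain p m where pm: "p \<in> Rp" "m \<in> Rm" "Cod R m = Dom R p" "p \<cdot>\<^bsub>R\<^esub> m = \<phi>" "Dom R m = Dom R \<phi>" "Cod R p = Cod R \<phi>"
    by (rule factor[OF f])
  note pa = Rp_arr[OF pm(1)] and ma = Rm_arr[OF pm(2)]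
  have py: "act_R X a p y \<in> Ev X (a, Dom R p)" using act_R_in[OF X a pa] y pm(6) by simp
  have d: "deg (Dom R p) \<le> deg (Cod R \<phi>)" using Rp_deg_le[OF pm(1)] pm(6) by simp
  obtain \<sigma> w where w: "\<sigma> \<in> Rm" "Dom R \<sigma> = Dom R p" "w \<in> nondeg X (Cod R \<sigma>) a" "act_R X a p y = act_R X a \<sigma> w"
    using dec[OF R.base_arr(1)[OF pa] d py] by blast
  have "act_R X a \<phi> y = act_R X a m (act_R X a p y)" using act_R_cmp[OF X a ma pa pm(3)] y pm(4,6) by simp
  also have "\<dots> = act_R X a (\<sigma> \<cdot>\<^bsub>R\<^esub> m) w"
    using act_R_cmp[OF X a ma Rm_arr[OF w(1)]] w pm(3) by (simp add: nondeg_def)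
  finally have "act_R X a \<phi> y = act_R X a (\<sigma> \<cdot>\<^bsub>R\<^esub> m) w" .
  moreover have "\<sigma> \<cdot>\<^bsub>R\<^esub> m \<in> Rm" using Rm_cmp[OF pm(2) w(1)] w(2) pm(3) by simp
  moreover have "Dom R (\<sigma> \<cdot>\<^bsub>R\<^esub> m) = Dom R \<phi>" "Cod R (\<sigma> \<cdot>\<^bsub>R\<^esub> m) = Cod R \<sigma>"
    using R.base_cmp[OF ma Rm_arr[OF w(1)]] w(2) pm(3,5) by auto
  moreover have "deg (Cod R \<sigma>) \<le> deg (Cod R \<phi>)" using Rm_deg_le[OF w(1)] w(2) d by simp
  ultimately show ?thesis using w(3) by metis
qed

lemma decomposition_exists:
  assumes X: "presheaf U (prod_cat A R) X" and a: "a \<in> Obj A"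
  shows "s \<in> Obj R \<Longrightarrow> x \<in> Ev X (a, s) \<Longrightarrow> \<exists>\<sigma> y. \<sigma> \<in> Rm \<and> Dom R \<sigma> = s \<and> y \<in> nondeg X (Cod R \<sigma>) a \<and> x = act_R X a \<sigma> y"
proof (induction "deg s" arbitrary: s x rule: less_induct)
  case less
  show ?case
  proof (cases "x \<in> Fset X (deg s) (a, s)")
    case False
    then show ?thesis
      using less.prems act_R_id[OF X a less.prems] Rm_id[OF less.prems(1)] R.base_id[OF less.prems(1)]
      by (intro exI[of _ "Idt R s"] exI[of _ x]) (auto simp: nondeg_def)
  next
    case True
    then obtain \<phi> y where y: "\<phi> \<in> Arr R" "y \<in> Ev X (a, Cod R \<phi>)" "Dom R \<phi> = s" "deg (Cod R \<phi>) < deg s" "x = act_R X a \<phi> y"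
      unfolding Fset_def by auto
    from decomposition_along[OF X a y(1,2) less.hyps[OF le_less_trans[OF _ y(4)]]]
    show ?thesis using y(3,5) by blast
  qed
qed

lemma Fset_decomposition:
  assumes X: "presheaf U (prod_cat A R) X" and a: "a \<in> Obj A" and x: "x \<in> Fset X n (a, s)"
  shows "\<exists>\<sigma> y. \<sigma> \<in> Rm \<and> Dom R \<sigma> = s \<and> y \<in> nondeg X (Cod R \<sigma>) a \<and> x = act_R X a \<sigma> y \<and> deg (Cod R \<sigma>) < n"
proof -
  obtain \<phi> y where y: "\<phi> \<in> Arr R" "y \<in> Ev X (a, Cod R \<phi>)" "Dom R \<phi> = s" "deg (Cod R \<phi>) < n" "x = act_R X a \<phi> y"
    using x unfolding Fset_def by auto
  from decomposition_along[OF X a y(1,2) decomposition_exists[OF X a]] obtain \<sigma> w where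
    "\<sigma> \<in> Rm" "Dom R \<sigma> = s" "w \<in> nondeg X (Cod R \<sigma>) a" "x = act_R X a \<sigma> w" "deg (Cod R \<sigma>) \<le> deg (Cod R \<phi>)"
    unfolding y(3,5)[symmetric] by (auto simp: y(3))
  then show ?thesis using y(4) le_less_trans by blast
qed

definition unique_decomposition where
  "unique_decomposition X s \<longleftrightarrow> (\<forall>a\<in>Obj A. \<forall>\<sigma> \<tau> y z. \<sigma> \<in> Rm \<longrightarrow> \<tau> \<in> Rm \<longrightarrow> Dom R \<sigma> = s \<longrightarrow> Dom R \<tau> = s \<longrightarrow>
     y \<in> nondeg X (Cod R \<sigma>) a \<longrightarrow> z \<in> nondeg X (Cod R \<tau>) a \<longrightarrow> act_R X a \<sigma> y = act_R X a \<tau> z \<longrightarrow> \<sigma> = \<tau> \<and> y = z)"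

text \<open>A mere choice; it is canonical at objects where \<open>unique_decomposition\<close>
  holds, see \<open>nf_eq\<close>.\<close>

definition nf where
  "nf X r a y = (SOME p. fst p \<in> Rm \<and> Dom R (fst p) = r \<and> snd p \<in> nondeg X (Cod R (fst p)) a \<and> y = act_R X a (fst p) (snd p))"

lemma nf:
  assumes "presheaf U (prod_cat A R) X" "a \<in> Obj A" "r \<in> Obj R" "y \<in> Ev X (a, r)"
  shows "fst (nf X r a y) \<in> Rm" "Dom R (fst (nf X r a y)) = r"
    "snd (nf X r a y) \<in> nondeg X (Cod R (fst (nf X r a y))) a" "y = act_R X a (fst (nf X r a y)) (snd (nf X r a y))"
proof -
  obtain \<sigma> w where "\<sigma> \<in> Rm \<and> Dom R \<sigma> = r \<and> w \<in> nondeg X (Cod R \<sigma>) a \<and> y = act_R X a \<sigma> w"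
    using decomposition_exists[OF assms] by blast
  then have "fst (nf X r a y) \<in> Rm \<and> Dom R (fst (nf X r a y)) = r \<and>
    snd (nf X r a y) \<in> nondeg X (Cod R (fst (nf X r a y))) a \<and> y = act_R X a (fst (nf X r a y)) (snd (nf X r a y))"
    unfolding nf_def
    using someI[where x = "(\<sigma>, w)" and P = "\<lambda>p. fst p \<in> Rm \<and> Dom R (fst p) = r \<and> snd p \<in> nondeg X (Cod R (fst p)) a \<and>
      y = act_R X a (fst p) (snd p)"] by simp
  then show "fst (nf X r a y) \<in> Rm" "Dom R (fst (nf X r a y)) = r"
    "snd (nf X r a y) \<in> nondeg X (Cod R (fst (nf X r a y))) a" "y = act_R X a (fst (nf X r a y)) (snd (nf X r a y))"
    by blast+
qed

lemma nf_eq: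
  assumes X: "presheaf U (prod_cat A R) X" and un: "unique_decomposition X (Dom R \<rho>)" and a: "a \<in> Obj A"
    and r: "\<rho> \<in> Rm" and w: "w \<in> nondeg X (Cod R \<rho>) a"
  shows "nf X (Dom R \<rho>) a (act_R X a \<rho> w) = (\<rho>, w)"
proof -
  have "act_R X a \<rho> w \<in> Ev X (a, Dom R \<rho>)" using act_R_in[OF X a Rm_arr[OF r]] w by (simp add: nondeg_def)
  note n = nf[OF X a R.base_arr(1)[OF Rm_arr[OF r]] this]
  have "\<rho> = fst (nf X (Dom R \<rho>) a (act_R X a \<rho> w)) \<and> w = snd (nf X (Dom R \<rho>) a (act_R X a \<rho> w))"
    using un[unfolded unique_decomposition_def, rule_format, OF a r n(1) refl n(2) w n(3,4)] .
  then show ?thesis by (metis prod.collapse)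
qed

text \<open>The code of the normal form that \<open>act_R X a \<sigma> y\<close> should have: if
  \<open>y\<close> has normal form \<open>\<rho>\<close>, \<open>w\<close>, it is the pair of
  \<open>\<rho> \<cdot> \<sigma>\<close> and \<open>w\<close>. Only normal forms at
  \<open>Cod R \<sigma>\<close> are used, where uniqueness is available by induction, and none at
  \<open>Dom R \<sigma>\<close>, where it is at stake.\<close>

definition nfenc where
  "nfenc X a \<sigma> y = vpair (enc (fst (nf X (Cod R \<sigma>) a y) \<cdot>\<^bsub>R\<^esub> \<sigma>), snd (nf X (Cod R \<sigma>) a y))"

text \<open>This is the compatibility with arrows of the latching category that makes
  \<open>nfenc\<close> a cocone. Uniqueness at \<open>Cod R \<sigma>\<close> pins down the normal
  form of \<open>act_R X a \<theta> y\<close>.\<close>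

lemma nfenc_act_R:
  assumes X: "presheaf U (prod_cat A R) X" and a: "a \<in> Obj A"
    and s: "\<sigma> \<in> Rm" and t: "\<theta> \<in> Rm" and d: "Dom R \<theta> = Cod R \<sigma>" and un: "unique_decomposition X (Cod R \<sigma>)"
    and y: "y \<in> Ev X (a, Cod R \<theta>)"
  shows "nfenc X a \<sigma> (act_R X a \<theta> y) = nfenc X a (\<theta> \<cdot>\<^bsub>R\<^esub> \<sigma>) y"
proof -
  define \<rho> where "\<rho> = fst (nf X (Cod R \<theta>) a y)"
  define w where "w = snd (nf X (Cod R \<theta>) a y)"
  note n = nf[OF X a R.base_arr(2)[OF Rm_arr[OF t]] y, folded \<rho>_def w_def]
  note arr = Rm_arr[OF s] Rm_arr[OF t] Rm_arr[OF n(1)]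
  have w: "w \<in> Ev X (a, Cod R \<rho>)" using n(3) by (simp add: nondeg_def)
  have rt: "\<rho> \<cdot>\<^bsub>R\<^esub> \<theta> \<in> Rm" "Dom R (\<rho> \<cdot>\<^bsub>R\<^esub> \<theta>) = Cod R \<sigma>" "Cod R (\<rho> \<cdot>\<^bsub>R\<^esub> \<theta>) = Cod R \<rho>"
    using Rm_cmp[OF t n(1)] R.base_cmp[OF arr(2,3)] n(2) d by auto
  have "act_R X a \<theta> y = act_R X a (\<rho> \<cdot>\<^bsub>R\<^esub> \<theta>) w" using act_R_cmp[OF X a arr(2,3) _ w] n(2,4) by simp
  then have "nf X (Cod R \<sigma>) a (act_R X a \<theta> y) = (\<rho> \<cdot>\<^bsub>R\<^esub> \<theta>, w)"
    using nf_eq[OF X _ a rt(1)] un rt n(3) by simp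
  moreover have "Cod R (\<theta> \<cdot>\<^bsub>R\<^esub> \<sigma>) = Cod R \<theta>" using R.base_cmp[OF arr(1,2)] d by simp
  ultimately show ?thesis
    unfolding nfenc_def using R_assoc[OF arr] d n(2) by (simp add: \<rho>_def w_def)
qed

text \<open>The normal forms of the degenerate elements at \<open>s\<close> form a cocone that separates them.\<close>

lemma latching_separates:
  assumes X: "presheaf U (prod_cat A R) X" and rc: "reedy_cof X"
    and s: "s \<in> Obj R" and IH: "\<And>r. r \<in> Obj R \<Longrightarrow> deg r < deg s \<Longrightarrow> unique_decomposition X r"
    and a: "a \<in> Obj A" and st: "\<sigma> \<in> Rm" "\<tau> \<in> Rm" "Dom R \<sigma> = s" "Dom R \<tau> = s" "\<sigma> \<noteq> Idt R s" "\<tau> \<noteq> Idt R s"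
    and y: "y \<in> nondeg X (Cod R \<sigma>) a" and z: "z \<in> nondeg X (Cod R \<tau>) a" and eq: "act_R X a \<sigma> y = act_R X a \<tau> z"
  shows "\<sigma> = \<tau> \<and> y = z"
proof -
  \<comment> \<open>The objects of the latching category at \<open>s\<close>. Their targets have
    smaller degree, so the induction hypothesis covers them.\<close>
  define M where "M = {\<rho> \<in> Rm. Dom R \<rho> = s \<and> \<rho> \<noteq> Idt R s}"
  have M: "\<rho> \<in> Rm" "\<rho> \<in> Arr R" "Dom R \<rho> = s" "deg (Cod R \<rho>) < deg s" "Cod R \<rho> \<in> Obj R" "unique_decomposition X (Cod R \<rho>)" if "\<rho> \<in> M" for \<rho>
    using that Rm_arr Rm_deg[of \<rho>] R.base_arr IH unfolding M_def by auto
  have M_cmp: "\<theta> \<cdot>\<^bsub>R\<^esub> \<rho> \<in> M" if "\<rho> \<in> M" "\<theta> \<in> Rm" "Dom R \<theta> = Cod R \<rho>" for \<rho> \<theta>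
  proof -
    note c = R.base_cmp[OF M(2)[OF that(1)] Rm_arr[OF that(2)] that(3)[symmetric]]
    have "deg (Cod R (\<theta> \<cdot>\<^bsub>R\<^esub> \<rho>)) < deg s" using c Rm_deg_le[OF that(2)] that(3) M(4)[OF that(1)] by simp
    then have "\<theta> \<cdot>\<^bsub>R\<^esub> \<rho> \<noteq> Idt R s" using R.base_id[OF s] by auto
    then show ?thesis unfolding M_def using c M[OF that(1)] Rm_cmp[OF _ that(2)] that(3) by simp
  qed
  \<comment> \<open>The test object \<open>T\<close> consists of formal normal forms, with no
    relation between different pairs. An arrow of \<open>A\<close> can turn a nondegenerate element
    into a degenerate one, so \<open>act\<close> has to renormalize; \<open>N_nat\<close> shows that
    this is consistent.\<close>
  define ev where "ev b = {vpair (enc \<rho>, w) |\<rho> w. \<rho> \<in> M \<and> w \<in> nondeg X (Cod R \<rho>) b}" for b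
  define act where "act u v = nfenc X (Dom A u) (dec (fst (inv vpair v)))
     (act_A X u (Cod R (dec (fst (inv vpair v)))) (snd (inv vpair v)))" for u v
  define T where "T = mk_presheaf A ev act"
  have act: "act u (vpair (enc \<rho>, w)) = nfenc X (Dom A u) \<rho> (act_A X u (Cod R \<rho>) w)" if "\<rho> \<in> M" for u \<rho> w
    unfolding act_def using M[OF that] by simp
  have N_in: "nfenc X b \<rho> w \<in> ev b" if "b \<in> Obj A" "\<rho> \<in> M" "w \<in> Ev X (b, Cod R \<rho>)" for b \<rho> w
  proof -
    note n = nf[OF X that(1) M(5)[OF that(2)] that(3)]
    show ?thesis unfolding nfenc_def ev_def
      using M_cmp[OF that(2) n(1,2)] n(3) R.base_cmp[OF M(2)[OF that(2)] Rm_arr[OF n(1)]] n(2) by auto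
  qed
  have N_nat: "act u (nfenc X (Cod A u) \<rho> w) = nfenc X (Dom A u) \<rho> (act_A X u (Cod R \<rho>) w)"
    if u: "u \<in> Arr A" and r: "\<rho> \<in> M" and w: "w \<in> Ev X (Cod A u, Cod R \<rho>)" for u \<rho> w
  proof -
    note n = nf[OF X A.base_arr(2)[OF u] M(5)[OF r] w]
    define \<theta> where "\<theta> = fst (nf X (Cod R \<rho>) (Cod A u) w)"
    define v where "v = snd (nf X (Cod R \<rho>) (Cod A u) w)"
    note n = n[folded \<theta>_def v_def]
    note ta = Rm_arr[OF n(1)]
    have v: "v \<in> Ev X (Cod A u, Cod R \<theta>)" using n(3) by (simp add: nondeg_def)
    have uv: "act_A X u (Cod R \<theta>) v \<in> Ev X (Dom A u, Cod R \<theta>)" using act_A_in[OF X u R.base_arr(2)[OF ta] v] .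
    have "act u (nfenc X (Cod A u) \<rho> w) = act u (vpair (enc (\<theta> \<cdot>\<^bsub>R\<^esub> \<rho>), v))"
      unfolding nfenc_def \<theta>_def v_def by simp
    also have "\<dots> = nfenc X (Dom A u) (\<theta> \<cdot>\<^bsub>R\<^esub> \<rho>) (act_A X u (Cod R \<theta>) v)"
      using act[OF M_cmp[OF r n(1,2)]] R.base_cmp[OF M(2)[OF r] ta] n(2) by simp
    also have "\<dots> = nfenc X (Dom A u) \<rho> (act_R X (Dom A u) \<theta> (act_A X u (Cod R \<theta>) v))"
      using nfenc_act_R[OF X A.base_arr(1)[OF u] M(1)[OF r] n(1,2) M(6)[OF r] uv] by simp
    also have "act_R X (Dom A u) \<theta> (act_A X u (Cod R \<theta>) v) = act_A X u (Cod R \<rho>) w"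
      using Act_factors[OF X u ta v] n(2,4) by simp
    finally show ?thesis .
  qed
  have act_A_X: "act_A X u (Cod R \<rho>) w \<in> Ev X (Dom A u, Cod R \<rho>)"
    if "u \<in> Arr A" "\<rho> \<in> M" "w \<in> Ev X (Cod A u, Cod R \<rho>)" for u \<rho> w
    using act_A_in[OF X that(1) M(5)[OF that(2)] that(3)] .
  have T: "presheaf U A T" unfolding T_def
  proof (rule A.presheaf_mk_presheaf)
    fix b assume b: "b \<in> Obj A"
    have "enc ` M \<in> U" by (rule U_subset[OF enc_U]) (use M in auto)
    then have "(\<Union>k\<in>enc ` M. Ev X (b, Cod R (dec k))) \<in> U"
      by (rule U_UN) (use AR.Ev_U[OF X] b M in auto)
    from U_subset[OF U_times[OF \<open>enc ` M \<in> U\<close> this], of "ev b"] show "ev b \<in> U"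
      using M by (force simp: ev_def nondeg_def)
  next
    fix u v assume u: "u \<in> Arr A" and "v \<in> ev (Cod A u)"
    then obtain \<rho> w where v: "v = vpair (enc \<rho>, w)" "\<rho> \<in> M" "w \<in> Ev X (Cod A u, Cod R \<rho>)"
      unfolding ev_def nondeg_def by auto
    then show "act u v \<in> ev (Dom A u)" using act N_in[OF A.base_arr(1)[OF u] v(2) act_A_X[OF u v(2,3)]] by simp
  next
    fix b v assume b: "b \<in> Obj A" and "v \<in> ev b"
    then obtain \<rho> w where v: "v = vpair (enc \<rho>, w)" "\<rho> \<in> M" and w: "w \<in> nondeg X (Cod R \<rho>) b"
      unfolding ev_def by auto
    have wX: "w \<in> Ev X (b, Cod R \<rho>)" using w by (simp add: nondeg_def)
    note o = M(5)[OF v(2)]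
    have "nf X (Cod R \<rho>) b w = (Idt R (Cod R \<rho>), w)"
      using nf_eq[OF X _ b Rm_id[OF o], of w] R.base_id[OF o] w M(6)[OF v(2)] act_R_id[OF X b o wX] by simp
    then show "act (Idt A b) v = v"
      using act[OF v(2)] v(1) act_A_id[OF X b o wX] A.base_id[OF b] R_id_left[OF M(2)[OF v(2)]] by (simp add: nfenc_def)
  next
    fix u u' v assume u: "u \<in> Arr A" "u' \<in> Arr A" "Cod A u = Dom A u'" and "v \<in> ev (Cod A u')"
    then obtain \<rho> w where v: "v = vpair (enc \<rho>, w)" "\<rho> \<in> M" "w \<in> Ev X (Cod A u', Cod R \<rho>)"
      unfolding ev_def nondeg_def by auto
    note o = M(5)[OF v(2)]
    have "act (u' \<cdot>\<^bsub>A\<^esub> u) v = nfenc X (Dom A u) \<rho> (act_A X u (Cod R \<rho>) (act_A X u' (Cod R \<rho>) w))"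
      using act[OF v(2)] v(1) act_A_cmp[OF X o u v(3)] A.base_cmp[OF u] by simp
    also have "\<dots> = act u (nfenc X (Cod A u) \<rho> (act_A X u' (Cod R \<rho>) w))"
      using N_nat[OF u(1) v(2)] act_A_X[OF u(2) v(2,3)] u(3) by simp
    also have "\<dots> = act u (act u' v)" using act[OF v(2)] v(1) u(3) by simp
    finally show "act (u' \<cdot>\<^bsub>A\<^esub> u) v = act u (act u' v)" .
  qed
  define \<kappa> where "\<kappa> \<rho> = mk_trans A (slice_obj A R X (Cod R \<rho>)) T (\<lambda>b w. nfenc X b \<rho> w)" for \<rho>
  have kh: "\<kappa> \<rho> \<in> hom A.B (slice_obj A R X (Cod R \<rho>)) T" if r: "\<rho> \<in> M" for \<rho>
    unfolding \<kappa>_def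
  proof (rule A.mk_trans_hom[OF slice_presheaf[OF X M(5)[OF r]] T])
    show "nfenc X b \<rho> w \<in> Ev T b" if "b \<in> Obj A" "w \<in> Ev (slice_obj A R X (Cod R \<rho>)) b" for b w
      using N_in[OF that(1) r] that unfolding T_def by simp
    fix u w assume u: "u \<in> Arr A" and "w \<in> Ev (slice_obj A R X (Cod R \<rho>)) (Cod A u)"
    then have w: "w \<in> Ev X (Cod A u, Cod R \<rho>)" using A.base_arr by simp
    show "nfenc X (Dom A u) \<rho> (Act (slice_obj A R X (Cod R \<rho>)) u w) = Act T u (nfenc X (Cod A u) \<rho> w)"
      using N_nat[OF u r w] N_in[OF A.base_arr(2)[OF u] r w] u unfolding T_def by (simp add: act_A_def)
  qed
  obtain L \<iota> h where L: "is_latching_object R Rm (psh U A) (diagram A R X) s L \<iota>" and h: "h \<in> hom A.B L (Fob (diagram A R X) s)"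
    and hi: "\<forall>f\<in>Obj (latching_cat R Rm s). h \<cdot>\<^bsub>A.B\<^esub> \<iota> f = Far (diagram A R X) f" and hc: "h \<in> cof"
    using rc s unfolding reedy_cofibrant_def by blast
  have lobj: "Obj (latching_cat R Rm s) = M"
    unfolding latching_cat_def full_cat_def under_cat_def wide_cat_def M_def by auto
  have "is_cocone (op_cat (latching_cat R Rm s)) A.B (comp_func (diagram A R X) (latching_proj R)) T \<kappa>"
    unfolding is_cocone_def
  proof (intro conjI ballI)
    show "T \<in> Obj A.B" using T A.Obj_B by simp
    show "\<kappa> i \<in> hom A.B (Fob (comp_func (diagram A R X) (latching_proj R)) i) T"
      if "i \<in> Obj (op_cat (latching_cat R Rm s))" for i
    proof -
      have "i \<in> M" using that lobj unfolding op_cat_def by simp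
      then show ?thesis using kh by (simp add: comp_func_def latching_proj_def diagram_def)
    qed
    fix x assume "x \<in> Arr (op_cat (latching_cat R Rm s))"
    then obtain f u g where x: "x = (f, u, g)" and f: "f \<in> M" and g: "g \<in> M" and u: "u \<in> Rm" "Dom R u = Cod R f" "Cod R u = Cod R g"
      "u \<cdot>\<^bsub>R\<^esub> f = g"
      unfolding op_cat_def latching_cat_def full_cat_def under_cat_def wide_cat_def M_def hom_def by auto
    note dh = diagram_hom[OF X Rm_arr[OF u(1)], unfolded u(2,3)]
    have "\<kappa> f \<cdot>\<^bsub>A.B\<^esub> Far (diagram A R X) u = \<kappa> g"
    proof (rule A.homB_eqI[OF A.B_comp_hom[OF dh kh[OF f]] kh[OF g]])
      fix b w assume b: "b \<in> Obj A" and w: "w \<in> Ev (slice_obj A R X (Cod R g)) b"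
      then have w': "w \<in> Ev X (b, Cod R u)" using u by simp
      have "act_R X b u w \<in> Ev X (b, Cod R f)" using act_R_in[OF X b Rm_arr[OF u(1)] w'] u by simp
      then show "Cpt (\<kappa> f \<cdot>\<^bsub>A.B\<^esub> Far (diagram A R X) u) b w = Cpt (\<kappa> g) b w"
        using A.Cpt_cmp[OF dh b w] w b nfenc_act_R[OF X b M(1)[OF f] u(1,2) M(6)[OF f] w'] u(4)
        by (simp add: Cpt_diagram \<kappa>_def)
    qed
    then show "\<kappa> (Cod (op_cat (latching_cat R Rm s)) x) \<cdot>\<^bsub>A.B\<^esub> Far (comp_func (diagram A R X) (latching_proj R)) x =
         \<kappa> (Dom (op_cat (latching_cat R Rm s)) x)"
      unfolding x by (simp add: op_cat_def latching_cat_def full_cat_def under_cat_def wide_cat_def comp_func_def latching_proj_def)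
  qed
  then have "\<exists>!k. k \<in> hom A.B L T \<and> (\<forall>i\<in>Obj (op_cat (latching_cat R Rm s)). k \<cdot>\<^bsub>A.B\<^esub> \<iota> i = \<kappa> i)"
    using L unfolding is_latching_object_def is_colimit_def by blast
  then obtain k where k: "k \<in> hom A.B L T" "\<forall>i\<in>Obj (op_cat (latching_cat R Rm s)). k \<cdot>\<^bsub>A.B\<^esub> \<iota> i = \<kappa> i"
    by blast
  have oobj: "Obj (op_cat (latching_cat R Rm s)) = M" using lobj by (simp add: op_cat_def)
  have ih: "\<iota> i \<in> hom A.B (slice_obj A R X (Cod R i)) L" if "i \<in> M" for i
  proof -
    have "\<iota> i \<in> hom A.B (Fob (comp_func (diagram A R X) (latching_proj R)) i) L"
      using L that unfolding is_latching_object_def is_colimit_def is_cocone_def oobj by blast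
    then show ?thesis by (simp add: comp_func_def latching_proj_def diagram_def)
  qed
  have sM: "\<sigma> \<in> M" "\<tau> \<in> M" using st unfolding M_def by auto
  have yX: "y \<in> Ev (slice_obj A R X (Cod R \<sigma>)) a" and zX: "z \<in> Ev (slice_obj A R X (Cod R \<tau>)) a"
    using y z a unfolding nondeg_def by auto
  have "Cpt h a (Cpt (\<iota> \<sigma>) a y) = Cpt (Far (diagram A R X) \<sigma>) a y"
    using hi lobj sM A.Cpt_cmp[OF ih[OF sM(1)] a yX] by metis
  moreover have "Cpt h a (Cpt (\<iota> \<tau>) a z) = Cpt (Far (diagram A R X) \<tau>) a z"
    using hi lobj sM A.Cpt_cmp[OF ih[OF sM(2)] a zX] by metis
  ultimately have "Cpt h a (Cpt (\<iota> \<sigma>) a y) = Cpt h a (Cpt (\<iota> \<tau>) a z)"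
    using eq a by (simp add: Cpt_diagram)
  \<comment> \<open>Here cofibrancy enters: \<open>h\<close> is injective, so the two elements agree
    already in the colimit \<open>L\<close>, and therefore under every map out of \<open>L\<close>,
    in particular under \<open>k\<close>.\<close>
  moreover have "inj_on (Cpt h a) (Ev L a)" using A.mono_injective[OF _ h a] hc cof_mono by simp
  ultimately have i: "Cpt (\<iota> \<sigma>) a y = Cpt (\<iota> \<tau>) a z"
    using A.Cpt_in[OF ih[OF sM(1)] a yX] A.Cpt_in[OF ih[OF sM(2)] a zX] by (auto dest: inj_onD)
  have "Cpt k a (Cpt (\<iota> \<sigma>) a y) = nfenc X a \<sigma> y"
    using A.Cpt_cmp[OF ih[OF sM(1)] a yX, of k] k(2) sM oobj a yX by (simp add: \<kappa>_def)
  moreover have "Cpt k a (Cpt (\<iota> \<tau>) a z) = nfenc X a \<tau> z"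
    using A.Cpt_cmp[OF ih[OF sM(2)] a zX, of k] k(2) sM oobj a zX by (simp add: \<kappa>_def)
  ultimately have ne: "nfenc X a \<sigma> y = nfenc X a \<tau> z" using i by simp
  \<comment> \<open>A nondegenerate element is its own normal form, so \<open>k\<close> gives back
    the pair of arrow and element that was put in.\<close>
  have nd: "nfenc X a \<rho> w = vpair (enc \<rho>, w)" if "\<rho> \<in> M" "w \<in> nondeg X (Cod R \<rho>) a" for \<rho> w
  proof -
    note o = M(5)[OF that(1)]
    have wX: "w \<in> Ev X (a, Cod R \<rho>)" using that(2) by (simp add: nondeg_def)
    have "nf X (Cod R \<rho>) a w = (Idt R (Cod R \<rho>), w)"
      using nf_eq[OF X _ a Rm_id[OF o], of w] R.base_id[OF o] that(2) M(6)[OF that(1)] act_R_id[OF X a o wX] by simp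
    then show ?thesis unfolding nfenc_def using R_id_left[OF M(2)[OF that(1)]] by simp
  qed
  have "enc \<sigma> = enc \<tau> \<and> y = z" using ne nd[OF sM(1) y] nd[OF sM(2) z] by simp
  then show ?thesis using enc_inj M(2) sM by (auto dest: inj_onD)
qed

text \<open>Induction on the degree of \<open>s\<close>. If one of the two arrows is the identity,
  the element is nondegenerate at \<open>s\<close> and cannot come from a lower degree, so the other
  arrow is the identity too. Otherwise both are objects of the latching category and
  \<open>latching_separates\<close> applies.\<close>

lemma unique_decomposition:
  assumes X: "presheaf U (prod_cat A R) X" and rc: "reedy_cof X"
  shows "s \<in> Obj R \<Longrightarrow> unique_decomposition X s"
proof (induction "deg s" arbitrary: s rule: less_induct)
  case less
  note IH = less.hyps
  have id_case: "\<tau> = Idt R s \<and> y = z"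
    if a: "a \<in> Obj A" and t: "\<tau> \<in> Rm" "Dom R \<tau> = s" and y: "y \<in> nondeg X s a" and z: "z \<in> nondeg X (Cod R \<tau>) a"
      and eq: "y = act_R X a \<tau> z" for a \<tau> y z
  proof -
    have zX: "z \<in> Ev X (a, Cod R \<tau>)" using z by (simp add: nondeg_def)
    have "\<tau> = Idt R s"
    proof (rule ccontr)
      assume "\<tau> \<noteq> Idt R s"
      then have "deg (Cod R \<tau>) < deg s" using Rm_deg[OF t(1)] t(2) by simp
      then have "y \<in> Fset X (deg s) (a, s)" using FsetI[where m = "deg s", OF Rm_arr[OF t(1)] zX] eq t(2) by simp
      then show False using y by (simp add: nondeg_def)
    qed
    moreover have "z = y" using eq zX act_R_id[OF X a less.prems] \<open>\<tau> = Idt R s\<close> R.base_id[OF less.prems] by simp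
    ultimately show ?thesis by simp
  qed
  show ?case unfolding unique_decomposition_def
  proof (intro ballI allI impI)
    fix a \<sigma> \<tau> y z
    assume a: "a \<in> Obj A" and st: "\<sigma> \<in> Rm" "\<tau> \<in> Rm" "Dom R \<sigma> = s" "Dom R \<tau> = s"
      and y: "y \<in> nondeg X (Cod R \<sigma>) a" and z: "z \<in> nondeg X (Cod R \<tau>) a" and eq: "act_R X a \<sigma> y = act_R X a \<tau> z"
    note sid = R.base_id[OF less.prems]
    have yX: "y \<in> Ev X (a, Cod R \<sigma>)" and zX: "z \<in> Ev X (a, Cod R \<tau>)" using y z by (auto simp: nondeg_def)
    consider "\<sigma> = Idt R s" | "\<tau> = Idt R s" | "\<sigma> \<noteq> Idt R s" "\<tau> \<noteq> Idt R s" by blast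
    then show "\<sigma> = \<tau> \<and> y = z"
    proof cases
      case 1
      then have c: "Cod R \<sigma> = s" using sid by simp
      have "y = act_R X a \<tau> z" using act_R_id[OF X a less.prems yX[unfolded c]] eq 1 by metis
      from id_case[OF a st(2,4) y[unfolded c] z this] show ?thesis using 1 by blast
    next
      case 2
      then have c: "Cod R \<tau> = s" using sid by simp
      have "z = act_R X a \<sigma> y" using act_R_id[OF X a less.prems zX[unfolded c]] eq 2 by metis
      from id_case[OF a st(1,3) z[unfolded c] y this] show ?thesis using 2 by blast
    next
      case 3
      show ?thesis
        by (rule latching_separates[OF X rc less.prems _ a st 3 y z eq]) (use IH in blast)
    qed
  qed
qed

end

section \<open>Skeleta, cells and the attaching squares\<close>

section \<open>The skeletal filtration\<close>

context presheaf_category begin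

definition restr :: "('o, 'm, 'v) presh \<Rightarrow> ('o \<Rightarrow> 'v set) \<Rightarrow> ('o, 'm, 'v) presh" where "restr X S = mk_presheaf C S (Act X)"

definition subpresheaf :: "('o, 'm, 'v) presh \<Rightarrow> ('o, 'm, 'v) presh \<Rightarrow> bool" where
  "subpresheaf S T \<longleftrightarrow> presheaf U C S \<and> presheaf U C T \<and> (\<forall>a\<in>Obj C. Ev S a \<subseteq> Ev T a) \<and>
     (\<forall>f\<in>Arr C. \<forall>x\<in>Ev S (Cod C f). Act S f x = Act T f x)"

definition incl :: "('o, 'm, 'v) presh \<Rightarrow> ('o, 'm, 'v) presh \<Rightarrow> ('o, 'm, 'v) nat_trans" where "incl S T = mk_trans C S T (\<lambda>_ x. x)"

lemma restr_simps [simp]: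
  "a \<in> Obj C \<Longrightarrow> Ev (restr X S) a = S a"
  "f \<in> Arr C \<Longrightarrow> x \<in> S (Cod C f) \<Longrightarrow> Act (restr X S) f x = Act X f x"
  by (simp_all add: restr_def)

lemma presheaf_restr:
  assumes X: "presheaf U C X" and S: "\<And>a. a \<in> Obj C \<Longrightarrow> S a \<subseteq> Ev X a"
    and st: "\<And>f x. f \<in> Arr C \<Longrightarrow> x \<in> S (Cod C f) \<Longrightarrow> Act X f x \<in> S (Dom C f)"
  shows "presheaf U C (restr X S)"
  unfolding restr_def
proof (rule presheaf_mk_presheaf)
  show "S a \<in> U" if "a \<in> Obj C" for a using U_subset[OF Ev_U[OF X that] S[OF that]] .
  show "Act X (Idt C a) x = x" if "a \<in> Obj C" "x \<in> S a" for a x using Act_id[OF X that(1)] S[OF that(1)] that(2) by blast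
  show "Act X (g \<cdot>\<^bsub>C\<^esub> f) x = Act X f (Act X g x)" if "f \<in> Arr C" "g \<in> Arr C" "Cod C f = Dom C g" "x \<in> S (Cod C g)" for f g x
    using Act_cmp[OF X that(1-3)] S[OF base_arr(2)[OF that(2)]] that(4) by blast
qed (rule st)

lemma subpresheaf_restr:
  assumes "presheaf U C X" "\<And>a. a \<in> Obj C \<Longrightarrow> S a \<subseteq> Ev X a"
    "\<And>f x. f \<in> Arr C \<Longrightarrow> x \<in> S (Cod C f) \<Longrightarrow> Act X f x \<in> S (Dom C f)"
  shows "subpresheaf (restr X S) X"
  unfolding subpresheaf_def using presheaf_restr[OF assms] assms base_arr by simp

lemma incl_hom: "subpresheaf S T \<Longrightarrow> incl S T \<in> hom B S T"
  unfolding incl_def subpresheaf_def by (rule mk_trans_hom) auto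

lemma Cpt_incl [simp]: "a \<in> Obj C \<Longrightarrow> x \<in> Ev S a \<Longrightarrow> Cpt (incl S T) a x = x"
  by (simp add: incl_def)

lemma incl_image: "a \<in> Obj C \<Longrightarrow> Cpt (incl S T) a ` Ev S a = Ev S a"
  by (auto simp: incl_def image_iff)

lemma incl_inj: "a \<in> Obj C \<Longrightarrow> inj_on (Cpt (incl S T) a) (Ev S a)"
  by (rule inj_onI) simp

lemma sub_map_hom:
  assumes S: "subpresheaf S X" and T: "subpresheaf T Y" and t: "mk_trans C X Y c \<in> hom B X Y"
    and c: "\<And>a x. a \<in> Obj C \<Longrightarrow> x \<in> Ev S a \<Longrightarrow> c a x \<in> Ev T a"
  shows "mk_trans C S T c \<in> hom B S T"
proof (rule mk_trans_hom)
  show "presheaf U C S" "presheaf U C T" using S T unfolding subpresheaf_def by auto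
  show "c (Dom C f) (Act S f x) = Act T f (c (Cod C f) x)" if f: "f \<in> Arr C" and x: "x \<in> Ev S (Cod C f)" for f x
  proof -
    note o = base_arr[OF f]
    have xX: "x \<in> Ev X (Cod C f)" and X: "presheaf U C X" using S x o unfolding subpresheaf_def by auto
    have "c (Dom C f) (Act X f x) = Act Y f (c (Cod C f) x)"
      using Cpt_nat[OF t f xX] Act_in[OF X f xX] o xX by simp
    then show ?thesis using S T x f c[OF o(2) x] unfolding subpresheaf_def by auto
  qed
qed (rule c)

text \<open>Two subobjects that meet in \<open>P\<close> and cover \<open>G\<close>: the part of
  \<open>Q\<close> outside \<open>P\<close> is exactly the complement of \<open>F\<close> in
  \<open>G\<close>, which is what \<open>ptwise_po\<close> asks for.\<close>

lemma union_square:
  assumes 1: "subpresheaf P Q" "subpresheaf P F" "subpresheaf Q G" "subpresheaf F G"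
    and 2: "\<And>a. a \<in> Obj C \<Longrightarrow> Ev Q a \<inter> Ev F a \<subseteq> Ev P a" "\<And>a. a \<in> Obj C \<Longrightarrow> Ev G a \<subseteq> Ev Q a \<union> Ev F a"
  shows "ptwise_po P Q F G (incl P Q) (incl P F) (incl Q G) (incl F G)"
proof -
  have s: "Ev P a \<subseteq> Ev Q a" "Ev P a \<subseteq> Ev F a" if "a \<in> Obj C" for a using 1 that unfolding subpresheaf_def by auto
  have im: "Cpt (incl Q G) a ` (Ev Q a - Ev P a) = Ev Q a - Ev P a" if "a \<in> Obj C" for a
    using that by (auto simp: image_iff)
  show ?thesis
    unfolding ptwise_po_def
  proof (intro conjI ballI)
    fix a assume a: "a \<in> Obj C"
    show "Cpt (incl Q G) a (Cpt (incl P Q) a x) = Cpt (incl F G) a (Cpt (incl P F) a x)" if "x \<in> Ev P a" for x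
      using a that subsetD[OF s(1)[OF a] that] subsetD[OF s(2)[OF a] that] by simp
    show "inj_on (Cpt (incl F G) a) (Ev F a)" by (rule incl_inj[OF a])
    show "inj_on (Cpt (incl Q G) a) (Ev Q a - Cpt (incl P Q) a ` Ev P a)" by (rule inj_on_subset[OF incl_inj[OF a]]) auto
    show "Ev G a \<subseteq> Cpt (incl F G) a ` Ev F a \<union> Cpt (incl Q G) a ` (Ev Q a - Cpt (incl P Q) a ` Ev P a)"
      using 2(2)[OF a] s[OF a] unfolding incl_image[OF a] im[OF a] by blast
    show "Cpt (incl F G) a ` Ev F a \<inter> Cpt (incl Q G) a ` (Ev Q a - Cpt (incl P Q) a ` Ev P a) = {}"
      using 2(1)[OF a] unfolding incl_image[OF a] im[OF a] by blast
  qed (use incl_hom 1 in auto)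
qed

end

context reedy_setting begin

abbreviation "AR_cat \<equiv> prod_cat A R"

definition Fil where "Fil X m = AR.restr X (Fset X m)"

lemma Ev_Fil [simp]: "a \<in> Obj A \<Longrightarrow> s \<in> Obj R \<Longrightarrow> Ev (Fil X m) (a, s) = Fset X m (a, s)"
  by (simp add: Fil_def)

lemma Fset_stable:
  assumes X: "presheaf U AR_cat X"
  shows "c \<in> Obj AR_cat \<Longrightarrow> Fset X m c \<subseteq> Ev X c"
    and "f \<in> Arr AR_cat \<Longrightarrow> x \<in> Fset X m (Cod AR_cat f) \<Longrightarrow> Act X f x \<in> Fset X m (Dom AR_cat f)"
  using Fset_subset[OF X] Fset_Act[OF X] by auto

lemma subpresheaf_Fil: "presheaf U AR_cat X \<Longrightarrow> AR.subpresheaf (Fil X m) X"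
  unfolding Fil_def by (rule AR.subpresheaf_restr) (use Fset_stable in auto)

lemma presheaf_Fil: "presheaf U AR_cat X \<Longrightarrow> presheaf U AR_cat (Fil X m)"
  using subpresheaf_Fil unfolding AR.subpresheaf_def by blast

lemma Fset_mono: "m \<le> n \<Longrightarrow> Fset X m c \<subseteq> Fset X n c"
  unfolding Fset_def by (cases c) force

lemma subpresheaf_Fil_le:
  assumes X: "presheaf U AR_cat X" and mn: "m \<le> n"
  shows "AR.subpresheaf (Fil X m) (Fil X n)"
  unfolding AR.subpresheaf_def
proof (intro conjI ballI)
  show "Ev (Fil X m) c \<subseteq> Ev (Fil X n) c" if "c \<in> Obj AR_cat" for c
    using that Fset_mono[OF mn, of X c] by (simp add: Fil_def del: prod_cat_simps)
  show "Act (Fil X m) f x = Act (Fil X n) f x" if f: "f \<in> Arr AR_cat" and x: "x \<in> Ev (Fil X m) (Cod AR_cat f)" for f x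
  proof -
    have "x \<in> Fset X m (Cod AR_cat f)" using x AR.base_arr(2)[OF f] by (simp add: Fil_def)
    moreover from this have "x \<in> Fset X n (Cod AR_cat f)" using subsetD[OF Fset_mono[OF mn]] by blast
    ultimately show ?thesis using f by (simp add: Fil_def del: prod_cat_simps)
  qed
qed (use presheaf_Fil[OF X] in auto)

definition Fmap :: "('a \<times> 'r, 'b \<times> 's, 'v) nat_trans \<Rightarrow> ('a \<times> 'r, 'b \<times> 's, 'v) presh \<Rightarrow> ('a \<times> 'r, 'b \<times> 's, 'v) presh \<Rightarrow> nat \<Rightarrow> ('a \<times> 'r, 'b \<times> 's, 'v) nat_trans" where "Fmap t X Y m = mk_trans AR_cat (Fil X m) (Fil Y m) (Cpt t)"

lemma mk_trans_Cpt: "t \<in> hom AR.B X Y \<Longrightarrow> mk_trans AR_cat X Y (Cpt t) = t"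
proof -
  assume t: "t \<in> hom AR.B X Y"
  have h: "mk_trans AR_cat X Y (Cpt t) \<in> hom AR.B X Y"
    by (rule AR.mk_trans_hom) (use AR.homB_presheaf[OF t] AR.Cpt_in[OF t] AR.Cpt_nat[OF t] in auto)
  show ?thesis by (rule AR.homB_eqI[OF h t]) simp
qed

lemma Fset_map:
  assumes t: "t \<in> hom AR.B X Y" and c: "c \<in> Obj AR_cat" and x: "x \<in> Fset X m c"
  shows "Cpt t c x \<in> Fset Y m c"
proof -
  obtain a s where as: "c = (a, s)" "a \<in> Obj A" using c by auto
  obtain \<phi> y where y: "\<phi> \<in> Arr R" "y \<in> Ev X (a, Cod R \<phi>)" "Dom R \<phi> = s" "deg (Cod R \<phi>) < m" "x = act_R X a \<phi> y"
    using x as unfolding Fset_def by auto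
  have "Cpt t c x = act_R Y a \<phi> (Cpt t (a, Cod R \<phi>) y)" using natural_act_R[OF t as(2) y(1,2)] y as by simp
  then show ?thesis
    using FsetI[OF y(1) AR.Cpt_in[OF t _ y(2)] y(4)] as y(3) R.base_arr[OF y(1)] by simp
qed

lemma Fmap_hom:
  assumes t: "t \<in> hom AR.B X Y"
  shows "Fmap t X Y m \<in> hom AR.B (Fil X m) (Fil Y m)"
  unfolding Fmap_def
proof (rule AR.sub_map_hom)
  show "AR.subpresheaf (Fil X m) X" "AR.subpresheaf (Fil Y m) Y"
    using subpresheaf_Fil AR.homB_presheaf[OF t] by auto
  show "mk_trans AR_cat X Y (Cpt t) \<in> hom AR.B X Y" using mk_trans_Cpt[OF t] t by simp
  show "Cpt t c x \<in> Ev (Fil Y m) c" if "c \<in> Obj AR_cat" "x \<in> Ev (Fil X m) c" for c x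
    using Fset_map[OF t that(1)] that by (simp add: Fil_def)
qed

lemma Cpt_Fmap: "c \<in> Obj AR_cat \<Longrightarrow> x \<in> Fset X m c \<Longrightarrow> Cpt (Fmap t X Y m) c x = Cpt t c x"
  by (simp add: Fmap_def Fil_def)

text \<open>The representable presheaf \<open>R(-, r)\<close>, with arrows replaced by their
  codes.\<close>

definition rep where
  "rep r = mk_presheaf R (\<lambda>s. enc ` {\<phi> \<in> Arr R. Dom R \<phi> = s \<and> Cod R \<phi> = r}) (\<lambda>\<psi> v. enc (dec v \<cdot>\<^bsub>R\<^esub> \<psi>))"

text \<open>The boundary \<open>\<partial>R(-, r)\<close>. Factorizations through any object of
  smaller degree count, which makes closure under precomposition immediate; \<open>bdry_deg\<close>
  relates the complement to \<open>Rm\<close>.\<close>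

definition bdry_set where
  "bdry_set r s = enc ` {\<phi> \<in> Arr R. Dom R \<phi> = s \<and> Cod R \<phi> = r \<and>
     (\<exists>\<alpha>\<in>Arr R. \<exists>\<beta>\<in>Arr R. Cod R \<alpha> = Dom R \<beta> \<and> deg (Cod R \<alpha>) < deg r \<and> \<phi> = \<beta> \<cdot>\<^bsub>R\<^esub> \<alpha>)}"

definition bdry where "bdry r = R.restr (rep r) (bdry_set r)"

lemma Ev_rep: "s \<in> Obj R \<Longrightarrow> Ev (rep r) s = enc ` {\<phi> \<in> Arr R. Dom R \<phi> = s \<and> Cod R \<phi> = r}"
  by (simp add: rep_def)

lemma Act_rep: "\<psi> \<in> Arr R \<Longrightarrow> \<phi> \<in> Arr R \<Longrightarrow> Dom R \<phi> = Cod R \<psi> \<Longrightarrow> Cod R \<phi> = r \<Longrightarrow>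
    Act (rep r) \<psi> (enc \<phi>) = enc (\<phi> \<cdot>\<^bsub>R\<^esub> \<psi>)"
  unfolding rep_def by (subst mk_presheaf_simps) auto

lemma presheaf_rep: "presheaf U R (rep r)"
  unfolding rep_def
proof (rule R.presheaf_mk_presheaf)
  show "enc ` {\<phi> \<in> Arr R. Dom R \<phi> = s \<and> Cod R \<phi> = r} \<in> U" for s by (rule U_subset[OF enc_U]) auto
  show "enc (dec v \<cdot>\<^bsub>R\<^esub> \<psi>) \<in> enc ` {\<phi> \<in> Arr R. Dom R \<phi> = Dom R \<psi> \<and> Cod R \<phi> = r}"
    if p: "\<psi> \<in> Arr R" and v: "v \<in> enc ` {\<phi> \<in> Arr R. Dom R \<phi> = Cod R \<psi> \<and> Cod R \<phi> = r}" for \<psi> v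
  proof -
    obtain \<phi> where f: "v = enc \<phi>" "\<phi> \<in> Arr R" "Dom R \<phi> = Cod R \<psi>" "Cod R \<phi> = r" using v by blast
    then show ?thesis using R.base_cmp[OF p f(2) f(3)[symmetric]] by simp
  qed
  show "enc (dec v \<cdot>\<^bsub>R\<^esub> Idt R s) = v" if "s \<in> Obj R" "v \<in> enc ` {\<phi> \<in> Arr R. Dom R \<phi> = s \<and> Cod R \<phi> = r}" for s v
    using that R_id_right by auto
  show "enc (dec v \<cdot>\<^bsub>R\<^esub> (g \<cdot>\<^bsub>R\<^esub> f)) = enc (dec (enc (dec v \<cdot>\<^bsub>R\<^esub> g)) \<cdot>\<^bsub>R\<^esub> f)"
    if fg: "f \<in> Arr R" "g \<in> Arr R" "Cod R f = Dom R g" and v: "v \<in> enc ` {\<phi> \<in> Arr R. Dom R \<phi> = Cod R g \<and> Cod R \<phi> = r}" for f g v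
  proof -
    obtain \<phi> where f: "v = enc \<phi>" "\<phi> \<in> Arr R" "Dom R \<phi> = Cod R g" using v by blast
    then show ?thesis using R_assoc[OF fg(1,2) f(2) fg(3)] R.base_cmp[OF fg(2) f(2)] by simp
  qed
qed

lemma bdry_set_subset: "s \<in> Obj R \<Longrightarrow> bdry_set r s \<subseteq> Ev (rep r) s"
  unfolding bdry_set_def Ev_rep by auto

lemma bdry_set_Act:
  assumes p: "\<psi> \<in> Arr R" and v: "v \<in> bdry_set r (Cod R \<psi>)"
  shows "Act (rep r) \<psi> v \<in> bdry_set r (Dom R \<psi>)"
proof -
  obtain \<phi> \<alpha> \<beta> where f: "v = enc \<phi>" "\<phi> \<in> Arr R" "Dom R \<phi> = Cod R \<psi>" "Cod R \<phi> = r" and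
    ab: "\<alpha> \<in> Arr R" "\<beta> \<in> Arr R" "Cod R \<alpha> = Dom R \<beta>" "deg (Cod R \<alpha>) < deg r" "\<phi> = \<beta> \<cdot>\<^bsub>R\<^esub> \<alpha>"
    using v unfolding bdry_set_def by auto
  have d: "Dom R \<alpha> = Cod R \<psi>" using R.base_cmp[OF ab(1,2,3)] ab(5) f(3) by simp
  note c = R.base_cmp[OF p f(2) f(3)[symmetric]] and c' = R.base_cmp[OF p ab(1) d[symmetric]]
  have "\<phi> \<cdot>\<^bsub>R\<^esub> \<psi> = \<beta> \<cdot>\<^bsub>R\<^esub> (\<alpha> \<cdot>\<^bsub>R\<^esub> \<psi>)" using R_assoc[OF p ab(1,2)] d ab by simp
  then have "\<exists>\<alpha>'\<in>Arr R. \<exists>\<beta>\<in>Arr R. Cod R \<alpha>' = Dom R \<beta> \<and> deg (Cod R \<alpha>') < deg r \<and> \<phi> \<cdot>\<^bsub>R\<^esub> \<psi> = \<beta> \<cdot>\<^bsub>R\<^esub> \<alpha>'"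
    using c' ab by (intro bexI[of _ "\<alpha> \<cdot>\<^bsub>R\<^esub> \<psi>"] bexI[of _ \<beta>]) auto
  then show ?thesis unfolding bdry_set_def f(1) Act_rep[OF p f(2,3,4)] using c f(4) by (intro imageI) simp
qed

lemma bdry_simps:
  "s \<in> Obj R \<Longrightarrow> Ev (bdry r) s = bdry_set r s"
  "\<psi> \<in> Arr R \<Longrightarrow> v \<in> bdry_set r (Cod R \<psi>) \<Longrightarrow> Act (bdry r) \<psi> v = Act (rep r) \<psi> v"
  by (simp_all add: bdry_def)

lemma presheaf_bdry: "presheaf U R (bdry r)"
  unfolding bdry_def by (rule R.presheaf_restr[OF presheaf_rep bdry_set_subset bdry_set_Act])

text \<open>If the part of \<open>\<phi>\<close> in \<open>Rp\<close> were not an identity, its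
  source would have degree below that of \<open>r\<close>, and \<open>\<phi>\<close> would factor
  through it. So the interior of \<open>R(-, r)\<close> consists of arrows to which unique
  decomposition applies.\<close>

lemma bdry_deg:
  assumes "\<phi> \<in> Arr R" "Cod R \<phi> = r" "enc \<phi> \<notin> bdry_set r (Dom R \<phi>)"
  shows "\<phi> \<in> Rm"
proof -
  obtain p m where pm: "p \<in> Rp" "m \<in> Rm" "Cod R m = Dom R p" "p \<cdot>\<^bsub>R\<^esub> m = \<phi>" "Dom R m = Dom R \<phi>" "Cod R p = Cod R \<phi>"
    by (rule factor[OF assms(1)])
  note pa = Rp_arr[OF pm(1)] and ma = Rm_arr[OF pm(2)]
  have "p = Idt R (Dom R p)"
  proof (rule ccontr)
    assume "p \<noteq> Idt R (Dom R p)"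
    then have "deg (Cod R m) < deg r" using Rp_deg[OF pm(1)] pm(3,6) assms(2) by simp
    then have "\<exists>\<alpha>\<in>Arr R. \<exists>\<beta>\<in>Arr R. Cod R \<alpha> = Dom R \<beta> \<and> deg (Cod R \<alpha>) < deg r \<and> \<phi> = \<beta> \<cdot>\<^bsub>R\<^esub> \<alpha>"
      using pa ma pm by (intro bexI[of _ m] bexI[of _ p]) auto
    then have "enc \<phi> \<in> bdry_set r (Dom R \<phi>)" unfolding bdry_set_def using assms by (intro imageI) simp
    then show False using assms(3) by simp
  qed
  then have "\<phi> = m" using R_id_left[OF ma] pm(3,4) by metis
  then show ?thesis using pm(2) by simp
qed

text \<open>Coproducts are indexed by members of \<open>U\<close>, hence by elements of
  \<open>'v\<close>; an object is represented by the code of its identity.\<close>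

definition cell_index where "cell_index m = (\<lambda>r. enc (Idt R r)) ` {r \<in> Obj R. deg r = m}"

definition ob where "ob i = Dom R (dec i)"

lemma ob_enc [simp]: "r \<in> Obj R \<Longrightarrow> ob (enc (Idt R r)) = r"
  unfolding ob_def using R.base_id by simp

lemma cell_index_U: "cell_index m \<in> U"
  by (rule U_subset[OF enc_U]) (auto simp: cell_index_def R.base_id)

lemma enc_id_eq [simp]: "r \<in> Obj R \<Longrightarrow> r' \<in> Obj R \<Longrightarrow> enc (Idt R r) = enc (Idt R r') \<longleftrightarrow> r = r'"
  using ob_enc by metis

text \<open>The coproduct of \<open>Z\<^sub>r \<times> L r\<close> over the objects of degree
  \<open>m\<close>. With \<open>Z\<close> either \<open>X\<close> or its skeleton and
  \<open>L\<close> either \<open>rep\<close> or \<open>bdry\<close> it yields the four presheaves in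
  the pushout product of \<open>L\<^sub>r X \<rightarrow> X\<^sub>r\<close> and
  \<open>\<partial>R(-, r) \<rightarrow> R(-, r)\<close>.\<close>

definition cells where
  "cells Z L m = AR.copr (cell_index m) (\<lambda>i. ext_prod_obj A R (L (ob i)) (slice_obj A R Z (ob i)))"

lemma Ev_cells:
  "a \<in> Obj A \<Longrightarrow> s \<in> Obj R \<Longrightarrow> Ev (cells Z L m) (a, s) =
    {vpair (enc (Idt R r), vpair (x, v)) |r x v. r \<in> Obj R \<and> deg r = m \<and> x \<in> Ev Z (a, r) \<and> v \<in> Ev (L r) s}"
  unfolding cells_def by (force simp: AR.Ev_copr Ev_ext_prod cell_index_def)

lemma Act_cells:
  assumes "u \<in> Arr A" "\<psi> \<in> Arr R" "r \<in> Obj R" "deg r = m" "x \<in> Ev Z (Cod A u, r)" "v \<in> Ev (L r) (Cod R \<psi>)"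
  shows "Act (cells Z L m) (u, \<psi>) (vpair (enc (Idt R r), vpair (x, v))) =
    vpair (enc (Idt R r), vpair (act_A Z u r x, Act (L r) \<psi> v))"
proof -
  have i: "enc (Idt R r) \<in> cell_index m" using assms unfolding cell_index_def by auto
  have f: "(u, \<psi>) \<in> Arr AR_cat" using assms by simp
  have x: "x \<in> Ev (slice_obj A R Z r) (Cod A u)" using assms A.base_arr by simp
  have "vpair (x, v) \<in> Ev (ext_prod_obj A R (L (ob (enc (Idt R r)))) (slice_obj A R Z (ob (enc (Idt R r))))) (Cod AR_cat (u, \<psi>))"
    using assms x A.base_arr R.base_arr by (simp add: Ev_ext_prod)
  from AR.Act_copr[where X = "\<lambda>i. ext_prod_obj A R (L (ob i)) (slice_obj A R Z (ob i))", OF f i this]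
  show ?thesis using assms Act_ext_prod[OF assms(1,2) x, of v "L r"] by (simp add: cells_def act_A_def)
qed

lemma presheaf_cells:
  assumes Z: "presheaf U AR_cat Z" and L: "\<And>r. r \<in> Obj R \<Longrightarrow> presheaf U R (L r)"
  shows "presheaf U AR_cat (cells Z L m)"
  unfolding cells_def
  by (rule AR.presheaf_copr[OF cell_index_U ext_prod_presheaf[OF L slice_presheaf[OF Z]]]) (auto simp: cell_index_def)

text \<open>One raw formula for all choices of \<open>Z\<close> and \<open>L\<close>, and also for
  the union \<open>latch\<close>, so that comparison squares commute by computation.\<close>

definition cmap :: "('a \<times> 'r, 'b \<times> 's, 'v) nat_trans \<Rightarrow> 'a \<times> 'r \<Rightarrow> 'v \<Rightarrow> 'v" where
  "cmap t = (\<lambda>(a, s) z. vpair (fst (inv vpair z),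
     vpair (Cpt t (a, ob (fst (inv vpair z))) (fst (inv vpair (snd (inv vpair z)))), snd (inv vpair (snd (inv vpair z))))))"

lemma cmap [simp]: "r \<in> Obj R \<Longrightarrow> cmap t (a, s) (vpair (enc (Idt R r), vpair (x, v))) = vpair (enc (Idt R r), vpair (Cpt t (a, r) x, v))"
  by (simp add: cmap_def)

lemma cmap_hom:
  assumes t: "t \<in> hom AR.B Z Z'" and L: "\<And>r. r \<in> Obj R \<Longrightarrow> presheaf U R (L r)"
  shows "mk_trans AR_cat (cells Z L m) (cells Z' L m) (cmap t) \<in> hom AR.B (cells Z L m) (cells Z' L m)"
proof (rule AR.mk_trans_hom)
  note Z = AR.homB_presheaf[OF t]
  show "presheaf U AR_cat (cells Z L m)" "presheaf U AR_cat (cells Z' L m)" using presheaf_cells[OF _ L] Z by auto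
  fix c z assume c: "c \<in> Obj AR_cat" and z: "z \<in> Ev (cells Z L m) c"
  obtain a s where as: "c = (a, s)" "a \<in> Obj A" "s \<in> Obj R" using c by auto
  obtain r x v where zz: "z = vpair (enc (Idt R r), vpair (x, v))" "r \<in> Obj R" "deg r = m" "x \<in> Ev Z (a, r)" "v \<in> Ev (L r) s"
    using z unfolding as(1) Ev_cells[OF as(2,3)] by blast
  have "Cpt t (a, r) x \<in> Ev Z' (a, r)" using AR.Cpt_in[OF t] zz as by simp
  then show "cmap t c z \<in> Ev (cells Z' L m) c"
    unfolding as(1) Ev_cells[OF as(2,3)] zz(1) cmap[OF zz(2)] using zz by blast
next
  note Z = AR.homB_presheaf[OF t]
  fix f z assume f: "f \<in> Arr AR_cat" and z: "z \<in> Ev (cells Z L m) (Cod AR_cat f)"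
  obtain u \<psi> where u: "f = (u, \<psi>)" "u \<in> Arr A" "\<psi> \<in> Arr R" using f by auto
  note o = A.base_arr[OF u(2)] R.base_arr[OF u(3)]
  obtain r x v where zz: "z = vpair (enc (Idt R r), vpair (x, v))" "r \<in> Obj R" "deg r = m" "x \<in> Ev Z (Cod A u, r)" "v \<in> Ev (L r) (Cod R \<psi>)"
    using z Ev_cells[OF o(2,4)] unfolding u(1) by auto
  have tx: "Cpt t (Cod A u, r) x \<in> Ev Z' (Cod A u, r)" using AR.Cpt_in[OF t] zz o by simp
  have "Cpt t (Dom A u, r) (act_A Z u r x) = act_A Z' u r (Cpt t (Cod A u, r) x)"
    using AR.Cpt_nat[OF t, of "(u, Idt R r)" x] u zz R.base_id[OF zz(2)] by (simp add: act_A_def)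
  then show "cmap t (Dom AR_cat f) (Act (cells Z L m) f z) = Act (cells Z' L m) f (cmap t (Cod AR_cat f) z)"
    unfolding u(1) zz(1) using zz Act_cells[of u \<psi> r m x Z v L] Act_cells[of u \<psi> r m "Cpt t (Cod A u, r) x" Z' v L] u tx by simp
qed

lemma subpresheaf_cells:
  assumes S: "AR.subpresheaf S Z" and L: "\<And>r. r \<in> Obj R \<Longrightarrow> R.subpresheaf (K r) (L r)"
  shows "AR.subpresheaf (cells S K m) (cells Z L m)"
proof -
  have S': "presheaf U AR_cat S" "presheaf U AR_cat Z" "\<And>c. c \<in> Obj AR_cat \<Longrightarrow> Ev S c \<subseteq> Ev Z c"
    "\<And>f x. f \<in> Arr AR_cat \<Longrightarrow> x \<in> Ev S (Cod AR_cat f) \<Longrightarrow> Act S f x = Act Z f x"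
    using S unfolding AR.subpresheaf_def by auto
  have L': "presheaf U R (K r)" "presheaf U R (L r)" "\<And>s. s \<in> Obj R \<Longrightarrow> Ev (K r) s \<subseteq> Ev (L r) s"
    "\<And>f x. f \<in> Arr R \<Longrightarrow> x \<in> Ev (K r) (Cod R f) \<Longrightarrow> Act (K r) f x = Act (L r) f x" if "r \<in> Obj R" for r
    using L[OF that] unfolding R.subpresheaf_def by auto
  show ?thesis
    unfolding AR.subpresheaf_def
  proof (intro conjI ballI)
    show "presheaf U AR_cat (cells S K m)" "presheaf U AR_cat (cells Z L m)" using presheaf_cells S' L' by auto
    show "Ev (cells S K m) c \<subseteq> Ev (cells Z L m) c" if c: "c \<in> Obj AR_cat" for c
    proof -
      obtain a s where as: "c = (a, s)" "a \<in> Obj A" "s \<in> Obj R" using c by auto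
      have "x \<in> Ev Z (a, r)" if "x \<in> Ev S (a, r)" "r \<in> Obj R" for r x using S'(3)[of "(a, r)"] that as(2) by auto
      moreover have "v \<in> Ev (L r) s" if "v \<in> Ev (K r) s" "r \<in> Obj R" for r v using L'(3)[OF that(2) as(3)] that(1) by blast
      ultimately show ?thesis unfolding as(1) Ev_cells[OF as(2,3)] by blast
    qed
    fix f z assume f: "f \<in> Arr AR_cat" and z: "z \<in> Ev (cells S K m) (Cod AR_cat f)"
    obtain u \<psi> where u: "f = (u, \<psi>)" "u \<in> Arr A" "\<psi> \<in> Arr R" using f by auto
    note o = A.base_arr[OF u(2)] R.base_arr[OF u(3)]
    obtain r x v where zz: "z = vpair (enc (Idt R r), vpair (x, v))" "r \<in> Obj R" "deg r = m" "x \<in> Ev S (Cod A u, r)" "v \<in> Ev (K r) (Cod R \<psi>)"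
      using z Ev_cells[OF o(2,4)] unfolding u(1) by auto
    have 1: "x \<in> Ev Z (Cod A u, r)" "v \<in> Ev (L r) (Cod R \<psi>)" using S'(3)[of "(Cod A u, r)"] L'(3)[OF zz(2) o(4)] zz o by auto
    have "act_A S u r x = act_A Z u r x" unfolding act_A_def using S'(4)[of "(u, Idt R r)" x] u zz R.base_id[OF zz(2)] by simp
    then show "Act (cells S K m) f z = Act (cells Z L m) f z"
      unfolding u(1) zz(1) Act_cells[of u \<psi> r m x S v K, OF u(2,3) zz(2-5)] Act_cells[of u \<psi> r m x Z v L, OF u(2,3) zz(2,3) 1]
      using L'(4)[OF zz(2) u(3) zz(5)] by simp
  qed
qed

text \<open>
  For a Reedy cofibrant \<open>X\<close> and \<open>deg r = m\<close> the latching object at \<open>r\<close> is the value of \<open>Fil X m\<close> at \<open>r\<close>, so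
  \<open>latch X m\<close> is the domain of the cells of degree \<open>m\<close>.
\<close>

definition latch_set where
  "latch_set X m c = Ev (cells (Fil X m) rep m) c \<union> Ev (cells X bdry m) c"

definition latch where "latch X m = AR.restr (cells X rep m) (latch_set X m)"

lemma sub_rep: "R.subpresheaf (rep r) (rep r)" and sub_bdry: "R.subpresheaf (bdry r) (bdry r)"
    and sub_bdry_rep: "R.subpresheaf (bdry r) (rep r)"
  using presheaf_rep presheaf_bdry bdry_set_subset R.base_arr unfolding R.subpresheaf_def by (auto simp: bdry_simps)

lemma sub_refl: "presheaf U AR_cat X \<Longrightarrow> AR.subpresheaf X X" unfolding AR.subpresheaf_def by auto

lemma latch_facts:
  assumes X: "presheaf U AR_cat X"
  shows sub_latch: "AR.subpresheaf (latch X m) (cells X rep m)"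
    and sub_rep_latch: "AR.subpresheaf (cells (Fil X m) rep m) (latch X m)"
    and sub_bdry_latch: "AR.subpresheaf (cells X bdry m) (latch X m)"
    and sub_bdry_rep_Fil: "AR.subpresheaf (cells (Fil X m) bdry m) (cells (Fil X m) rep m)"
    and sub_bdry_Fil: "AR.subpresheaf (cells (Fil X m) bdry m) (cells X bdry m)"
proof -
  note F = subpresheaf_Fil[OF X]
  have s1: "AR.subpresheaf (cells (Fil X m) rep m) (cells X rep m)" by (rule subpresheaf_cells[OF F sub_rep])
  have s2: "AR.subpresheaf (cells X bdry m) (cells X rep m)" by (rule subpresheaf_cells[OF sub_refl[OF X] sub_bdry_rep])
  show "AR.subpresheaf (cells (Fil X m) bdry m) (cells (Fil X m) rep m)"
    by (rule subpresheaf_cells[OF sub_refl[OF presheaf_Fil[OF X]] sub_bdry_rep])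
  show "AR.subpresheaf (cells (Fil X m) bdry m) (cells X bdry m)" by (rule subpresheaf_cells[OF F sub_bdry])
  have st: "Act (cells X rep m) f x \<in> latch_set X m (Dom AR_cat f)" if f: "f \<in> Arr AR_cat" and x: "x \<in> latch_set X m (Cod AR_cat f)" for f x
    using x AR.Act_in[of "cells (Fil X m) rep m" f x] AR.Act_in[of "cells X bdry m" f x] s1 s2 f
    unfolding latch_set_def AR.subpresheaf_def by auto
  have sb: "latch_set X m c \<subseteq> Ev (cells X rep m) c" if "c \<in> Obj AR_cat" for c
    using s1 s2 that unfolding latch_set_def AR.subpresheaf_def by blast
  show l: "AR.subpresheaf (latch X m) (cells X rep m)"
    unfolding latch_def by (rule AR.subpresheaf_restr[OF _ sb st]) (rule presheaf_cells[OF X presheaf_rep])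
  show "AR.subpresheaf (cells (Fil X m) rep m) (latch X m)"
    using s1 l AR.base_arr unfolding AR.subpresheaf_def by (auto simp: latch_def latch_set_def simp del: prod_cat_simps)
  show "AR.subpresheaf (cells X bdry m) (latch X m)"
    using s2 l AR.base_arr unfolding AR.subpresheaf_def by (auto simp: latch_def latch_set_def simp del: prod_cat_simps)
qed

text \<open>The code of a cell determines \<open>r\<close>, \<open>x\<close> and the arrow, so a
  cell lies in both parts only if \<open>x\<close> is in the skeleton and the arrow in the boundary.
  The square presents the latching domain by three coproducts of external products, to which
  \<open>cells_we\<close> applies.\<close>

lemma latch_square:
  assumes X: "presheaf U AR_cat X"
  shows "AR.ptwise_po (cells (Fil X m) bdry m) (cells (Fil X m) rep m) (cells X bdry m) (latch X m)
    (AR.incl (cells (Fil X m) bdry m) (cells (Fil X m) rep m)) (AR.incl (cells (Fil X m) bdry m) (cells X bdry m))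
    (AR.incl (cells (Fil X m) rep m) (latch X m)) (AR.incl (cells X bdry m) (latch X m))"
proof (rule AR.union_square)
  fix c assume c: "c \<in> Obj AR_cat"
  obtain a s where as: "c = (a, s)" "a \<in> Obj A" "s \<in> Obj R" using c by auto
  show "Ev (cells (Fil X m) rep m) c \<inter> Ev (cells X bdry m) c \<subseteq> Ev (cells (Fil X m) bdry m) c"
  proof (rule subsetI)
    fix z assume z: "z \<in> Ev (cells (Fil X m) rep m) c \<inter> Ev (cells X bdry m) c"
    obtain r x v where 1: "z = vpair (enc (Idt R r), vpair (x, v))" "r \<in> Obj R" "deg r = m" "x \<in> Ev (Fil X m) (a, r)"
      using z unfolding as(1) Ev_cells[OF as(2,3)] by blast
    obtain r' x' v' where 2: "z = vpair (enc (Idt R r'), vpair (x', v'))" "r' \<in> Obj R" "v' \<in> Ev (bdry r') s"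
      using z unfolding as(1) Ev_cells[OF as(2,3)] by blast
    have "r = r'" "v = v'" using 1(1,2) 2(1,2) by auto
    then show "z \<in> Ev (cells (Fil X m) bdry m) c" unfolding as(1) Ev_cells[OF as(2,3)] using 1 2(3) by blast
  qed
  show "Ev (latch X m) c \<subseteq> Ev (cells (Fil X m) rep m) c \<union> Ev (cells X bdry m) c"
    using c by (simp add: latch_def latch_set_def del: prod_cat_simps)
qed (use latch_facts[OF X] in auto)

text \<open>The map given by the elements of \<open>X\<^sub>r\<close> under the Yoneda lemma: a pair
  of \<open>x\<close> and \<open>\<phi>\<close> goes to the restriction of \<open>x\<close> along
  \<open>\<phi>\<close>. It is a raw function since it is used on all cells and on the latching
  domain.\<close>

definition cell_att where
  "cell_att X = (\<lambda>(a, s) z. act_R X a (dec (snd (inv vpair (snd (inv vpair z))))) (fst (inv vpair (snd (inv vpair z)))))"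

abbreviation "attach X m \<equiv> mk_trans AR_cat (cells X rep m) (Fil X (Suc m)) (cell_att X)"

abbreviation "attach_latch X m \<equiv> mk_trans AR_cat (latch X m) (Fil X m) (cell_att X)"

lemma cell_att [simp]: "\<phi> \<in> Arr R \<Longrightarrow> cell_att X (a, s) (vpair (i, vpair (x, enc \<phi>))) = act_R X a \<phi> x"
  by (simp add: cell_att_def)

lemma cells_rep_elim:
  assumes "z \<in> Ev (cells Z rep m) (a, s)" "a \<in> Obj A" "s \<in> Obj R"
  obtains \<phi> x where "z = vpair (enc (Idt R (Cod R \<phi>)), vpair (x, enc \<phi>))" "\<phi> \<in> Arr R" "Dom R \<phi> = s" "deg (Cod R \<phi>) = m"
    "x \<in> Ev Z (a, Cod R \<phi>)"
  using assms(1) unfolding Ev_cells[OF assms(2,3)] Ev_rep[OF assms(3)] by auto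

lemma cell_att_hom:
  assumes X: "presheaf U AR_cat X"
  shows "attach X m \<in> hom AR.B (cells X rep m) (Fil X (Suc m))"
proof (rule AR.mk_trans_hom[OF presheaf_cells[OF X presheaf_rep] presheaf_Fil[OF X]])
  fix c z assume c: "c \<in> Obj AR_cat" and z: "z \<in> Ev (cells X rep m) c"
  obtain a s where as: "c = (a, s)" "a \<in> Obj A" "s \<in> Obj R" using c by auto
  obtain \<phi> x where f: "z = vpair (enc (Idt R (Cod R \<phi>)), vpair (x, enc \<phi>))" "\<phi> \<in> Arr R" "Dom R \<phi> = s" "deg (Cod R \<phi>) = m"
    "x \<in> Ev X (a, Cod R \<phi>)" by (rule cells_rep_elim[OF z[unfolded as(1)] as(2,3)])
  show "cell_att X c z \<in> Ev (Fil X (Suc m)) c"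
    using FsetI[OF f(2,5), of "Suc m"] f as by simp
next
  fix g z assume g: "g \<in> Arr AR_cat" and z: "z \<in> Ev (cells X rep m) (Cod AR_cat g)"
  obtain u \<psi> where u: "g = (u, \<psi>)" "u \<in> Arr A" "\<psi> \<in> Arr R" using g by auto
  note o = A.base_arr[OF u(2)] R.base_arr[OF u(3)]
  obtain \<phi> x where f: "z = vpair (enc (Idt R (Cod R \<phi>)), vpair (x, enc \<phi>))" "\<phi> \<in> Arr R" "Dom R \<phi> = Cod R \<psi>" "deg (Cod R \<phi>) = m"
    "x \<in> Ev X (Cod A u, Cod R \<phi>)" by (rule cells_rep_elim[OF _ o(2,4)]) (use z u in auto)
  note of = R.base_arr[OF f(2)] and c = R.base_cmp[OF u(3) f(2) f(3)[symmetric]]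
  have e: "enc \<phi> \<in> Ev (rep (Cod R \<phi>)) (Cod R \<psi>)" using f o by (simp add: Ev_rep)
  have ux: "act_A X u (Cod R \<phi>) x \<in> Ev X (Dom A u, Cod R \<phi>)" using act_A_in[OF X u(2) of(2) f(5)] .
  have rx: "act_R X (Cod A u) \<phi> x \<in> Ev X (Cod A u, Cod R \<psi>)" using act_R_in[OF X o(2) f(2,5)] f(3) by simp
  have "act_R X (Cod A u) \<phi> x \<in> Fset X (Suc m) (Cod A u, Cod R \<psi>)" using FsetI[OF f(2,5), of "Suc m"] f by simp
  then have 1: "Act (Fil X (Suc m)) (u, \<psi>) (act_R X (Cod A u) \<phi> x) = Act X (u, \<psi>) (act_R X (Cod A u) \<phi> x)"
    using u unfolding Fil_def by (subst AR.restr_simps) auto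
  have "cell_att X (Dom A u, Dom R \<psi>) (Act (cells X rep m) (u, \<psi>) z) = act_R X (Dom A u) (\<phi> \<cdot>\<^bsub>R\<^esub> \<psi>) (act_A X u (Cod R \<phi>) x)"
    unfolding f(1) Act_cells[of u \<psi> "Cod R \<phi>" m x X "enc \<phi>" rep, OF u(2,3) of(2) f(4,5) e] Act_rep[OF u(3) f(2,3) refl]
    using c by simp
  also have "\<dots> = act_R X (Dom A u) \<psi> (act_R X (Dom A u) \<phi> (act_A X u (Cod R \<phi>) x))"
    using act_R_cmp[OF X o(1) u(3) f(2) f(3)[symmetric] ux] .
  also have "\<dots> = act_R X (Dom A u) \<psi> (act_A X u (Cod R \<psi>) (act_R X (Cod A u) \<phi> x))"
    using Act_factors[OF X u(2) f(2,5)] f(3) by simp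
  also have "\<dots> = Act X (u, \<psi>) (act_R X (Cod A u) \<phi> x)" using Act_factors(1)[OF X u(2,3) rx] by simp
  finally show "cell_att X (Dom AR_cat g) (Act (cells X rep m) g z) = Act (Fil X (Suc m)) g (cell_att X (Cod AR_cat g) z)"
    unfolding u(1) using 1 f by simp
qed

text \<open>Either coordinate can lower the degree: \<open>x\<close> itself comes from below degree
  \<open>m\<close>, or the arrow factors through an object of degree below \<open>m\<close>, and so
  does the restriction of \<open>x\<close>.\<close>

lemma cell_att_latch:
  assumes X: "presheaf U AR_cat X" and as: "a \<in> Obj A" "s \<in> Obj R" and z: "z \<in> latch_set X m (a, s)"
  shows "cell_att X (a, s) z \<in> Fset X m (a, s)"
  using z unfolding latch_set_def
proof
  assume "z \<in> Ev (cells (Fil X m) rep m) (a, s)"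
  then obtain \<phi> x where f: "z = vpair (enc (Idt R (Cod R \<phi>)), vpair (x, enc \<phi>))" "\<phi> \<in> Arr R" "Dom R \<phi> = s" "deg (Cod R \<phi>) = m"
    "x \<in> Ev (Fil X m) (a, Cod R \<phi>)" by (rule cells_rep_elim[OF _ as])
  have "x \<in> Fset X m (a, Cod R \<phi>)" using f as R.base_arr[OF f(2)] by simp
  then show ?thesis
    using Fset_Act[OF X A.base_id(1)[OF as(1)] f(2), of x m] A.base_id[OF as(1)] f by (simp add: act_R_def)
next
  assume "z \<in> Ev (cells X bdry m) (a, s)"
  then obtain r x v where zz: "z = vpair (enc (Idt R r), vpair (x, v))" "r \<in> Obj R" "deg r = m" "x \<in> Ev X (a, r)" "v \<in> bdry_set r s"
    unfolding Ev_cells[OF as] by (auto simp: bdry_simps(1)[OF as(2)])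
  obtain \<phi> \<alpha> \<beta> where f: "v = enc \<phi>" "\<phi> \<in> Arr R" "Dom R \<phi> = s" "Cod R \<phi> = r" and
    ab: "\<alpha> \<in> Arr R" "\<beta> \<in> Arr R" "Cod R \<alpha> = Dom R \<beta>" "deg (Cod R \<alpha>) < deg r" "\<phi> = \<beta> \<cdot>\<^bsub>R\<^esub> \<alpha>"
    using zz(5) unfolding bdry_set_def by auto
  have cd: "Cod R \<beta> = r" "Dom R \<alpha> = s" using R.base_cmp[OF ab(1,2,3)] ab(5) f by auto
  have bx: "act_R X a \<beta> x \<in> Ev X (a, Cod R \<alpha>)" using act_R_in[OF X as(1) ab(2), of x] zz(4) cd ab(3) by simp
  have "cell_att X (a, s) z = act_R X a \<alpha> (act_R X a \<beta> x)"
    using act_R_cmp[OF X as(1) ab(1,2,3), of x] zz cd f ab(5) by simp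
  then show ?thesis using FsetI[OF ab(1) bx, of m] ab(4) zz(3) cd by simp
qed

text \<open>A cell outside the latching domain is a pair of an arrow of \<open>Rm\<close> and a
  nondegenerate element, and attaching it forms the element with this decomposition. Injectivity on
  such cells and disjointness from the lower skeleton are thus both instances of
  \<open>unique_decomposition\<close>.\<close>

lemma cell_square:
  assumes X: "presheaf U AR_cat X" and rc: "reedy_cof X"
  shows "AR.ptwise_po (latch X m) (cells X rep m) (Fil X m) (Fil X (Suc m))
    (AR.incl (latch X m) (cells X rep m)) (attach_latch X m)
    (attach X m) (AR.incl (Fil X m) (Fil X (Suc m)))"
  unfolding AR.ptwise_po_def
proof (intro conjI ballI)
  show "AR.incl (latch X m) (cells X rep m) \<in> hom AR.B (latch X m) (cells X rep m)"
    by (rule AR.incl_hom[OF sub_latch[OF X]])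
  show "AR.incl (Fil X m) (Fil X (Suc m)) \<in> hom AR.B (Fil X m) (Fil X (Suc m))"
    by (rule AR.incl_hom[OF subpresheaf_Fil_le[OF X]]) simp
  show "attach X m \<in> hom AR.B (cells X rep m) (Fil X (Suc m))"
    by (rule cell_att_hom[OF X])
  show "attach_latch X m \<in> hom AR.B (latch X m) (Fil X m)"
  proof (rule AR.sub_map_hom[OF sub_latch[OF X] subpresheaf_Fil_le[OF X] cell_att_hom[OF X]])
    show "cell_att X c z \<in> Ev (Fil X m) c" if "c \<in> Obj AR_cat" "z \<in> Ev (latch X m) c" for c z
      using that cell_att_latch[OF X] by (auto simp: latch_def)
  qed simp
  fix c assume c: "c \<in> Obj AR_cat"
  obtain a s where as: "c = (a, s)" "a \<in> Obj A" "s \<in> Obj R" using c by auto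
  have EvL: "Ev (latch X m) c = latch_set X m c" using c by (simp add: latch_def del: prod_cat_simps)
  have Lsub: "latch_set X m c \<subseteq> Ev (cells X rep m) c"
    using sub_latch[OF X, of m] c EvL unfolding AR.subpresheaf_def by auto
  have EvF: "Ev (Fil X n) c = Fset X n c" for n using as by simp
  show "Cpt (attach X m) c (Cpt (AR.incl (latch X m) (cells X rep m)) c x) =
     Cpt (AR.incl (Fil X m) (Fil X (Suc m))) c (Cpt (attach_latch X m) c x)"
    if x: "x \<in> Ev (latch X m) c" for x
    using c x Lsub EvL EvF cell_att_latch[OF X as(2,3), of x m] as(1) by (auto simp del: prod_cat_simps)
  show "inj_on (Cpt (AR.incl (Fil X m) (Fil X (Suc m))) c) (Ev (Fil X m) c)" by (rule AR.incl_inj[OF c])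
  have D: "Ev (cells X rep m) c - Cpt (AR.incl (latch X m) (cells X rep m)) c ` Ev (latch X m) c = Ev (cells X rep m) c - latch_set X m c"
    unfolding AR.incl_image[OF c] unfolding EvL ..
  have nd: "\<exists>\<phi> x. z = vpair (enc (Idt R (Cod R \<phi>)), vpair (x, enc \<phi>)) \<and> \<phi> \<in> Rm \<and> Dom R \<phi> = s \<and> deg (Cod R \<phi>) = m \<and> x \<in> nondeg X (Cod R \<phi>) a \<and>
       cell_att X c z = act_R X a \<phi> x"
    if z: "z \<in> Ev (cells X rep m) c - latch_set X m c" for z
  proof -
    obtain \<phi> x where f: "z = vpair (enc (Idt R (Cod R \<phi>)), vpair (x, enc \<phi>))" "\<phi> \<in> Arr R" "Dom R \<phi> = s" "deg (Cod R \<phi>) = m"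
      "x \<in> Ev X (a, Cod R \<phi>)" by (rule cells_rep_elim[OF _ as(2,3)]) (use z as in auto)
    note o = R.base_arr[OF f(2)]
    have "x \<notin> Fset X m (a, Cod R \<phi>)"
    proof
      assume "x \<in> Fset X m (a, Cod R \<phi>)"
      then have "z \<in> Ev (cells (Fil X m) rep m) (a, s)"
        unfolding Ev_cells[OF as(2,3)] Ev_rep[OF as(3)] using f as o by auto
      then show False using z unfolding latch_set_def as(1) by blast
    qed
    then have x: "x \<in> nondeg X (Cod R \<phi>) a" using f by (simp add: nondeg_def)
    have "enc \<phi> \<notin> bdry_set (Cod R \<phi>) (Dom R \<phi>)"
    proof
      assume "enc \<phi> \<in> bdry_set (Cod R \<phi>) (Dom R \<phi>)"
      then have "z \<in> Ev (cells X bdry m) (a, s)"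
        unfolding Ev_cells[OF as(2,3)] bdry_simps(1)[OF as(3)] using f as o by auto
      then show False using z unfolding latch_set_def as(1) by blast
    qed
    then have "\<phi> \<in> Rm" using bdry_deg[OF f(2) refl] by simp
    moreover have "cell_att X c z = act_R X a \<phi> x" using f as by simp
    ultimately show ?thesis using f x by blast
  qed
  note un = unique_decomposition[OF X rc as(3), unfolded unique_decomposition_def, rule_format, OF as(2)]
  have im: "Cpt (attach X m) c z = cell_att X c z"
    if "z \<in> Ev (cells X rep m) c" for z using c that by (simp del: prod_cat_simps)
  show "inj_on (Cpt (attach X m) c)
     (Ev (cells X rep m) c - Cpt (AR.incl (latch X m) (cells X rep m)) c ` Ev (latch X m) c)"
    unfolding D
  proof (rule inj_onI)
    fix z z' assume z: "z \<in> Ev (cells X rep m) c - latch_set X m c" and z': "z' \<in> Ev (cells X rep m) c - latch_set X m c"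
      and e: "Cpt (attach X m) c z = Cpt (attach X m) c z'"
    obtain \<phi> x where f: "z = vpair (enc (Idt R (Cod R \<phi>)), vpair (x, enc \<phi>))" "\<phi> \<in> Rm" "Dom R \<phi> = s" "x \<in> nondeg X (Cod R \<phi>) a" "cell_att X c z = act_R X a \<phi> x"
      using nd[OF z] by blast
    obtain \<phi>' x' where f': "z' = vpair (enc (Idt R (Cod R \<phi>')), vpair (x', enc \<phi>'))" "\<phi>' \<in> Rm" "Dom R \<phi>' = s" "x' \<in> nondeg X (Cod R \<phi>') a" "cell_att X c z' = act_R X a \<phi>' x'"
      using nd[OF z'] by blast
    have "act_R X a \<phi> x = act_R X a \<phi>' x'" using e im z z' f(5) f'(5) by simp
    then have "\<phi> = \<phi>' \<and> x = x'" by (rule un[OF f(2) f'(2) f(3) f'(3) f(4) f'(4)])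
    then show "z = z'" using f(1) f'(1) by simp
  qed
  show "Cpt (AR.incl (Fil X m) (Fil X (Suc m))) c ` Ev (Fil X m) c \<inter>
     Cpt (attach X m) c `
       (Ev (cells X rep m) c - Cpt (AR.incl (latch X m) (cells X rep m)) c ` Ev (latch X m) c) = {}"
    unfolding D unfolding AR.incl_image[OF c] unfolding EvF
  proof (rule equals0I)
    fix y assume "y \<in> Fset X m c \<inter> Cpt (attach X m) c ` (Ev (cells X rep m) c - latch_set X m c)"
    then obtain z where z: "z \<in> Ev (cells X rep m) c - latch_set X m c" and y: "cell_att X c z \<in> Fset X m c" using im by auto
    obtain \<phi> x where f: "\<phi> \<in> Rm" "Dom R \<phi> = s" "deg (Cod R \<phi>) = m" "x \<in> nondeg X (Cod R \<phi>) a" "cell_att X c z = act_R X a \<phi> x"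
      using nd[OF z] by blast
    \<comment> \<open>Lying in the skeleton below \<open>m\<close>, the same element also decomposes
      through an object of degree less than \<open>m\<close>; uniqueness then contradicts
      \<open>deg (Cod R \<phi>) = m\<close>.\<close>
    obtain \<sigma> w where w: "\<sigma> \<in> Rm" "Dom R \<sigma> = s" "w \<in> nondeg X (Cod R \<sigma>) a" "act_R X a \<phi> x = act_R X a \<sigma> w" "deg (Cod R \<sigma>) < m"
      using Fset_decomposition[OF X as(2)] y f(5) as(1) by metis
    have "\<phi> = \<sigma> \<and> x = w" by (rule un[OF f(1) w(1) f(2) w(2) f(4) w(3,4)])
    then show False using w(5) f(3) by simp
  qed
  show "Ev (Fil X (Suc m)) c \<subseteq> Cpt (AR.incl (Fil X m) (Fil X (Suc m))) c ` Ev (Fil X m) c \<union>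
     Cpt (attach X m) c `
       (Ev (cells X rep m) c - Cpt (AR.incl (latch X m) (cells X rep m)) c ` Ev (latch X m) c)"
    unfolding D unfolding AR.incl_image[OF c] unfolding EvF
  proof (rule subsetI)
    fix y assume y: "y \<in> Fset X (Suc m) c"
    show "y \<in> Fset X m c \<union> Cpt (attach X m) c ` (Ev (cells X rep m) c - latch_set X m c)"
    proof (cases "y \<in> Fset X m c")
      case False
      obtain \<phi> x where f: "\<phi> \<in> Arr R" "x \<in> Ev X (a, Cod R \<phi>)" "Dom R \<phi> = s" "deg (Cod R \<phi>) < Suc m" "y = act_R X a \<phi> x"
        using y unfolding as(1) Fset_def by auto
      have "\<not> deg (Cod R \<phi>) < m" using False FsetI[OF f(1,2), of m] f(3,5) as(1) by auto
      then have d: "deg (Cod R \<phi>) = m" using f(4) by simp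
      define z where "z = vpair (enc (Idt R (Cod R \<phi>)), vpair (x, enc \<phi>))"
      have z: "z \<in> Ev (cells X rep m) c" unfolding as(1) Ev_cells[OF as(2,3)] Ev_rep[OF as(3)] z_def
        using f d R.base_arr[OF f(1)] by auto
      have qz: "cell_att X c z = y" unfolding z_def as(1) using f by simp
      then have "z \<notin> latch_set X m c" using cell_att_latch[OF X as(2,3), of z m] False as(1) by auto
      then show ?thesis using z qz im by (intro UnI2 image_eqI[of _ _ z]) auto
    qed simp
  qed
qed

end

section \<open>Comparison of skeleta by gluing, latching maps, and passage to the colimit\<close>

section \<open>Induction over the skeleta\<close>

locale cell_induction = reedy_setting U A R cof we deg Rm Rp enc + cellular_functor U A R cof we \<Phi>
  for U :: "'v set set" and A :: "('a, 'b) cat" and R :: "('r, 's) cat" and cof we deg Rm Rp enc \<Phi>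
begin

text \<open>Nothing is known about elements in the values of \<open>\<Phi>\<close>, so commutativity
  is verified on elements before \<open>\<Phi>\<close> is applied and then transported.\<close>

lemma \<Phi>_square:
  assumes t: "t \<in> hom AR.B X Y" and s: "s \<in> hom AR.B Y Z" and t': "t' \<in> hom AR.B X Y'" and s': "s' \<in> hom AR.B Y' Z"
    and eq: "\<And>c x. c \<in> Obj AR_cat \<Longrightarrow> x \<in> Ev X c \<Longrightarrow> Cpt s c (Cpt t c x) = Cpt s' c (Cpt t' c x)"
  shows "Far \<Phi> s \<cdot>\<^bsub>A.B\<^esub> Far \<Phi> t = Far \<Phi> s' \<cdot>\<^bsub>A.B\<^esub> Far \<Phi> t'"
proof -
  have "s \<cdot>\<^bsub>AR.B\<^esub> t = s' \<cdot>\<^bsub>AR.B\<^esub> t'"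
    by (rule AR.homB_eqI[OF AR.B_comp_hom[OF t s] AR.B_comp_hom[OF t' s']])
      (simp add: AR.Cpt_cmp[OF t] AR.Cpt_cmp[OF t'] eq del: prod_cat_simps)
  then show ?thesis using \<Phi>_comp[OF t s] \<Phi>_comp[OF t' s'] by simp
qed

lemma gluing_cellular:
  assumes p: "AR.ptwise_po P Q F G i g g' i'" and p': "AR.ptwise_po P' Q' F' G' j k k' j'"
    and inj: "\<And>c. c \<in> Obj AR_cat \<Longrightarrow> inj_on (Cpt i c) (Ev P c)" "\<And>c. c \<in> Obj AR_cat \<Longrightarrow> inj_on (Cpt j c) (Ev P' c)"
    and \<alpha>: "\<alpha> \<in> hom AR.B P P'" "Far \<Phi> \<alpha> \<in> we" and \<beta>: "\<beta> \<in> hom AR.B Q Q'" "Far \<Phi> \<beta> \<in> we"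
    and \<gamma>: "\<gamma> \<in> hom AR.B F F'" "Far \<Phi> \<gamma> \<in> we" and \<delta>: "\<delta> \<in> hom AR.B G G'"
    and e: "\<And>c x. c \<in> Obj AR_cat \<Longrightarrow> x \<in> Ev P c \<Longrightarrow> Cpt \<beta> c (Cpt i c x) = Cpt j c (Cpt \<alpha> c x)"
      "\<And>c x. c \<in> Obj AR_cat \<Longrightarrow> x \<in> Ev P c \<Longrightarrow> Cpt \<gamma> c (Cpt g c x) = Cpt k c (Cpt \<alpha> c x)"
      "\<And>c x. c \<in> Obj AR_cat \<Longrightarrow> x \<in> Ev Q c \<Longrightarrow> Cpt \<delta> c (Cpt g' c x) = Cpt k' c (Cpt \<beta> c x)"
      "\<And>c x. c \<in> Obj AR_cat \<Longrightarrow> x \<in> Ev F c \<Longrightarrow> Cpt \<delta> c (Cpt i' c x) = Cpt j' c (Cpt \<gamma> c x)"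
  shows "Far \<Phi> \<delta> \<in> we"
proof -
  have h: "i \<in> hom AR.B P Q" "g \<in> hom AR.B P F" "g' \<in> hom AR.B Q G" "i' \<in> hom AR.B F G"
    using p unfolding AR.ptwise_po_def by auto
  have h': "j \<in> hom AR.B P' Q'" "k \<in> hom AR.B P' F'" "k' \<in> hom AR.B Q' G'" "j' \<in> hom AR.B F' G'"
    using p' unfolding AR.ptwise_po_def by auto
  show ?thesis
    by (rule H.gluing[OF \<Phi>_cof[OF h(1) inj(1)] \<Phi>_cof[OF h'(1) inj(2)] \<Phi>_po[OF p] \<Phi>_po[OF p']
        \<Phi>_hom[OF \<alpha>(1)] \<alpha>(2) \<Phi>_hom[OF \<beta>(1)] \<beta>(2) \<Phi>_hom[OF \<gamma>(1)] \<gamma>(2)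
        \<Phi>_square[OF h(1) \<beta>(1) \<alpha>(1) h'(1) e(1)] \<Phi>_square[OF h(2) \<gamma>(1) \<alpha>(1) h'(2) e(2)] \<Phi>_hom[OF \<delta>]
        \<Phi>_square[OF h(3) \<delta> \<beta>(1) h'(3) e(3)] \<Phi>_square[OF h(4) \<delta> \<gamma>(1) h'(4) e(4)]])
qed

definition cells_map :: "('a \<times> 'r, 'b \<times> 's, 'v) nat_trans \<Rightarrow> ('a \<times> 'r, 'b \<times> 's, 'v) presh \<Rightarrow> ('a \<times> 'r, 'b \<times> 's, 'v) presh \<Rightarrow> ('r \<Rightarrow> ('r, 's, 'v) presh) \<Rightarrow> nat \<Rightarrow> ('a \<times> 'r, 'b \<times> 's, 'v) nat_trans" where
  "cells_map t Z Z' L m = mk_trans AR_cat (cells Z L m) (cells Z' L m) (cmap t)"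

lemma Cpt_cells_map: "c \<in> Obj AR_cat \<Longrightarrow> z \<in> Ev (cells Z L m) c \<Longrightarrow> Cpt (cells_map t Z Z' L m) c z = cmap t c z"
  by (simp add: cells_map_def del: prod_cat_simps)

text \<open>Only objects of degree \<open>m\<close> contribute, so \<open>t\<close> has to be a weak
  equivalence there and nowhere else; this restriction is what keeps the induction on degrees well
  founded.\<close>

lemma cells_we:
  assumes t: "t \<in> hom AR.B Z Z'" and L: "\<And>r. r \<in> Obj R \<Longrightarrow> presheaf U R (L r)"
    and w: "\<And>r. r \<in> Obj R \<Longrightarrow> deg r = m \<Longrightarrow> slice_map A R t r \<in> we"
  shows "Far \<Phi> (cells_map t Z Z' L m) \<in> we"
proof (rule copr_we[OF cell_index_U, where X = "\<lambda>i. ext_prod_obj A R (L (ob i)) (slice_obj A R Z (ob i))"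
      and Y = "\<lambda>i. ext_prod_obj A R (L (ob i)) (slice_obj A R Z' (ob i))"
      and t = "\<lambda>i. Far (ext_prod A R (L (ob i))) (slice_map A R t (ob i))"])
  show "cells_map t Z Z' L m \<in> hom AR.B (AR.copr (cell_index m) (\<lambda>i. ext_prod_obj A R (L (ob i)) (slice_obj A R Z (ob i))))
     (AR.copr (cell_index m) (\<lambda>i. ext_prod_obj A R (L (ob i)) (slice_obj A R Z' (ob i))))"
    using cmap_hom[OF t L] unfolding cells_map_def cells_def .
  have i: "ob i \<in> Obj R \<and> deg (ob i) = m \<and> i = enc (Idt R (ob i))" if "i \<in> cell_index m" for i
    using that unfolding cell_index_def by auto
  show "Far (ext_prod A R (L (ob i))) (slice_map A R t (ob i)) \<in>
      hom AR.B (ext_prod_obj A R (L (ob i)) (slice_obj A R Z (ob i))) (ext_prod_obj A R (L (ob i)) (slice_obj A R Z' (ob i)))"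
    if "i \<in> cell_index m" for i
    using ext_prod_hom[OF L slice_hom[OF t]] i[OF that] by blast
  show "Far \<Phi> (Far (ext_prod A R (L (ob i))) (slice_map A R t (ob i))) \<in> we" if "i \<in> cell_index m" for i
    using \<Phi>_ext_prod[OF L w] i[OF that] by blast
  fix c i x assume c: "c \<in> Obj AR_cat" and ii: "i \<in> cell_index m"
    and x: "x \<in> Ev (ext_prod_obj A R (L (ob i)) (slice_obj A R Z (ob i))) c"
  obtain a s where as: "c = (a, s)" "a \<in> Obj A" "s \<in> Obj R" using c by auto
  obtain y v where y: "x = vpair (y, v)" "y \<in> Ev Z (a, ob i)" "v \<in> Ev (L (ob i)) s"
    using x as by (auto simp: Ev_ext_prod)
  have ix: "vpair (i, x) \<in> Ev (cells Z L m) c"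
    unfolding as(1) Ev_cells[OF as(2,3)] y(1) mem_Collect_eq
    by (rule exI[of _ "ob i"], rule exI[of _ y], rule exI[of _ v]) (use i[OF ii] y(2,3) in simp)
  have "cmap t c (vpair (i, x)) = vpair (i, vpair (Cpt t (a, ob i) y, v))"
    unfolding as(1) y(1) by (simp add: cmap_def)
  moreover have "Cpt (Far (ext_prod A R (L (ob i))) (slice_map A R t (ob i))) c x = vpair (Cpt t (a, ob i) y, v)"
    unfolding as(1) y(1)
    using Cpt_ext_prod[OF slice_hom[OF t, of "ob i"] as(2,3), of y v "L (ob i)"] i[OF ii] y as by simp
  ultimately show "Cpt (cells_map t Z Z' L m) c (vpair (i, x)) = vpair (i, Cpt (Far (ext_prod A R (L (ob i))) (slice_map A R t (ob i))) c x)"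
    using Cpt_cells_map[OF c ix] by simp
qed

lemma cmap_Fmap:
  assumes c: "c \<in> Obj AR_cat" and z: "z \<in> Ev (cells (Fil X m) L m) c"
  shows "cmap (Fmap f X Y m) c z = cmap f c z"
proof -
  obtain a s where as: "c = (a, s)" "a \<in> Obj A" "s \<in> Obj R" using c by auto
  obtain r x v where zz: "z = vpair (enc (Idt R r), vpair (x, v))" "r \<in> Obj R" "x \<in> Ev (Fil X m) (a, r)"
    using z unfolding as(1) Ev_cells[OF as(2,3)] by blast
  have "Cpt (Fmap f X Y m) (a, r) x = Cpt f (a, r) x" by (rule Cpt_Fmap) (use zz as in auto)
  then show ?thesis unfolding as(1) zz(1) by (simp add: zz(2))
qed

lemma cells_map_hom:
  "t \<in> hom AR.B Z Z' \<Longrightarrow> (\<And>r. r \<in> Obj R \<Longrightarrow> presheaf U R (L r)) \<Longrightarrow> cells_map t Z Z' L m \<in> hom AR.B (cells Z L m) (cells Z' L m)"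
  unfolding cells_map_def by (rule cmap_hom)

definition latch_map :: "('a \<times> 'r, 'b \<times> 's, 'v) nat_trans \<Rightarrow> ('a \<times> 'r, 'b \<times> 's, 'v) presh \<Rightarrow> ('a \<times> 'r, 'b \<times> 's, 'v) presh \<Rightarrow> nat \<Rightarrow> ('a \<times> 'r, 'b \<times> 's, 'v) nat_trans" where
  "latch_map f X Y m = mk_trans AR_cat (latch X m) (latch Y m) (cmap f)"

context
  fixes f X Y
  assumes f: "f \<in> hom AR.B X Y"
begin

lemma presheaf_src: "presheaf U AR_cat X" and presheaf_tgt: "presheaf U AR_cat Y" using AR.homB_presheaf[OF f] by auto

lemma Ev_latch: "c \<in> Obj AR_cat \<Longrightarrow> Ev (latch Z m) c = latch_set Z m c"
  by (simp add: latch_def del: prod_cat_simps)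

lemma cmap_rep:
  assumes c: "c \<in> Obj AR_cat" and z: "z \<in> Ev (cells (Fil X m) rep m) c"
  shows "cmap f c z \<in> Ev (cells (Fil Y m) rep m) c"
  using AR.Cpt_in[OF cells_map_hom[OF Fmap_hom[OF f] presheaf_rep] c z] Cpt_cells_map[OF c z] cmap_Fmap[OF c z] by simp

lemma cmap_bdry:
  assumes c: "c \<in> Obj AR_cat" and z: "z \<in> Ev (cells X bdry m) c"
  shows "cmap f c z \<in> Ev (cells Y bdry m) c"
  using AR.Cpt_in[OF cells_map_hom[OF f presheaf_bdry] c z] Cpt_cells_map[OF c z] by simp

lemma latch_map_hom: "latch_map f X Y m \<in> hom AR.B (latch X m) (latch Y m)"
  unfolding latch_map_def
proof (rule AR.sub_map_hom[OF sub_latch[OF presheaf_src] sub_latch[OF presheaf_tgt] cmap_hom[OF f presheaf_rep]])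
  fix c z assume c: "c \<in> Obj AR_cat" and z: "z \<in> Ev (latch X m) c"
  show "cmap f c z \<in> Ev (latch Y m) c"
    using z cmap_rep[OF c] cmap_bdry[OF c] unfolding Ev_latch[OF c] latch_set_def by blast
qed

lemma Cpt_latch_map: "c \<in> Obj AR_cat \<Longrightarrow> z \<in> latch_set X m c \<Longrightarrow> Cpt (latch_map f X Y m) c z = cmap f c z"
  by (simp add: latch_map_def latch_def del: prod_cat_simps)

text \<open>Gluing over \<open>latch_square\<close>. The two corners built on the skeleton rest on
  the comparison of latching objects in \<open>wF\<close>, the corner built on \<open>X\<close>
  itself rests on \<open>wf\<close>.\<close>

lemma latch_we:
  assumes wF: "\<And>r. r \<in> Obj R \<Longrightarrow> deg r = m \<Longrightarrow> slice_map A R (Fmap f X Y m) r \<in> we"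
    and wf: "\<And>r. r \<in> Obj R \<Longrightarrow> deg r = m \<Longrightarrow> slice_map A R f r \<in> we"
  shows "Far \<Phi> (latch_map f X Y m) \<in> we"
proof (rule gluing_cellular[OF latch_square[OF presheaf_src] latch_square[OF presheaf_tgt] AR.incl_inj AR.incl_inj
      cells_map_hom[OF Fmap_hom[OF f] presheaf_bdry] cells_we[OF Fmap_hom[OF f] presheaf_bdry wF]
      cells_map_hom[OF Fmap_hom[OF f] presheaf_rep] cells_we[OF Fmap_hom[OF f] presheaf_rep wF]
      cells_map_hom[OF f presheaf_bdry] cells_we[OF f presheaf_bdry wf] latch_map_hom])
  fix c z assume c: "c \<in> Obj AR_cat"
  have sub: "Ev (cells (Fil X m) bdry m) c \<subseteq> Ev (cells (Fil X m) rep m) c" "Ev (cells (Fil X m) bdry m) c \<subseteq> Ev (cells X bdry m) c"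
    using sub_bdry_rep_Fil[OF presheaf_src, of m] sub_bdry_Fil[OF presheaf_src, of m] c unfolding AR.subpresheaf_def by blast+
  have Fb: "cmap f c z \<in> Ev (cells (Fil Y m) bdry m) c" if "z \<in> Ev (cells (Fil X m) bdry m) c" for z
    using AR.Cpt_in[OF cells_map_hom[OF Fmap_hom[OF f] presheaf_bdry] c that] Cpt_cells_map[OF c that] cmap_Fmap[OF c that] by simp
  {
    assume z: "z \<in> Ev (cells (Fil X m) bdry m) c"
    note 1 = subsetD[OF sub(1) z] subsetD[OF sub(2) z] Fb[OF z]
    show "Cpt (cells_map (Fmap f X Y m) (Fil X m) (Fil Y m) rep m) c (Cpt (AR.incl (cells (Fil X m) bdry m) (cells (Fil X m) rep m)) c z) =
       Cpt (AR.incl (cells (Fil Y m) bdry m) (cells (Fil Y m) rep m)) c (Cpt (cells_map (Fmap f X Y m) (Fil X m) (Fil Y m) bdry m) c z)"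
      using z 1 by (simp add: AR.Cpt_incl[OF c] Cpt_cells_map[OF c] cmap_Fmap[OF c])
    show "Cpt (cells_map f X Y bdry m) c (Cpt (AR.incl (cells (Fil X m) bdry m) (cells X bdry m)) c z) =
       Cpt (AR.incl (cells (Fil Y m) bdry m) (cells Y bdry m)) c (Cpt (cells_map (Fmap f X Y m) (Fil X m) (Fil Y m) bdry m) c z)"
      using z 1 by (simp add: AR.Cpt_incl[OF c] Cpt_cells_map[OF c] cmap_Fmap[OF c])
  next
    assume z: "z \<in> Ev (cells (Fil X m) rep m) c"
    then have "z \<in> latch_set X m c" by (simp add: latch_set_def)
    then show "Cpt (latch_map f X Y m) c (Cpt (AR.incl (cells (Fil X m) rep m) (latch X m)) c z) =
       Cpt (AR.incl (cells (Fil Y m) rep m) (latch Y m)) c (Cpt (cells_map (Fmap f X Y m) (Fil X m) (Fil Y m) rep m) c z)"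
      using z cmap_rep[OF c z] by (simp add: AR.Cpt_incl[OF c] Cpt_cells_map[OF c] cmap_Fmap[OF c] Cpt_latch_map[OF c])
  next
    assume z: "z \<in> Ev (cells X bdry m) c"
    then have "z \<in> latch_set X m c" by (simp add: latch_set_def)
    then show "Cpt (latch_map f X Y m) c (Cpt (AR.incl (cells X bdry m) (latch X m)) c z) =
       Cpt (AR.incl (cells Y bdry m) (latch Y m)) c (Cpt (cells_map f X Y bdry m) c z)"
      using z cmap_bdry[OF c z] by (simp add: AR.Cpt_incl[OF c] Cpt_cells_map[OF c] Cpt_latch_map[OF c])
  }
qed

lemma cell_att_nat:
  assumes c: "c \<in> Obj AR_cat" and z: "z \<in> Ev (cells X rep m) c"
  shows "Cpt f c (cell_att X c z) = cell_att Y c (cmap f c z)"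
proof -
  obtain a s where as: "c = (a, s)" "a \<in> Obj A" "s \<in> Obj R" using c by auto
  obtain \<phi> x where g: "z = vpair (enc (Idt R (Cod R \<phi>)), vpair (x, enc \<phi>))" "\<phi> \<in> Arr R" "Dom R \<phi> = s" "deg (Cod R \<phi>) = m"
    "x \<in> Ev X (a, Cod R \<phi>)" by (rule cells_rep_elim[OF z[unfolded as(1)] as(2,3)])
  show ?thesis unfolding as(1) g(1) using natural_act_R[OF f as(2) g(2,5)] g R.base_arr[OF g(2)] by simp
qed

text \<open>Three corners of \<open>cell_square\<close> are known: the latching domain by
  \<open>latch_we\<close>, the cells by \<open>wf\<close>, and the lower skeleton by
  \<open>IH\<close>. The fourth is the next skeleton.\<close>

lemma Fil_step:
  assumes rcX: "reedy_cof X" and rcY: "reedy_cof Y"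
    and wF: "\<And>r. r \<in> Obj R \<Longrightarrow> deg r = m \<Longrightarrow> slice_map A R (Fmap f X Y m) r \<in> we"
    and wf: "\<And>r. r \<in> Obj R \<Longrightarrow> deg r = m \<Longrightarrow> slice_map A R f r \<in> we"
    and IH: "Far \<Phi> (Fmap f X Y m) \<in> we"
  shows "Far \<Phi> (Fmap f X Y (Suc m)) \<in> we"
proof (rule gluing_cellular[OF cell_square[OF presheaf_src rcX] cell_square[OF presheaf_tgt rcY] AR.incl_inj AR.incl_inj
      latch_map_hom latch_we[OF wF wf] cells_map_hom[OF f presheaf_rep] cells_we[OF f presheaf_rep wf]
      Fmap_hom[OF f] IH Fmap_hom[OF f]])
  fix c z assume c: "c \<in> Obj AR_cat"
  obtain a s where as: "c = (a, s)" "a \<in> Obj A" "s \<in> Obj R" using c by auto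
  have lsub: "latch_set X m c \<subseteq> Ev (cells X rep m) c"
    using sub_latch[OF presheaf_src, of m] c Ev_latch[OF c, of X m] unfolding AR.subpresheaf_def by auto
  have EvF: "Ev (Fil Z n) c = Fset Z n c" for Z n using as by simp
  {
    assume "z \<in> Ev (latch X m) c"
    then have z: "z \<in> latch_set X m c" using Ev_latch[OF c] by simp
    have z': "z \<in> Ev (cells X rep m) c" using z lsub by blast
    have y: "cmap f c z \<in> latch_set Y m c"
      using AR.Cpt_in[OF latch_map_hom c, of z m] z Cpt_latch_map[OF c z] Ev_latch[OF c] by simp
    show "Cpt (cells_map f X Y rep m) c (Cpt (AR.incl (latch X m) (cells X rep m)) c z) =
      Cpt (AR.incl (latch Y m) (cells Y rep m)) c (Cpt (latch_map f X Y m) c z)"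
      using z z' y by (simp add: AR.Cpt_incl[OF c] Cpt_cells_map[OF c] Cpt_latch_map[OF c] Ev_latch[OF c])
    have "cell_att X c z \<in> Fset X m c" using cell_att_latch[OF presheaf_src as(2,3)] z as(1) by simp
    then show "Cpt (Fmap f X Y m) c (Cpt (attach_latch X m) c z) =
       Cpt (attach_latch Y m) c (Cpt (latch_map f X Y m) c z)"
      using z y cell_att_nat[OF c z']
      by (simp add: mk_trans_simps(3)[OF c] Ev_latch[OF c] Cpt_Fmap[OF c] Cpt_latch_map[OF c])
  next
    assume z: "z \<in> Ev (cells X rep m) c"
    have y: "cmap f c z \<in> Ev (cells Y rep m) c"
      using AR.Cpt_in[OF cells_map_hom[OF f presheaf_rep] c z] Cpt_cells_map[OF c z] by simp
    have "cell_att X c z \<in> Fset X (Suc m) c"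
      using AR.Cpt_in[OF cell_att_hom[OF presheaf_src] c z] z EvF by (simp add: mk_trans_simps(3)[OF c])
    then show "Cpt (Fmap f X Y (Suc m)) c (Cpt (attach X m) c z) =
       Cpt (attach Y m) c (Cpt (cells_map f X Y rep m) c z)"
      using z y cell_att_nat[OF c z] by (simp add: mk_trans_simps(3)[OF c] Cpt_Fmap[OF c] Cpt_cells_map[OF c])
  next
    assume "z \<in> Ev (Fil X m) c"
    then have z: "z \<in> Fset X m c" using EvF by simp
    have z': "z \<in> Fset X (Suc m) c" using z Fset_mono[of m "Suc m" X c] by auto
    have "Cpt f c z \<in> Fset Y m c" using Fset_map[OF f c z] .
    then show "Cpt (Fmap f X Y (Suc m)) c (Cpt (AR.incl (Fil X m) (Fil X (Suc m))) c z) =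
       Cpt (AR.incl (Fil Y m) (Fil Y (Suc m))) c (Cpt (Fmap f X Y m) c z)"
      using z z' by (simp add: AR.Cpt_incl[OF c] Cpt_Fmap[OF c] EvF)
  }
qed

text \<open>No degree lies below \<open>0\<close>, so both presheaves are empty, that is, coproducts
  of the empty family. \<open>\<Phi>\<close> preserves these, and \<open>coproduct_we\<close> over
  the empty index set has nothing left to check; the families in \<open>cp\<close> are
  dummies.\<close>

lemma Fil_zero: "Far \<Phi> (Fmap f X Y 0) \<in> we"
proof -
  have e: "({} :: 'v set) \<in> U" using U_infinite U_subset by blast
  have cp: "is_coproduct A.B ({} :: 'v set) (\<lambda>i. Fob \<Phi> Z) (Fob \<Phi> (Fil Z 0)) (\<lambda>i. Far \<Phi> f)" if Z: "presheaf U AR_cat Z" for Z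
  proof (rule \<Phi>_coproduct[OF e])
    show "AR.ptwise_coproduct {} (\<lambda>i. Z) (Fil Z 0) (\<lambda>i. f)"
      unfolding AR.ptwise_coproduct_def using presheaf_Fil[OF Z] by (auto simp: Fset_def)
  qed simp
  show ?thesis
    by (rule H.coproduct_we[OF e _ _ cp[OF presheaf_src] cp[OF presheaf_tgt] \<Phi>_hom[OF Fmap_hom[OF f]], of "\<lambda>i. Far \<Phi> f"]) auto
qed

text \<open>The hypothesis on latching maps is limited to degrees below \<open>m\<close>, so that it
  can be the induction hypothesis in \<open>latching_we\<close> and an established fact in
  \<open>diagonal_we\<close>.\<close>

lemma Fil_we:
  assumes rcX: "reedy_cof X" and rcY: "reedy_cof Y"
    and wf: "\<And>r. r \<in> Obj R \<Longrightarrow> slice_map A R f r \<in> we"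
  shows "(\<And>r. r \<in> Obj R \<Longrightarrow> deg r < m \<Longrightarrow> slice_map A R (Fmap f X Y (deg r)) r \<in> we) \<Longrightarrow> Far \<Phi> (Fmap f X Y m) \<in> we"
proof (induction m)
  case 0
  show ?case by (rule Fil_zero)
next
  case (Suc m)
  show ?case
    by (rule Fil_step[OF rcX rcY _ wf]) (use Suc in auto)
qed

end

end

context reedy_setting begin

text \<open>Evaluation at \<open>r\<close> is itself cellular. With it in the role of
  \<open>\<Phi>\<close>, the skeleton below \<open>deg r\<close> is built from cells of smaller
  degree, whose latching maps are weak equivalences by induction.\<close>

lemma latching_we:
  assumes f: "f \<in> hom AR.B X Y"
    and rcX: "reedy_cof X" and rcY: "reedy_cof Y"
    and wf: "\<And>r. r \<in> Obj R \<Longrightarrow> slice_map A R f r \<in> we"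
  shows "r \<in> Obj R \<Longrightarrow> slice_map A R (Fmap f X Y (deg r)) r \<in> we"
proof (induction "deg r" arbitrary: r rule: less_induct)
  case less
  interpret S: cell_induction U A R cof we deg Rm Rp enc "slice_func r"
    by (intro cell_induction.intro reedy_setting_axioms cellular_slice less.prems)
  have "Far (slice_func r) (Fmap f X Y (deg r)) \<in> we"
    by (rule S.Fil_we[OF f rcX rcY wf]) (use less.hyps in auto)
  then show ?case by (simp add: slice_func_def)
qed

lemma diagonal_we:
  assumes d: "diagonal_functor U A R we d" and f: "f \<in> hom AR.B X Y"
    and rcX: "reedy_cof X" and rcY: "reedy_cof Y"
    and wf: "\<And>r. r \<in> Obj R \<Longrightarrow> slice_map A R f r \<in> we"
  shows "Far d f \<in> we"
proof -
  interpret S: cell_induction U A R cof we deg Rm Rp enc d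
    by (intro cell_induction.intro reedy_setting_axioms cellular_diagonal d)
  interpret D: colimit_functor U AR.B A.B d
    using d unfolding diagonal_functor_def by unfold_locales auto
  have w: "Far d (Fmap f X Y m) \<in> we" for m
    by (rule S.Fil_we[OF f rcX rcY wf]) (use latching_we[OF f rcX rcY wf] in auto)
  \<comment> \<open>All inclusions between skeleta are recorded, not only successive ones, as
    \<open>preserves_seq_colimit\<close> requires.\<close>
  define u where "u Z m n = AR.incl (Fil Z m) (Fil Z n)" for Z m n
  have uh: "u Z m n \<in> hom AR.B (Fil Z m) (Fil Z n)" if "presheaf U AR_cat Z" "m \<le> n" for Z m n
    unfolding u_def by (rule AR.incl_hom[OF subpresheaf_Fil_le[OF that]])
  have iF: "AR.incl (Fil Z m) Z \<in> hom AR.B (Fil Z m) Z" if "presheaf U AR_cat Z" for Z m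
    by (rule AR.incl_hom[OF subpresheaf_Fil[OF that]])
  have EvF: "Ev (Fil Z n) c = Fset Z n c" if "c \<in> Obj AR_cat" for Z n c using that by (auto simp: Fil_def)
  have col: "is_seq_colimit A.B (\<lambda>n. Fob d (Fil Z n)) (\<lambda>n. Far d (u Z n (Suc n))) (Fob d Z) (\<lambda>n. Far d (AR.incl (Fil Z n) Z))"
    if Z: "presheaf U AR_cat Z" for Z
  proof (rule D.preserves_seq_colimit)
    show "u Z m n \<in> hom AR.B (Fil Z m) (Fil Z n)" if "m \<le> n" for m n by (rule uh[OF Z that])
    show "u Z n n = Idt AR.B (Fil Z n)" for n unfolding u_def AR.incl_def AR.Idt_B ..
    show "u Z m n \<cdot>\<^bsub>AR.B\<^esub> u Z l m = u Z l n" if "l \<le> m" "m \<le> n" for l m n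
    proof (rule AR.homB_eqI[OF AR.B_comp_hom[OF uh[OF Z that(1)] uh[OF Z that(2)]] uh[OF Z order_trans[OF that]]])
      fix c x assume c: "c \<in> Obj AR_cat" and x: "x \<in> Ev (Fil Z l) c"
      have "x \<in> Ev (Fil Z m) c" using x Fset_mono[OF that(1), of Z c] EvF[OF c] by auto
      then show "Cpt (u Z m n \<cdot>\<^bsub>AR.B\<^esub> u Z l m) c x = Cpt (u Z l n) c x"
        using AR.Cpt_cmp[OF uh[OF Z that(1)] c x] c x unfolding u_def by (simp add: AR.Cpt_incl[OF c])
    qed
    show "is_seq_colimit AR.B (Fil Z) (\<lambda>n. u Z n (Suc n)) Z (\<lambda>n. AR.incl (Fil Z n) Z)"
    proof (rule AR.ptwise_seq_colimit)
      show "u Z n (Suc n) \<in> hom AR.B (Fil Z n) (Fil Z (Suc n))" for n by (rule uh[OF Z]) simp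
      show "AR.incl (Fil Z n) Z \<in> hom AR.B (Fil Z n) Z" for n by (rule iF[OF Z])
      fix c assume c: "c \<in> Obj AR_cat"
      show "inj_on (Cpt (AR.incl (Fil Z n) Z) c) (Ev (Fil Z n) c)" for n by (rule AR.incl_inj[OF c])
      show "Cpt (AR.incl (Fil Z (Suc n)) Z) c (Cpt (u Z n (Suc n)) c x) = Cpt (AR.incl (Fil Z n) Z) c x"
        if x: "x \<in> Ev (Fil Z n) c" for n x
      proof -
        have "x \<in> Ev (Fil Z (Suc n)) c" using x Fset_mono[of n "Suc n" Z c] EvF[OF c] by auto
        then show ?thesis using x unfolding u_def by (simp add: AR.Cpt_incl[OF c])
      qed
      show "Ev Z c \<subseteq> (\<Union>n. Cpt (AR.incl (Fil Z n) Z) c ` Ev (Fil Z n) c)"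
        unfolding AR.incl_image[OF c]
      proof (rule subsetI)
        fix x assume x: "x \<in> Ev Z c"
        obtain a s where as: "c = (a, s)" "a \<in> Obj A" "s \<in> Obj R" using c by auto
        \<comment> \<open>An element at \<open>s\<close> is its own restriction along the identity;
          the bound in \<open>Fset\<close> is strict, whence the stage
          \<open>Suc (deg s)\<close>.\<close>
        have "act_R Z a (Idt R s) x \<in> Fset Z (Suc (deg s)) (a, s)"
          using FsetI[OF R.base_id(1)[OF as(3)], of x Z a "Suc (deg s)"] x as R.base_id[OF as(3)] by simp
        then have "x \<in> Ev (Fil Z (Suc (deg s))) c"
          using act_R_id[OF Z as(2,3), of x] x as EvF[OF c] by simp
        then show "x \<in> (\<Union>n. Ev (Fil Z n) c)" by blast
      qed
    qed
  qed
  note X = AR.homB_presheaf(1)[OF f] and Y = AR.homB_presheaf(2)[OF f]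
  have uc: "Far d (u Z n (Suc n)) \<in> cof" if Z: "presheaf U AR_cat Z" for Z n
    by (rule S.\<Phi>_cof[OF uh[OF Z]]) (auto simp: u_def intro: AR.incl_inj)
  have Fm: "x \<in> Fset Z (Suc n) c" if "x \<in> Fset Z n c" for x Z n c using that Fset_mono[of n "Suc n" Z c] by auto
  show ?thesis
  proof (rule H.seq_colimit_we[OF D.F_hom[OF uh[OF X]] uc[OF X] D.F_hom[OF uh[OF Y]] uc[OF Y] D.F_hom[OF Fmap_hom[OF f]] w _
        col[OF X] col[OF Y] D.F_hom[OF f]])
    fix n
    show "Far d (Fmap f X Y (Suc n)) \<cdot>\<^bsub>A.B\<^esub> Far d (u X n (Suc n)) = Far d (u Y n (Suc n)) \<cdot>\<^bsub>A.B\<^esub> Far d (Fmap f X Y n)"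
    proof (rule S.\<Phi>_square[OF uh[OF X] Fmap_hom[OF f] Fmap_hom[OF f] uh[OF Y]])
      fix c x assume c: "c \<in> Obj AR_cat" and "x \<in> Ev (Fil X n) c"
      then have x: "x \<in> Fset X n c" using EvF by simp
      then show "Cpt (Fmap f X Y (Suc n)) c (Cpt (u X n (Suc n)) c x) = Cpt (u Y n (Suc n)) c (Cpt (Fmap f X Y n) c x)"
        using Fm Fset_map[OF f c x] unfolding u_def by (simp add: AR.Cpt_incl[OF c] Cpt_Fmap[OF c] EvF[OF c])
    qed auto
    show "Far d f \<cdot>\<^bsub>A.B\<^esub> Far d (AR.incl (Fil X n) X) = Far d (AR.incl (Fil Y n) Y) \<cdot>\<^bsub>A.B\<^esub> Far d (Fmap f X Y n)"
    proof (rule S.\<Phi>_square[OF iF[OF X] f Fmap_hom[OF f] iF[OF Y]])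
      fix c x assume c: "c \<in> Obj AR_cat" and "x \<in> Ev (Fil X n) c"
      then have x: "x \<in> Fset X n c" using EvF by simp
      then show "Cpt f c (Cpt (AR.incl (Fil X n) X) c x) = Cpt (AR.incl (Fil Y n) Y) c (Cpt (Fmap f X Y n) c x)"
        using Fset_map[OF f c x] by (simp add: AR.Cpt_incl[OF c] Cpt_Fmap[OF c] EvF[OF c])
    qed
  qed auto
qed

end

theorem theorem2p8:
  fixes U :: "'v set set"
    and A :: "('a, 'b) cat"
    and R :: "('r, 's) cat"
    and d :: "(('a \<times> 'r, 'b \<times> 's, 'v) presh, ('a \<times> 'r, 'b \<times> 's, 'v) nat_trans,
               ('a, 'b, 'v) presh, ('a, 'b, 'v) nat_trans) func"
    and f :: "('a \<times> 'r, 'b \<times> 's, 'v) nat_trans"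
  assumes "set_universe U"
    and "small_category U A" and "reedy_category A degA Am Ap"
    and "small_category U R" and "reedy_category R degR Rm Rp"
    and "cisinski_structure U A cof we"
    and "diagonal_functor U A R we d"
    and "f \<in> hom (psh U (prod_cat A R)) X Y"
    and "reedy_cofibrant R Rm (psh U A) cof (diagram A R X)"
    and "reedy_cofibrant R Rm (psh U A) cof (diagram A R Y)"
    and "\<forall>r\<in>Obj R. slice_map A R f r \<in> we"
  shows "Far d f \<in> we"
proof -
  have "category A" "category R" "small U (Arr R)"
    using assms(2,4) unfolding small_category_def by auto
  \<comment> \<open>Smallness of the set of arrows of \<open>R\<close> provides the codes that
    representables and normal forms are made of.\<close>
  then obtain enc where enc: "inj_on enc (Arr R)" "enc ` Arr R \<in> U" unfolding small_def by blast
  have cc: "cofibration_category U (psh U A) cof we" "cof = mono_arrows (psh U A)"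
    using assms(6) unfolding cisinski_structure_def by auto
  interpret universe U by unfold_locales (rule assms(1))
  interpret A: presheaf_category U A by unfold_locales (rule \<open>category A\<close>)
  interpret R: presheaf_category U R by unfold_locales (rule \<open>category R\<close>)
  interpret AR: presheaf_category U "prod_cat A R"
    by unfold_locales (rule category_prod_cat[OF \<open>category A\<close> \<open>category R\<close>])
  interpret H: cof_category "psh U A" U cof we by unfold_locales (rule cc(1))
  interpret reedy_setting U A R cof we degR Rm Rp enc
    by unfold_locales (rule cc(2), rule assms(5), rule enc(1), rule enc(2))
  show ?thesis using diagonal_we[OF assms(7-10)] assms(11) by blast
qed

end
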